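(* Assume $F$ is analytic on $\Omega=\Omega(\hat{\mathbb{C}}\setminus\{(0),S\})$, that $\omega\in\partial\Omega$, and that $F$ has an elementary singularity at $\omega$. Without loss of generality, normalize so that the projection of $\omega$ on $\hat{\mathbb{C}}$ is $1$. Then the singularity can be eliminated by a combination of an appropriate operator $L_\beta$ and composition with a rational map such as $$\phi_0(z)=2z-z^2,\qquad \phi_1(z)=\frac{4z}{(1+z)^2},\qquad \phi_2(z)=\frac{2z}{1+z^2};$$ that is, there are $\beta$ with $\Re\beta>-1$ and such a rational map $\phi$ for which $(L_\beta F)\circ\phi$ is analytic at $z=0$ and at the point $z=1$ corresponding to the singularity.
   Context: $\hat{\mathbb{C}}=\mathbb{C}\cup\{\infty\}$. $\Omega(\hat{\mathbb{C}}\setminus\{(0),S\})$, with $S$ a discrete set of punctures, is the Riemann surface with fixed origin whose points are equivalence classes of curves originating at $0$, modulo homotopies in $\hat{\mathbb{C}}\setminus(\{0\}\cup S)$, together with the origin itself on the first sheet (so $0$ is regular on the first sheet and may be singular on other sheets); the disk of analyticity at $0$ is normalized to be the unit disk. An elementary singularity at $\omega_0$ is one of the form $$(\omega-\omega_0)^{\alpha}A(\omega)+B(\omega),\quad \alpha\in\mathbb{C}\setminus\mathbb{Z};\qquad\text{or, for }\alpha\in\mathbb{Z},\quad \frac{d^k}{d\omega^k}\big[(\omega-\omega_0)^{\alpha}\ln(\omega-\omega_0)A(\omega)\big]+B(\omega)$$ for some $\alpha\in\mathbb{C}$, $k\in\mathbb{N}$, where $A,B$ are analytic at $\omega_0$ and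 $A(\omega_0)\ne0$. For $\Re\beta>-1$, $L_\beta$ is the linear operator $$(L_\beta F)(\omega)=\omega^{-\beta}\int_0^\omega F(s)(\omega-s)^\beta\,ds,$$ where on $\Omega$ the integral is taken along a smooth curve $\gamma:[0,1]\to\Omega$ with $\gamma(0)=0$, $\gamma(1)=\omega$. The rational maps $\phi$ considered satisfy $\phi(0)=0$, $\phi(1)=1$, and $\phi-1$ has a double zero at $z=1$. "Analytic at $z=1$" refers to the branch of $L_\beta F$ at the singular point $\omega$ of $\partial\Omega$ lying over $1$, composed with $\phi$ near $z=1$.
   Formalization: The elementary form is required for every branch of ln(ω−ω₀), which excludes negative integer α in the logarithmic form; there the claim fails, e.g. F=(ln(1−ω)+iπ)/(1−ω), where L_βF keeps a term (1−ω)^β ln(1−ω) (ln² for integer β) that no such map removes. *)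

theory Defs
  imports "HOL-Complex_Analysis.Complex_Analysis"
begin

section \<open>The Riemann sphere and the surface \<open>\<Omega>\<close>\<close>

text \<open>The point \<^term>\<open>Some z\<close> is the finite point \<open>z\<close>, and \<^term>\<open>None\<close> is the point at infinity.\<close>

definition riemann_sphere :: "complex option topology" where
  "riemann_sphere = Alexandroff_compactification euclidean"

text \<open>
  Closedness makes the complement of \<open>S\<close> a Riemann surface. Infinitely many punctures are
  allowed; they then accumulate at infinity only, which closedness forces to be a puncture.
\<close>

definition discrete_punctures :: "complex option set \<Rightarrow> bool" where
  "discrete_punctures S \<longleftrightarrow>
     closedin riemann_sphere S \<and> (\<forall>z. \<not> z islimpt (Some -` S)) \<and> Some 0 \<notin> S"

text \<open>
  Curves on the sphere starting at the origin, whose interior avoids the origin and the punctures.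
  The end point is unrestricted: curves ending at a regular point give points of \<open>\<Omega>\<close>, and
  curves ending at a puncture give boundary points of \<open>\<Omega>\<close>.
\<close>

definition curves :: "complex option set \<Rightarrow> (real \<Rightarrow> complex option) set" where
  "curves S = {\<gamma>. pathin riemann_sphere \<gamma> \<and> \<gamma> 0 = Some 0 \<and>
                   (\<forall>t\<in>{0<..<1}. \<gamma> t \<notin> insert (Some 0) S)}"

definition homotopic_curves ::
    "complex option set \<Rightarrow> ((real \<Rightarrow> complex option) \<times> (real \<Rightarrow> complex option)) set" where
  "homotopic_curves S = {(\<gamma>, \<eta>). \<gamma> \<in> curves S \<and> \<eta> \<in> curves S \<and>
     homotopic_with (\<lambda>\<kappa>. \<kappa> \<in> curves S \<and> \<kappa> 1 = \<gamma> 1) (top_of_set {0..1}) riemann_sphere \<gamma> \<eta>}"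

type_synonym surface_point = "(real \<Rightarrow> complex option) set"

definition curve_class :: "complex option set \<Rightarrow> (real \<Rightarrow> complex option) \<Rightarrow> surface_point" where
  "curve_class S \<gamma> = homotopic_curves S `` {\<gamma>}"

definition fibre :: "complex option set \<Rightarrow> complex option \<Rightarrow> surface_point set" where
  "fibre S p = {curve_class S \<gamma> | \<gamma>. \<gamma> \<in> curves S \<and> \<gamma> 1 = p}"

text \<open>The constant curve is not in \<^term>\<open>curves S\<close>, so the origin is not one of the other classes.\<close>

definition origin :: surface_point where
  "origin = {\<lambda>_. Some 0}"

definition Omega :: "complex option set \<Rightarrow> surface_point set" where
  "Omega S = insert origin (\<Union>p \<in> - insert (Some 0) S. fibre S p)"

text \<open>
  Points of the boundary of \<open>\<Omega>\<close> lying over a puncture. (The boundary points over \<open>0\<close> on sheets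
  other than the first project to \<open>0\<close> and are not needed here.)
\<close>

definition Omega_boundary :: "complex option set \<Rightarrow> surface_point set" where
  "Omega_boundary S = (\<Union>p\<in>S. fibre S p)"

definition curve_join ::
    "(real \<Rightarrow> complex option) \<Rightarrow> (real \<Rightarrow> complex option) \<Rightarrow> real \<Rightarrow> complex option" where
  "curve_join \<gamma> \<eta> = (\<lambda>t. if t \<le> 1/2 then \<gamma> (2 * t) else \<eta> (2 * t - 1))"

definition sphere_inverse :: "complex \<Rightarrow> complex option" where
  "sphere_inverse z = (if z = 0 then None else Some (inverse z))"

text \<open>
  The complex structure of \<open>\<Omega>\<close> is lifted from the sphere: near the class of \<open>\<gamma>\<close>, points are
  obtained by continuing \<open>\<gamma>\<close> along segments in one of the two standard charts of the sphere.
\<close>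

definition analytic_at_point ::
    "complex option set \<Rightarrow> (surface_point \<Rightarrow> complex) \<Rightarrow> surface_point \<Rightarrow> bool" where
  "analytic_at_point S F P \<longleftrightarrow>
     (if P = origin
      then (\<lambda>w. F (if w = 0 then origin else curve_class S (Some \<circ> linepath 0 w))) analytic_on {0}
      else \<forall>\<gamma>\<in>P. \<forall>chart\<in>{Some, sphere_inverse}. \<forall>z. chart z = \<gamma> 1 \<longrightarrow>
             (\<lambda>w. F (curve_class S (curve_join \<gamma> (chart \<circ> linepath z w)))) analytic_on {z})"

definition analytic_on_Omega :: "complex option set \<Rightarrow> (surface_point \<Rightarrow> complex) \<Rightarrow> bool" where
  "analytic_on_Omega S F \<longleftrightarrow> (\<forall>P\<in>Omega S. analytic_at_point S F P)"


section \<open>Neighbourhoods of a boundary point over \<open>1\<close>\<close>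

text \<open>
  Let \<open>\<omega>\<close> be a boundary point over \<open>1\<close>. A neighbourhood of \<open>\<omega>\<close> in \<open>\<Omega>\<close> is a covering of a
  punctured disk around \<open>1\<close>, on which \<open>\<zeta> = ln (w - 1)\<close> serves as a coordinate, \<open>w\<close> being the
  projection to the sphere. Such a coordinate is fixed by a finite (piecewise) smooth curve \<open>\<delta>\<close>
  from \<open>0\<close> to a point \<open>1 + exp \<zeta>0\<close> near \<open>1\<close> that, prolonged radially to \<open>1\<close>, represents \<open>\<omega>\<close>,
  together with the logarithm \<open>\<zeta>0\<close>, i.e. the branch of \<open>ln (w - 1)\<close>, at its end point.
\<close>

definition log_coordinate ::
    "complex option set \<Rightarrow> surface_point \<Rightarrow> (real \<Rightarrow> complex) \<Rightarrow> complex \<Rightarrow> bool" where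
  "log_coordinate S \<omega> \<delta> \<zeta>0 \<longleftrightarrow>
     valid_path \<delta> \<and> pathfinish \<delta> = 1 + exp \<zeta>0 \<and> Some \<circ> \<delta> \<in> curves S \<and>
     (\<forall>w. 0 < dist w 1 \<and> dist w 1 \<le> exp (Re \<zeta>0) \<longrightarrow> Some w \<notin> insert (Some 0) S) \<and>
     Some \<circ> (\<delta> +++ linepath (1 + exp \<zeta>0) 1) \<in> \<omega>"

text \<open>
  The curve \<open>\<delta>\<close> followed by the logarithmic spiral around \<open>1\<close> from \<open>\<zeta>0\<close> to \<open>\<zeta>\<close>; for
  \<open>Re \<zeta> \<le> Re \<zeta>0\<close> its class is the point of \<open>\<Omega>\<close> with coordinate \<open>\<zeta>\<close>.
\<close>

definition spiral_curve :: "(real \<Rightarrow> complex) \<Rightarrow> complex \<Rightarrow> complex \<Rightarrow> real \<Rightarrow> complex" where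
  "spiral_curve \<delta> \<zeta>0 \<zeta> = \<delta> +++ (\<lambda>t. 1 + exp (linepath \<zeta>0 \<zeta> t))"

definition log_point ::
    "complex option set \<Rightarrow> (real \<Rightarrow> complex) \<Rightarrow> complex \<Rightarrow> complex \<Rightarrow> surface_point" where
  "log_point S \<delta> \<zeta>0 \<zeta> = curve_class S (Some \<circ> spiral_curve \<delta> \<zeta>0 \<zeta>)"


section \<open>Elementary singularities\<close>

text \<open>The derivation \<open>d/dw\<close> in the coordinate \<open>\<zeta> = ln (w - 1)\<close>.\<close>

definition deriv_w :: "(complex \<Rightarrow> complex) \<Rightarrow> complex \<Rightarrow> complex" where
  "deriv_w g = (\<lambda>\<zeta>. exp (- \<zeta>) * deriv g \<zeta>)"

text \<open>
  With \<open>w = 1 + exp \<zeta>\<close>, the terms \<open>exp (\<alpha> * \<zeta>)\<close> and \<open>\<zeta>\<close> are \<open>(w - 1) powr \<alpha>\<close> and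
  \<open>ln (w - 1)\<close>. The exponents \<open>\<alpha>\<close> and \<open>k\<close> belong to the singularity. The form is required for
  every logarithmic coordinate, that is, for every choice of the branch of \<open>ln (w - 1)\<close>; the
  analytic functions \<open>A\<close> and \<open>B\<close> may depend on that choice. Passing to another branch adds a
  multiple of the \<open>k\<close>-th derivative of \<open>(w - 1) powr \<alpha> * A\<close> to the logarithmic form. This is absorbed
  in \<open>B\<close> if \<open>\<alpha> \<ge> 0\<close>; if \<open>\<alpha> < 0\<close> it has a pole, so that a function having the logarithmic form with
  negative \<open>\<alpha>\<close> for one branch does not have it for the others.
\<close>

definition elementary_singularity ::
    "complex option set \<Rightarrow> (surface_point \<Rightarrow> complex) \<Rightarrow> surface_point \<Rightarrow> bool" where
  "elementary_singularity S F \<omega> \<longleftrightarrow>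
     (\<exists>\<alpha>. \<alpha> \<notin> \<int> \<and>
        (\<forall>\<delta> \<zeta>0. log_coordinate S \<omega> \<delta> \<zeta>0 \<longrightarrow>
           (\<exists>A B \<rho>. A analytic_on {1} \<and> B analytic_on {1} \<and> A 1 \<noteq> 0 \<and>
              (\<forall>\<zeta>. Re \<zeta> < \<rho> \<longrightarrow>
                 F (log_point S \<delta> \<zeta>0 \<zeta>) = exp (\<alpha> * \<zeta>) * A (1 + exp \<zeta>) + B (1 + exp \<zeta>))))) \<or>
     (\<exists>\<alpha> k. \<alpha> \<in> \<int> \<and>
        (\<forall>\<delta> \<zeta>0. log_coordinate S \<omega> \<delta> \<zeta>0 \<longrightarrow>
           (\<exists>A B \<rho>. A analytic_on {1} \<and> B analytic_on {1} \<and> A 1 \<noteq> 0 \<and>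
              (\<forall>\<zeta>. Re \<zeta> < \<rho> \<longrightarrow>
                 F (log_point S \<delta> \<zeta>0 \<zeta>) =
                   (deriv_w ^^ k) (\<lambda>x. exp (\<alpha> * x) * x * A (1 + exp x)) \<zeta> + B (1 + exp \<zeta>)))))"


section \<open>The operators \<open>L\<^sub>\<beta>\<close>\<close>

text \<open>
  \<^term>\<open>has_L \<beta> S F g v\<close> states that \<open>v\<close> is the value of \<open>L\<^sub>\<beta> F\<close> at the class of the finite
  curve \<open>g\<close>, computed by integration along \<open>g\<close>. The integrand takes \<open>F\<close> on the sheet reached along
  \<open>g\<close>. The continuous function \<open>l\<close> is a branch of \<open>ln (g 1 - s)\<close> along \<open>g\<close>, and \<open>l 0\<close> is the
  corresponding logarithm of \<open>g 1\<close>; only the quotient of the two powers matters, so \<open>v\<close> does not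
  depend on the choice of \<open>l\<close>. At \<open>t = 0\<close> the class is empty instead of \<^term>\<open>origin\<close>, which does
  not affect the integral.
\<close>

definition has_L ::
    "complex \<Rightarrow> complex option set \<Rightarrow> (surface_point \<Rightarrow> complex) \<Rightarrow> (real \<Rightarrow> complex) \<Rightarrow> complex \<Rightarrow> bool"
  where
  "has_L \<beta> S F g v \<longleftrightarrow>
     (\<exists>l I. continuous_on {0..<1} l \<and> (\<forall>t\<in>{0..<1}. exp (l t) = g 1 - g t) \<and>
        ((\<lambda>t. F (curve_class S (Some \<circ> subpath 0 t g)) * exp (\<beta> * l t) *
               vector_derivative g (at t within {0..1})) has_integral I) {0..1} \<and>
        v = exp (- \<beta> * l 0) * I)"


section \<open>Elimination of the singularity\<close>

definition rational_map :: "(complex \<Rightarrow> complex) \<Rightarrow> bool" where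
  "rational_map \<phi> \<longleftrightarrow>
     (\<exists>p q. poly q 0 \<noteq> 0 \<and> (\<forall>z. \<phi> z = poly p z / poly q z)) \<and>
     \<phi> 0 = 0 \<and> \<phi> 1 = 1 \<and> zorder (\<lambda>z. \<phi> z - 1) 1 = 2"

definition L_comp_analytic_at_0 ::
    "complex \<Rightarrow> complex option set \<Rightarrow> (surface_point \<Rightarrow> complex) \<Rightarrow> (complex \<Rightarrow> complex) \<Rightarrow> bool" where
  "L_comp_analytic_at_0 \<beta> S F \<phi> \<longleftrightarrow>
     (\<exists>G. G analytic_on {0} \<and> (\<forall>\<^sub>F z in at 0. has_L \<beta> S F (linepath 0 (\<phi> z)) (G z)))"

text \<open>
  With \<open>z = 1 + exp u\<close>, a continuous solution \<open>\<zeta>\<close> of \<open>1 + exp (\<zeta> u) = \<phi> (1 + exp u)\<close>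
  is a lift of \<open>\<phi>\<close> to the neighbourhood of \<open>\<omega>\<close> in \<open>\<Omega>\<close>. Such lifts exist
  because \<open>\<phi> - 1\<close> has an isolated zero at \<open>1\<close>, and they differ by multiples of \<open>2 * pi * \<i>\<close>. For
  each of them the composition has to extend analytically to \<open>z = 1\<close>.
\<close>

definition L_comp_analytic_at_1 ::
    "complex \<Rightarrow> complex option set \<Rightarrow> (surface_point \<Rightarrow> complex) \<Rightarrow> surface_point \<Rightarrow>
     (complex \<Rightarrow> complex) \<Rightarrow> bool" where
  "L_comp_analytic_at_1 \<beta> S F \<omega> \<phi> \<longleftrightarrow>
     (\<forall>\<delta> \<zeta>0 \<zeta> \<rho>. log_coordinate S \<omega> \<delta> \<zeta>0 \<and> continuous_on {u. Re u < \<rho>} \<zeta> \<and>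
        (\<forall>u. Re u < \<rho> \<longrightarrow> 1 + exp (\<zeta> u) = \<phi> (1 + exp u)) \<longrightarrow>
        (\<exists>G \<rho>'. G analytic_on {1} \<and>
           (\<forall>u. Re u < \<rho>' \<longrightarrow> has_L \<beta> S F (spiral_curve \<delta> \<zeta>0 (\<zeta> u)) (G (1 + exp u)))))"

lemma rational_map_phi0: "rational_map (\<lambda>z. 2 * z - z\<^sup>2)"
proof -
  have "zorder (\<lambda>z::complex. (2 * z - z\<^sup>2) - 1) 1 = 2"
    by (rule zorder_eqI[where S = UNIV and g = "\<lambda>_. - 1"])
       (auto simp: power2_eq_square algebra_simps power_int_def)
  moreover have "\<forall>z. 2 * z - z\<^sup>2 = poly [:0, 2, - 1:] z / poly 1 (z::complex)"
    by (auto simp: power2_eq_square algebra_simps)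
  moreover have "poly 1 (0::complex) \<noteq> 0"
    by simp
  ultimately show ?thesis
    unfolding rational_map_def by (intro conjI) (blast | simp)+
qed

lemma rational_map_phi1: "rational_map (\<lambda>z. 4 * z / (1 + z)\<^sup>2)"
proof -
  have "zorder (\<lambda>z::complex. 4 * z / (1 + z)\<^sup>2 - 1) 1 = 2"
  proof (rule zorder_eqI[where S = "- {- 1}" and g = "\<lambda>z. - 1 / (1 + z)\<^sup>2"])
    show "(\<lambda>z. - 1 / (1 + z)\<^sup>2) holomorphic_on - {- 1 :: complex}"
      by (intro holomorphic_intros) (auto simp: add_eq_0_iff)
    show "4 * z / (1 + z)\<^sup>2 - 1 = - 1 / (1 + z)\<^sup>2 * (z - 1) powi 2"
      if "z \<in> - {- 1}" for z :: complex
    proof -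
      have "1 + z \<noteq> 0" using that by (auto simp: add_eq_0_iff)
      then have "4 * z / (1 + z)\<^sup>2 - 1 = (4 * z - (1 + z)\<^sup>2) / (1 + z)\<^sup>2"
        by (simp add: diff_divide_distrib)
      also have "4 * z - (1 + z)\<^sup>2 = - ((z - 1)\<^sup>2)"
        by (simp add: power2_eq_square algebra_simps)
      finally show ?thesis by (simp add: power_int_def)
    qed
  qed auto
  moreover have "\<forall>z. 4 * z / (1 + z)\<^sup>2 = poly [:0, 4:] z / poly [:1, 2, 1:] (z::complex)"
    by (auto simp: power2_eq_square algebra_simps)
  moreover have "poly [:1, 2, 1:] (0::complex) \<noteq> 0"
    by simp
  ultimately show ?thesis
    unfolding rational_map_def by (intro conjI) (blast | simp)+
qed

lemma rational_map_phi2: "rational_map (\<lambda>z. 2 * z / (1 + z\<^sup>2))"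
proof -
  have "zorder (\<lambda>z::complex. 2 * z / (1 + z\<^sup>2) - 1) 1 = 2"
  proof (rule zorder_eqI[where S = "- {\<i>, - \<i>}" and g = "\<lambda>z. - 1 / (1 + z\<^sup>2)"])
    have *: "1 + z\<^sup>2 \<noteq> 0" if "z \<in> - {\<i>, - \<i>}" for z :: complex
    proof
      assume "1 + z\<^sup>2 = 0"
      then have "(z - \<i>) * (z + \<i>) = 0" by (simp add: algebra_simps power2_eq_square)
      then show False using that by (auto simp: add_eq_0_iff2)
    qed
    then show "(\<lambda>z. - 1 / (1 + z\<^sup>2)) holomorphic_on - {\<i>, - \<i>}"
      by (intro holomorphic_intros) auto
    show "2 * z / (1 + z\<^sup>2) - 1 = - 1 / (1 + z\<^sup>2) * (z - 1) powi 2"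
      if "z \<in> - {\<i>, - \<i>}" for z :: complex
    proof -
      have "2 * z / (1 + z\<^sup>2) - 1 = (2 * z - (1 + z\<^sup>2)) / (1 + z\<^sup>2)"
        using *[OF that] by (simp add: diff_divide_distrib)
      also have "2 * z - (1 + z\<^sup>2) = - ((z - 1)\<^sup>2)"
        by (simp add: power2_eq_square algebra_simps)
      finally show ?thesis by (simp add: power_int_def)
    qed
  qed (auto simp: complex_eq_iff)
  moreover have "\<forall>z. 2 * z / (1 + z\<^sup>2) = poly [:0, 2:] z / poly [:1, 0, 1:] (z::complex)"
    by (auto simp: power2_eq_square algebra_simps)
  moreover have "poly [:1, 0, 1:] (0::complex) \<noteq> 0"
    by simp
  ultimately show ?thesis
    unfolding rational_map_def by (intro conjI) (blast | simp)+
qed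

end

theory Submission
  imports Defs
begin

text \<open>
  Near the singularity write \<open>w = 1 + exp \<zeta>\<close> and let \<open>f \<zeta>\<close> be the value of \<open>F\<close> at the point with
  coordinate \<open>\<zeta>\<close>. The only consequences of the elementary form that matter are a growth bound
  \<open>\<bar>f \<zeta>\<bar> \<le> C * exp (- N * Re \<zeta>)\<close> and a first-order monodromy relation
  \<open>f (\<zeta> + 2 * pi * \<i>) = c * f \<zeta> + B (1 + exp \<zeta>)\<close> with \<open>B\<close> analytic at \<open>1\<close>
  (\<open>elementary_singularity_monodromy\<close>). In the case of a power, \<open>c = exp (2 * pi * \<i> * \<alpha>)\<close>. In the
  case of a logarithm, \<open>c = 1\<close>; there \<open>\<alpha> < 0\<close> is impossible, because the form is required for
  every branch of the logarithm and the jump between two sheets would have a pole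
  (\<open>log_singularity_exponent_nonneg\<close>).

  Choose \<open>\<beta>\<close> with \<open>c * exp (2 * pi * \<i> * \<beta>) = - 1\<close> and with real part as large as the growth of
  \<open>F\<close> requires, and take \<open>\<phi> z = 2 * z - z\<^sup>2\<close>. The integral defining \<open>L\<^sub>\<beta> F\<close> at \<open>w\<close> is the sum of two
  integrals. The one along the curve \<open>\<delta>\<close> is analytic in \<open>w\<close> near \<open>1\<close>, since \<open>\<delta>\<close> stays
  away from \<open>1\<close> (\<open>holomorphic_path_integral_parameter\<close>). The other one, \<open>S \<zeta>\<close>, runs over the spiral
  around \<open>1\<close>, and it is computed in the coordinate \<open>\<zeta>\<close>. One turn around \<open>1\<close> multiplies
  \<open>(w - s) powr \<beta>\<close> by \<open>exp (2 * pi * \<i> * \<beta>)\<close>, so that \<open>S (\<zeta> + 2 * pi * \<i>) + S \<zeta>\<close> is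
  \<open>2 * pi * \<i>\<close>-periodic up to the contribution of \<open>B\<close>, which is periodic as well: the function
  \<open>B s * (w - s) powr \<beta>\<close> has the primitive \<open>- (w - s) powr (\<beta> + 1) * Q s\<close>, with \<open>Q\<close> analytic, and
  this vanishes at \<open>s = w\<close> on every sheet. Hence \<open>S\<close> has the period \<open>4 * pi * \<i>\<close>
  (\<open>spiral_integral_periodic\<close>). As \<open>\<phi> - 1\<close> has a double zero, \<open>\<zeta> = 2 * u + const\<close> for
  \<open>z = 1 + exp u\<close>, and \<open>S\<close> becomes a single-valued function of \<open>z\<close> around \<open>1\<close>. It grows at most
  linearly in \<open>u\<close>, so its singularity is removable
  (\<open>spiral_integral_double_cover_analytic\<close>).

  The values of \<open>F\<close> belong to homotopy classes of curves. That they are locally holomorphic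
  functions of the end point along a curve, also at the origin and in the coordinate \<open>\<zeta>\<close>, follows
  from explicit homotopies.
\<close>

section \<open>Contour integrals depending on a parameter\<close>

text \<open>
  By Morera's theorem and Fubini's theorem for contour integrals; no derivative of \<open>h\<close> in the
  parameter has to be continuous.
\<close>
lemma holomorphic_on_contour_integral_linepath:
  fixes h :: "complex \<Rightarrow> complex \<Rightarrow> complex"
  assumes U: "open U"
    and cont: "continuous_on (U \<times> closed_segment a b) (\<lambda>(w, x). h w x)"
    and hol: "\<And>x. x \<in> closed_segment a b \<Longrightarrow> (\<lambda>w. h w x) holomorphic_on U"
  shows "(\<lambda>w. contour_integral (linepath a b) (h w)) holomorphic_on U"
proof -
  have seg: "linepath a b t \<in> closed_segment a b" if "t \<in> {0..1}" for t
    using that by (auto simp: linepath_in_path)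
  have eq: "contour_integral (linepath a b) (h w) =
              integral (cbox 0 1) (\<lambda>t. h w (linepath a b t) * (b - a))" for w
    by (simp add: contour_integral_integral cbox_interval)
  have "continuous_on U (\<lambda>w. integral (cbox 0 1) (\<lambda>t. h w (linepath a b t) * (b - a)))"
  proof (rule integral_continuous_on_param)
    have "continuous_on (U \<times> cbox 0 1) ((\<lambda>(w, x). h w x) \<circ> (\<lambda>(w, t). (w, linepath a b t)))"
    proof (rule continuous_on_compose[OF _ continuous_on_subset[OF cont]])
      show "continuous_on (U \<times> cbox 0 1) (\<lambda>(w, t). (w, linepath a b t))"
        by (auto intro!: continuous_intros simp: case_prod_unfold linepath_def)
      show "(\<lambda>(w, t). (w, linepath a b t)) ` (U \<times> cbox 0 1) \<subseteq> U \<times> closed_segment a b"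
        using seg by auto
    qed
    then show "continuous_on (U \<times> cbox 0 1) (\<lambda>(w, t). h w (linepath a b t) * (b - a))"
      by (auto intro!: continuous_intros simp: case_prod_unfold o_def)
  qed
  then have c: "continuous_on U (\<lambda>w. contour_integral (linepath a b) (h w))"
    by (simp only: eq)
  have "(\<lambda>w. contour_integral (linepath a b) (h w)) analytic_on U"
  proof (rule Morera_triangle[OF c U], rule impI)
    fix p q r assume sub: "convex hull {p, q, r} \<subseteq> U"
    let ?T = "linepath p q +++ linepath q r +++ linepath r p"
    have segs: "closed_segment p q \<subseteq> U" "closed_segment q r \<subseteq> U" "closed_segment r p \<subseteq> U"
      by (rule subset_trans[OF closed_segment_subset sub]; simp add: hull_inc)+
    have sw: "contour_integral (linepath u v) (\<lambda>w. contour_integral (linepath a b) (h w)) =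
          contour_integral (linepath a b) (\<lambda>x. contour_integral (linepath u v) (\<lambda>w. h w x))"
      if "closed_segment u v \<subseteq> U" for u v
      by (rule contour_integral_swap)
         (use that in \<open>auto intro!: continuous_on_subset[OF cont]\<close>)
    have ci: "(\<lambda>x. contour_integral (linepath u v) (\<lambda>w. h w x)) contour_integrable_on linepath a b"
      if "closed_segment u v \<subseteq> U" for u v
    proof (rule contour_integrable_continuous_linepath)
      have eq': "contour_integral (linepath u v) (\<lambda>w. h w x) =
              integral (cbox 0 1) (\<lambda>t. h (linepath u v t) x * (v - u))" for x
        by (simp add: contour_integral_integral cbox_interval)
      have "continuous_on (closed_segment a b)
              (\<lambda>x. integral (cbox 0 1) (\<lambda>t. h (linepath u v t) x * (v - u)))"
      proof (rule integral_continuous_on_param)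
        have "linepath u v t \<in> U" if "t \<in> {0..1}" for t
          using that \<open>closed_segment u v \<subseteq> U\<close> by (auto simp: linepath_in_path)
        then have "continuous_on (closed_segment a b \<times> cbox 0 1)
            ((\<lambda>(w, x). h w x) \<circ> (\<lambda>(x, t). (linepath u v t, x)))"
          by (intro continuous_on_compose continuous_on_subset[OF cont])
             (auto intro!: continuous_intros simp: case_prod_unfold linepath_def)
        then show "continuous_on (closed_segment a b \<times> cbox 0 1)
            (\<lambda>(x, t). h (linepath u v t) x * (v - u))"
          by (auto intro!: continuous_intros simp: case_prod_unfold o_def)
      qed
      then show "continuous_on (closed_segment a b) (\<lambda>x. contour_integral (linepath u v) (\<lambda>w. h w x))"
        by (simp only: eq')
    qed
    have tri: "contour_integral (linepath p q) (\<lambda>w. h w x) + contour_integral (linepath q r) (\<lambda>w. h w x) +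
               contour_integral (linepath r p) (\<lambda>w. h w x) = 0" if "x \<in> closed_segment a b" for x
    proof -
      have hx: "(\<lambda>w. h w x) holomorphic_on convex hull {p, q, r}"
        using hol[OF that] sub holomorphic_on_subset by blast
      have "((\<lambda>w. h w x) has_contour_integral 0) ?T"
        using Cauchy_theorem_triangle[OF hx] .
      moreover have "(\<lambda>w. h w x) contour_integrable_on linepath u v" if "closed_segment u v \<subseteq> U" for u v
        using contour_integrable_holomorphic_simple[OF hol[OF \<open>x \<in> closed_segment a b\<close>] U] that by auto
      ultimately show ?thesis
        using segs by (auto dest!: contour_integral_unique simp: contour_integrable_joinI add.assoc)
    qed
    have "contour_integral (linepath a b) (\<lambda>x. contour_integral (linepath p q) (\<lambda>w. h w x) +
             contour_integral (linepath q r) (\<lambda>w. h w x) + contour_integral (linepath r p) (\<lambda>w. h w x))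
          = contour_integral (linepath a b) (\<lambda>x. 0)"
      by (rule contour_integral_cong) (use tri in auto)
    then show "contour_integral (linepath p q) (\<lambda>w. contour_integral (linepath a b) (h w)) +
       contour_integral (linepath q r) (\<lambda>w. contour_integral (linepath a b) (h w)) +
       contour_integral (linepath r p) (\<lambda>w. contour_integral (linepath a b) (h w)) = 0"
      using segs by (simp add: sw ci contour_integral_add contour_integrable_add)
  qed
  then show ?thesis
    by (rule analytic_imp_holomorphic)
qed

lemma norm_powr_le_complex:
  fixes q b :: complex
  assumes "q \<noteq> 0"
  shows "norm (q powr b) \<le> norm q powr Re b * exp (pi * \<bar>Im b\<bar>)"
proof -
  have "norm (q powr b) = exp (Re b * ln (norm q) - Im b * Im (Ln q))"
    using assms by (simp add: powr_def)
  also have "\<dots> = norm q powr Re b * exp (- (Im b * Im (Ln q)))"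
    using assms by (simp add: powr_def exp_add[symmetric])
  also have "- (Im b * Im (Ln q)) \<le> pi * \<bar>Im b\<bar>"
  proof -
    have "\<bar>Im (Ln q)\<bar> \<le> pi" using assms mpi_less_Im_Ln[of q] Im_Ln_le_pi[of q] by linarith
    then have "\<bar>Im b * Im (Ln q)\<bar> \<le> \<bar>Im b\<bar> * pi"
      by (simp add: abs_mult mult_left_mono)
    then show ?thesis by (simp add: mult.commute)
  qed
  finally show ?thesis
    by (simp add: mult_left_mono)
qed

text \<open>
  The point \<open>0\<close> is included because it is the end point of all the integrals below.
\<close>
lemma continuous_on_powr_right_half_plane:
  assumes "Re b > 0"
  shows "continuous_on {q. Re q > 0 \<or> q = 0} (\<lambda>q::complex. q powr b)"
proof -
  have "continuous (at q within {q. Re q > 0 \<or> q = 0}) (\<lambda>q. q powr b)" if "Re q > 0 \<or> q = 0" for q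
  proof (cases "q = 0")
    case False
    then have "q \<notin> \<real>\<^sub>\<le>\<^sub>0" using that by (auto simp: complex_nonpos_Reals_iff)
    then have "(\<lambda>q. q powr b) field_differentiable at q"
      unfolding field_differentiable_def by (intro exI) (rule has_field_derivative_powr)
    then show ?thesis
      using field_differentiable_imp_continuous_at continuous_at_imp_continuous_at_within by blast
  next
    case True
    have "((\<lambda>q::complex. norm q powr Re b * exp (pi * \<bar>Im b\<bar>)) \<longlongrightarrow> 0) (at 0)"
    proof -
      have "((\<lambda>q::complex. norm q powr Re b) \<longlongrightarrow> 0) (at 0)"
        using assms by (intro tendsto_zero_powrI[where b = "Re b"] tendsto_norm_zero tendsto_ident_at) auto
      then show ?thesis by (rule tendsto_mult_left_zero)
    qed
    then have "((\<lambda>q. q powr b) \<longlongrightarrow> 0) (at 0)"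
      by (rule Lim_null_comparison[rotated]) (auto simp: eventually_at_filter norm_powr_le_complex)
    then have "((\<lambda>q. q powr b) \<longlongrightarrow> 0) (at 0 within {q. Re q > 0 \<or> q = 0})"
      by (rule tendsto_within_subset) auto
    then show ?thesis by (simp add: True continuous_within)
  qed
  then show ?thesis by (auto simp: continuous_on_eq_continuous_within)
qed

lemma has_integral_along_path_primitive:
  fixes P f :: "complex \<Rightarrow> complex"
  assumes g: "valid_path g" and ab: "0 \<le> a" "a \<le> b" "b \<le> 1"
    and D: "\<And>t. t \<in> {a..b} \<Longrightarrow> g t \<in> D" "open D"
    and P: "\<And>z. z \<in> D \<Longrightarrow> (P has_field_derivative f z) (at z)"
  shows "((\<lambda>t. f (g t) * vector_derivative g (at t within {0..1})) has_integral (P (g b) - P (g a))) {a..b}"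
proof -
  obtain K where K: "finite K" "g C1_differentiable_on {0..1} - K" "continuous_on {0..1} g"
    using g by (auto simp: valid_path_def piecewise_C1_differentiable_on_def)
  show ?thesis
  proof (rule fundamental_theorem_of_calculus_interior_strong[where f = "\<lambda>t. P (g t)", OF K(1) ab(2)])
    have "continuous_on D P"
      using P DERIV_isCont by (blast intro: continuous_at_imp_continuous_on)
    moreover have "continuous_on {a..b} g" by (rule continuous_on_subset[OF K(3)]) (use ab in auto)
    ultimately show "continuous_on {a..b} (\<lambda>t. P (g t))"
      by (rule continuous_on_compose2) (use D in auto)
    fix t assume t: "t \<in> {a<..<b} - K"
    then have t01: "0 < t" "t < 1" using ab by auto
    then have "t \<in> {0..1} - K" using t by auto
    then have "g differentiable at t"
      using K(2) by (auto simp: C1_differentiable_on_eq)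
    then have gt: "(g has_vector_derivative vector_derivative g (at t)) (at t)"
      by (simp add: vector_derivative_works)
    have vd: "vector_derivative g (at t within {0..1}) = vector_derivative g (at t)"
      using gt t01 by (intro vector_derivative_at_within_ivl) auto
    have "g t \<in> D" using D(1) t by auto
    then have "(P \<circ> g has_vector_derivative vector_derivative g (at t) * f (g t)) (at t)"
      by (intro field_vector_diff_chain_at gt P)
    then show "((\<lambda>t. P (g t)) has_vector_derivative f (g t) * vector_derivative g (at t within {0..1}))
        (at t)"
      by (simp add: vd o_def mult.commute)
  qed
qed

text \<open>
  The factor \<open>m\<close> is a function of the curve parameter only, but near each parameter it is a
  holomorphic function of the point on the curve. A derivative of a piecewise differentiable curve
  need not be absolutely integrable, so the integral is computed on short pieces with local
  primitives, that is, as an integral over chords. The parameter \<open>t = 0\<close> is left out of the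
  hypothesis; a single value of \<open>m\<close> does not affect the integral.
\<close>
lemma holomorphic_path_integral_parameter:
  fixes k :: "complex \<Rightarrow> complex \<Rightarrow> complex" and m :: "real \<Rightarrow> complex"
  assumes g: "valid_path g" and W: "open W" and V: "open V" "path_image g \<subseteq> V"
    and k: "continuous_on (W \<times> V) (\<lambda>(w, s). k w s)"
      "\<And>w. w \<in> W \<Longrightarrow> k w holomorphic_on V" "\<And>s. s \<in> V \<Longrightarrow> (\<lambda>w. k w s) holomorphic_on W"
    and loc: "\<And>t0. t0 \<in> {0..1} \<Longrightarrow> \<exists>f r e. r > 0 \<and> e > 0 \<and> f holomorphic_on ball (g t0) r \<and>
        (\<forall>t\<in>{0<..1}. \<bar>t - t0\<bar> < e \<longrightarrow> g t \<in> ball (g t0) r \<and> m t = f (g t))"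
  shows "\<exists>D. D holomorphic_on W \<and>
    (\<forall>w\<in>W. ((\<lambda>t. m t * k w (g t) * vector_derivative g (at t within {0..1})) has_integral D w) {0..1})"
proof -
  define Q where "Q a b \<longleftrightarrow> (0 \<le> a \<and> b \<le> 1 \<longrightarrow> (\<exists>D. D holomorphic_on W \<and>
    (\<forall>w\<in>W. ((\<lambda>t. m t * k w (g t) * vector_derivative g (at t within {0..1}))
        has_integral D w) {a..b})))" for a b
  have "Q 0 1"
  proof (rule Bolzano[of 0 1 Q])
    fix a b c assume Q: "Q a b" "Q b c" "a \<le> b" "b \<le> c"
    show "Q a c"
      unfolding Q_def
    proof
      assume ac: "0 \<le> a \<and> c \<le> 1"
      have ab: "0 \<le> a \<and> b \<le> 1" and bc: "0 \<le> b \<and> c \<le> 1" using ac Q by auto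
      obtain D1 where D1: "D1 holomorphic_on W"
        "\<And>w. w \<in> W \<Longrightarrow> ((\<lambda>t. m t * k w (g t) * vector_derivative g (at t within {0..1}))
            has_integral D1 w) {a..b}"
        using Q(1) ab unfolding Q_def by blast
      obtain D2 where D2: "D2 holomorphic_on W"
        "\<And>w. w \<in> W \<Longrightarrow> ((\<lambda>t. m t * k w (g t) * vector_derivative g (at t within {0..1}))
            has_integral D2 w) {b..c}"
        using Q(2) bc unfolding Q_def by blast
      show "\<exists>D. D holomorphic_on W \<and>
        (\<forall>w\<in>W. ((\<lambda>t. m t * k w (g t) * vector_derivative g (at t within {0..1})) has_integral D w) {a..c})"
        using has_integral_combine[OF Q(3,4) D1(2) D2(2)] holomorphic_on_add[OF D1(1) D2(1)]
        by (intro exI[of _ "\<lambda>w. D1 w + D2 w"]) auto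
    qed
  next
    fix t0 :: real assume t0: "0 \<le> t0" "t0 \<le> 1"
    then obtain f r e where f: "r > 0" "e > 0" "f holomorphic_on ball (g t0) r"
      "\<And>t. t \<in> {0<..1} \<Longrightarrow> \<bar>t - t0\<bar> < e \<Longrightarrow> g t \<in> ball (g t0) r \<and> m t = f (g t)"
      using loc[of t0] by auto
    have "g t0 \<in> V" using V(2) t0 by (auto simp: path_image_def)
    then obtain r' where r': "r' > 0" "ball (g t0) r' \<subseteq> V" using V(1) open_contains_ball by blast
    define U where "U = ball (g t0) (min r r')"
    have U: "open U" "convex U" "U \<subseteq> V" "f holomorphic_on U"
      using r' f by (auto simp: U_def elim!: holomorphic_on_subset)
    have "continuous_on {0..1} g" using g valid_path_imp_path path_def by blast
    moreover have "t0 \<in> {0..1}" "min r r' > 0" using t0 f(1) r'(1) by auto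
    ultimately obtain e' where e': "e' > 0" "\<And>t. t \<in> {0..1} \<Longrightarrow> dist t t0 < e' \<Longrightarrow> dist (g t) (g t0) < min r r'"
      unfolding continuous_on_iff by blast
    show "\<exists>d>0. \<forall>a b. a \<le> t0 \<and> t0 \<le> b \<and> b - a < d \<longrightarrow> Q a b"
    proof (intro exI[of _ "min e e'"] conjI allI impI)
      show "min e e' > 0" using f(2) e'(1) by simp
      fix a b assume ab: "a \<le> t0 \<and> t0 \<le> b \<and> b - a < min e e'"
      show "Q a b"
        unfolding Q_def
      proof
        assume ab01: "0 \<le> a \<and> b \<le> 1"
        have gU: "g t \<in> U" if "t \<in> {a..b}" for t
          using e'(2)[of t] that ab ab01 by (auto simp: U_def dist_real_def dist_commute)
        have seg: "closed_segment (g a) (g b) \<subseteq> U"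
          using gU ab by (intro closed_segment_subset U) auto
        let ?h = "\<lambda>w s. f s * k w s"
        define D where "D w = contour_integral (linepath (g a) (g b)) (?h w)" for w
        have cf: "continuous_on (W \<times> closed_segment (g a) (g b)) (\<lambda>x. f (snd x))"
          by (rule continuous_on_compose2[where g = f and f = snd and t = U])
             (use seg U(4) in \<open>auto intro: holomorphic_on_imp_continuous_on continuous_on_snd\<close>)
        have ck: "continuous_on (W \<times> closed_segment (g a) (g b)) (\<lambda>x. k (fst x) (snd x))"
          using continuous_on_subset[OF k(1), of "W \<times> closed_segment (g a) (g b)"] seg U(3)
          by (auto simp: case_prod_unfold)
        have "D holomorphic_on W"
          unfolding D_def
        proof (rule holomorphic_on_contour_integral_linepath[OF W])
          show "continuous_on (W \<times> closed_segment (g a) (g b)) (\<lambda>(w, s). ?h w s)"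
            unfolding case_prod_unfold by (rule continuous_on_mult[OF cf ck])
          show "(\<lambda>w. ?h w s) holomorphic_on W" if "s \<in> closed_segment (g a) (g b)" for s
            using that seg U(3) by (intro holomorphic_on_mult holomorphic_on_const k(3)) auto
        qed
        moreover have "((\<lambda>t. m t * k w (g t) * vector_derivative g (at t within {0..1}))
            has_integral D w) {a..b}"
          if w: "w \<in> W" for w
        proof -
          have "?h w holomorphic_on U"
            using U(3,4) k(2)[OF w] by (intro holomorphic_on_mult) (auto elim: holomorphic_on_subset)
          then obtain P where P: "\<And>z. z \<in> U \<Longrightarrow> (P has_field_derivative ?h w z) (at z within U)"
            using holomorphic_convex_primitive'[OF U(2,1)] by blast
          then have P': "\<And>z. z \<in> U \<Longrightarrow> (P has_field_derivative ?h w z) (at z)"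
            by (simp add: at_within_open[OF _ U(1)])
          have "D w = P (g b) - P (g a)"
            unfolding D_def
            using contour_integral_primitive[OF P, of "linepath (g a) (g b)"] seg
            by (auto intro!: contour_integral_unique)
          moreover have "((\<lambda>t. ?h w (g t) * vector_derivative g (at t within {0..1}))
              has_integral (P (g b) - P (g a))) {a..b}"
            by (rule has_integral_along_path_primitive[OF g _ _ _ gU U(1) P']) (use ab ab01 in auto)
          ultimately have "((\<lambda>t. ?h w (g t) * vector_derivative g (at t within {0..1}))
              has_integral D w) {a..b}"
            by simp
          then show ?thesis
          proof (rule has_integral_spike_finite[of "{0}", rotated 2])
            fix t assume "t \<in> {a..b} - {0}"
            then have "m t = f (g t)" using f(4)[of t] ab ab01 by auto
            then show "m t * k w (g t) * vector_derivative g (at t within {0..1}) =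
                       ?h w (g t) * vector_derivative g (at t within {0..1})" by simp
          qed simp
        qed
        ultimately show "\<exists>D. D holomorphic_on W \<and>
          (\<forall>w\<in>W. ((\<lambda>t. m t * k w (g t) * vector_derivative g (at t within {0..1})) has_integral D w) {a..b})"
          by blast
      qed
    qed
  qed simp
  then show ?thesis unfolding Q_def by simp
qed

section \<open>Periodic functions and Euler's equation\<close>

text \<open>
  A function with period \<open>2 * pi * \<i>\<close> on a left half-plane is a function of \<open>exp u\<close>.
\<close>
lemma periodic_exp_cong:
  fixes h :: "complex \<Rightarrow> 'a"
  assumes per: "\<And>u. Re u < \<rho> \<Longrightarrow> h (u + 2 * of_real pi * \<i>) = h u"
    and "Re u < \<rho>" "exp u = exp v"
  shows "h u = h v"
proof -
  have nat: "h (u + of_nat n * (2 * of_real pi * \<i>)) = h u" if "Re u < \<rho>" for u n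
  proof (induction n)
    case (Suc n)
    have "h (u + of_nat n * (2 * of_real pi * \<i>) + 2 * of_real pi * \<i>)
        = h (u + of_nat n * (2 * of_real pi * \<i>))"
      using that by (intro per) simp
    with Suc show ?case by (simp add: algebra_simps)
  qed simp
  from assms(3) obtain n :: int where n: "u = v + of_int (2 * n) * pi * \<i>"
    using exp_eq by blast
  show ?thesis
  proof (cases "n \<ge> 0")
    case True
    then show ?thesis
      using nat[of v "nat n"] n assms(2) by (simp add: algebra_simps)
  next
    case False
    then show ?thesis
      using nat[of u "nat (-n)"] n assms(2) by (simp add: algebra_simps)
  qed
qed

lemma tendsto_mult_one_plus_Ln_0: "((\<lambda>z. z * of_real (1 + norm (Ln z))) \<longlongrightarrow> 0) (at 0)"
proof (rule Lim_null_comparison)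
  show "\<forall>\<^sub>F z in at 0. norm (z * of_real (1 + norm (Ln z))) \<le> norm z * (1 + pi) + 2 * sqrt (norm z)"
  proof -
    have "norm (z * of_real (1 + norm (Ln z))) \<le> norm z * (1 + pi) + 2 * sqrt (norm z)"
      if "z \<noteq> 0" "norm z < 1" for z :: complex
    proof -
      have "norm (Ln z) \<le> \<bar>Re (Ln z)\<bar> + \<bar>Im (Ln z)\<bar>" by (rule cmod_le)
      also have "\<bar>Im (Ln z)\<bar> \<le> pi" using that mpi_less_Im_Ln[of z] Im_Ln_le_pi[of z] by linarith
      also have "\<bar>Re (Ln z)\<bar> = - ln (norm z)" using that by (simp add: ln_less_zero_iff)
      \<comment> \<open>The square root leaves a factor that still tends to \<open>0\<close> after multiplication by \<open>norm z\<close>.\<close>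
      also have "- ln (norm z) = 2 * ln (1 / sqrt (norm z))"
        using that by (simp add: ln_div ln_sqrt)
      also have "ln (1 / sqrt (norm z)) \<le> 1 / sqrt (norm z)"
        using that by (intro order_trans[OF ln_le_minus_one]) auto
      finally have "norm (Ln z) \<le> 2 / sqrt (norm z) + pi" by simp
      then have "norm z * (1 + norm (Ln z)) \<le> norm z * (1 + (2 / sqrt (norm z) + pi))"
        by (intro mult_left_mono add_left_mono) auto
      also have "\<dots> = norm z * (1 + pi) + 2 * (norm z / sqrt (norm z))"
        by (simp add: algebra_simps)
      also have "norm z / sqrt (norm z) = sqrt (norm z)"
        by (simp add: real_div_sqrt)
      finally show ?thesis by (simp add: norm_mult abs_of_nonneg del: of_real_add)
    qed
    then show ?thesis
      unfolding eventually_at by (intro exI[of _ 1]) (auto simp: dist_norm)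
  qed
  show "((\<lambda>z::complex. norm z * (1 + pi) + 2 * sqrt (norm z)) \<longlongrightarrow> 0) (at 0)"
  proof -
    have "((\<lambda>z::complex. norm z * (1 + pi) + 2 * sqrt (norm z)) \<longlongrightarrow> norm (0::complex) * (1 + pi)
        + 2 * sqrt (norm (0::complex))) (at 0)"
      by (intro tendsto_intros)
    then show ?thesis by simp
  qed
qed

text \<open>
  A periodic function on a left half-plane descends to a punctured disk around \<open>1\<close>. Linear growth
  in the logarithmic coordinate makes the singularity removable.
\<close>
lemma periodic_function_extends:
  assumes hol: "h holomorphic_on {u. Re u < \<rho>}"
    and per: "\<And>u. Re u < \<rho> \<Longrightarrow> h (u + 2 * of_real pi * \<i>) = h u"
    and growth: "\<And>u. Re u < \<rho> \<Longrightarrow> \<bar>Im u\<bar> \<le> pi \<Longrightarrow> norm (h u) \<le> C * (1 + norm u)"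
  shows "\<exists>G. G analytic_on {1} \<and> (\<forall>u. Re u < \<rho> \<longrightarrow> h u = G (1 + exp u))"
proof -
  define r where "r = exp \<rho>"
  have r: "r > 0" by (simp add: r_def)
  define g where "g z = h (Ln (z - 1))" for z
  have Re_less: "Re u < \<rho>" if "exp u = z - 1" "z \<in> ball 1 r" for u z
  proof -
    have "exp (Re u) < exp \<rho>"
      using that by (metis dist_commute dist_norm mem_ball norm_exp_eq_Re r_def)
    then show ?thesis by simp
  qed
  have hg: "h u = g z" if "exp u = z - 1" "z \<in> ball 1 r" for u z
  proof -
    have "z - 1 \<noteq> 0" using that(1) exp_not_eq_zero by metis
    then show ?thesis
      unfolding g_def using that Re_less[OF that]
          by (intro periodic_exp_cong[where \<rho> = \<rho> and h = h, OF per]) auto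
  qed
  have opn: "open {u::complex. Re u < \<rho>}" by (simp add: open_halfspace_Re_lt)
  have hdiff: "h field_differentiable at u" if "Re u < \<rho>" for u
    using hol that opn by (auto simp: holomorphic_on_imp_differentiable_at)
  have "g field_differentiable at z" if z: "z \<in> ball 1 r - {1}" for z
  proof -
    \<comment> \<open>Near the branch cut, the logarithm is replaced by \<open>Ln (- (z - 1))\<close> plus a constant.\<close>
    obtain s where s: "s = 1 \<or> s = -1" "s * (z - 1) \<notin> \<real>\<^sub>\<le>\<^sub>0"
    proof (cases "z - 1 \<in> \<real>\<^sub>\<le>\<^sub>0")
      case True
      then have "- 1 * (z - 1) \<notin> \<real>\<^sub>\<le>\<^sub>0"
        using z by (auto simp: complex_nonpos_Reals_iff complex_eq_iff)
      then show ?thesis using that by blast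
    qed (use that[of 1] in auto)
    obtain t where t: "exp t = s" using s(1) by (metis exp_pi_i exp_zero mult.commute)
    let ?l = "\<lambda>z. Ln (s * (z - 1)) + t"
    have el: "exp (?l y) = y - 1" if "y \<noteq> 1" for y
      using that t s(1) by (auto simp: exp_add)
    have "h \<circ> ?l field_differentiable at z"
    proof (rule field_differentiable_compose)
      show "?l field_differentiable at z"
        unfolding field_differentiable_def using s(2)
        by (intro exI) (rule derivative_eq_intros | force)+
      show "h field_differentiable at (?l z)"
        using z by (intro hdiff Re_less[of _ z] el) auto
    qed
    then obtain D where "(h \<circ> ?l has_field_derivative D) (at z)"
      unfolding field_differentiable_def by blast
    then have "(g has_field_derivative D) (at z)"
    proof (rule has_field_derivative_transform_within_open)
      show "open (ball 1 r - {1::complex})" by auto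
      show "(h \<circ> ?l) y = g y" if "y \<in> ball 1 r - {1}" for y
        using that el[of y] hg[of "?l y" y] by (auto simp: o_def)
    qed (use z in auto)
    then show ?thesis unfolding field_differentiable_def by blast
  qed
  then have holg: "g holomorphic_on ball 1 r - {1}"
    unfolding holomorphic_on_def by (blast intro: field_differentiable_at_within)
  have "((\<lambda>z. (z - 1) * g z) \<longlongrightarrow> 0) (at 1)"
  proof (rule Lim_null_comparison)
    show "\<forall>\<^sub>F z in at 1. norm ((z - 1) * g z) \<le> C * norm ((z - 1) * of_real (1 + norm (Ln (z - 1))))"
      unfolding eventually_at
    proof (intro exI conjI ballI impI)
      fix z :: complex assume z: "z \<noteq> 1 \<and> dist z 1 < r"
      have e: "exp (Ln (z - 1)) = z - 1" using z by simp
      have "norm (g z) \<le> C * (1 + norm (Ln (z - 1)))"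
        unfolding g_def
      proof (rule growth)
        show "Re (Ln (z - 1)) < \<rho>"
          using Re_less[OF e] z by (auto simp: dist_commute)
        show "\<bar>Im (Ln (z - 1))\<bar> \<le> pi"
          using z mpi_less_Im_Ln[of "z - 1"] Im_Ln_le_pi[of "z - 1"] by fastforce
      qed
      then have "norm (z - 1) * norm (g z) \<le> norm (z - 1) * (C * (1 + norm (Ln (z - 1))))"
        by (intro mult_left_mono) auto
      then show "norm ((z - 1) * g z) \<le> C * norm ((z - 1) * of_real (1 + norm (Ln (z - 1))))"
        by (simp add: norm_mult mult_ac abs_of_nonneg del: of_real_add)
    qed (use r in auto)
    have "((\<lambda>z. (z - 1) * of_real (1 + norm (Ln (z - 1)))) \<longlongrightarrow> 0) (at (1::complex))"
      using tendsto_mult_one_plus_Ln_0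
      by (subst LIM_offset_zero_iff[of 1]) (auto simp: algebra_simps)
    then show "((\<lambda>z. C * norm ((z - 1) * of_real (1 + norm (Ln (z - 1))))) \<longlongrightarrow> 0) (at (1::complex))"
      by (intro tendsto_mult_right_zero tendsto_norm_zero)
  qed
  moreover have "1 \<in> interior (ball 1 r)" using r by (simp add: interior_open)
  ultimately obtain G where G: "G holomorphic_on ball 1 r" "\<forall>z\<in>ball 1 r - {1}. G z = g z"
    using holomorphic_on_extend_lim[OF holg] by blast
  have "G analytic_on {1}"
    using G(1) r by (intro analytic_on_subset[of G "ball 1 r" "{1}"]) (auto simp: analytic_on_open)
  moreover have "h u = G (1 + exp u)" if "Re u < \<rho>" for u
  proof -
    have "1 + exp u \<in> ball 1 r" using that by (simp add: dist_norm r_def)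
    then show ?thesis using hg[of u "1 + exp u"] G(2) by simp
  qed
  ultimately show ?thesis by blast
qed

text \<open>
  If \<open>B\<close> has the Taylor coefficients \<open>a n\<close> at \<open>y\<close>, the solution has the coefficients
  \<open>a n / (n + b)\<close>.
\<close>
lemma euler_equation_solution:
  fixes B :: "complex \<Rightarrow> complex"
  assumes B: "B holomorphic_on ball y r" and b: "Re b > 0"
  shows "\<exists>Q. \<forall>z\<in>ball y r. \<exists>Q'. (Q has_field_derivative Q') (at z) \<and> (z - y) * Q' + b * Q z = B z"
proof -
  define a where "a n = (deriv ^^ n) B y / fact n" for n
  define q where "q n = a n / (of_nat n + b)" for n
  have nz: "of_nat n + b \<noteq> 0" for n
    using b by (auto simp: complex_eq_iff)
  have sumsB: "(\<lambda>n. a n * h ^ n) sums B (y + h)" if "norm h < r" for h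
    using holomorphic_power_series[OF B, of "y + h"] that by (simp add: a_def dist_norm)
  have sums_q: "summable (\<lambda>n. q n * h ^ n)" if "norm h < r" for h
  proof -
    obtain s where s: "norm h < s" "s < r" using dense[OF \<open>norm h < r\<close>] by blast
    have "s > 0" using s norm_ge_zero[of h] by linarith
    then have "norm (complex_of_real s) < r" using s by simp
    then have "summable (\<lambda>n. norm (a n * h ^ n))"
      using s by (intro powser_insidea[of a "of_real s"] sums_summable[OF sumsB]) auto
    then have "summable (\<lambda>n. norm (a n * h ^ n) / Re b)" by (rule summable_divide)
    then show ?thesis
    proof (rule summable_comparison_test[rotated], intro exI allI impI)
      fix n :: nat
      have "Re b \<le> norm (of_nat n + b)"
        using complex_Re_le_cmod[of "of_nat n + b"] by simp
      then show "norm (q n * h ^ n) \<le> norm (a n * h ^ n) / Re b"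
        using b by (simp add: q_def norm_mult norm_divide frac_le)
    qed
  qed
  define P where "P h = (\<Sum>n. q n * h ^ n)" for h
  have P: "(P has_field_derivative (\<Sum>n. diffs q n * h ^ n)) (at h)" if "norm h < r" for h
    unfolding P_def using sums_q that by (rule termdiffs_strong')
  have eqn: "h * (\<Sum>n. diffs q n * h ^ n) + b * P h = B (y + h)" if h: "norm h < r" for h
  proof -
    have sm: "summable (\<lambda>n. diffs q n * h ^ n)"
      using termdiff_converges[OF h sums_q] by simp
    have "(\<lambda>n. of_nat n * q n * h ^ (n - Suc 0)) sums (\<Sum>n. diffs q n * h ^ n)"
      using diffs_equiv[OF sm] by simp
    then have "(\<lambda>n. h * (of_nat n * q n * h ^ (n - Suc 0))) sums (h * (\<Sum>n. diffs q n * h ^ n))"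
      by (rule sums_mult)
    moreover have "h * (of_nat n * q n * h ^ (n - Suc 0)) = of_nat n * (q n * h ^ n)" for n
      by (cases n) auto
    ultimately have "(\<lambda>n. of_nat n * (q n * h ^ n)) sums (h * (\<Sum>n. diffs q n * h ^ n))" by simp
    moreover have "(\<lambda>n. b * (q n * h ^ n)) sums (b * P h)"
      unfolding P_def by (intro sums_mult summable_sums sums_q h)
    ultimately have "(\<lambda>n. of_nat n * (q n * h ^ n)
        + b * (q n * h ^ n)) sums (h * (\<Sum>n. diffs q n * h ^ n) + b * P h)"
      by (rule sums_add)
    moreover have "of_nat n * (q n * h ^ n) + b * (q n * h ^ n) = a n * h ^ n" for n
    proof -
      have "of_nat n * (q n * h ^ n) + b * (q n * h ^ n) = ((of_nat n + b) * q n) * h ^ n"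
        by (simp add: algebra_simps)
      then show ?thesis using nz[of n] by (simp add: q_def)
    qed
    ultimately show ?thesis using sumsB[OF h] sums_unique2 by simp
  qed
  show ?thesis
  proof (intro exI[of _ "\<lambda>z. P (z - y)"] ballI)
    fix z assume "z \<in> ball y r"
    then have n: "norm (z - y) < r" by (simp add: dist_norm norm_minus_commute)
    have "((\<lambda>z. P (z - y)) has_field_derivative (\<Sum>n. diffs q n * (z - y) ^ n) * 1) (at z)"
      by (rule DERIV_chain2[where f = P and g = "\<lambda>z. z - y", OF P[OF n]]) (auto intro!: derivative_eq_intros)
    then show "\<exists>Q'. ((\<lambda>z. P (z - y)) has_field_derivative Q') (at z) \<and> (z - y) * Q' + b * P (z - y) = B z"
      using eqn[OF n] by auto
  qed
qed

section \<open>The part of the integral over the spiral\<close>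

text \<open>
  The integrand \<open>F s * (w - s) powr \<beta> ds\<close> in the coordinates \<open>s = 1 + exp x\<close> and \<open>w = 1 + exp \<zeta>\<close>.
  The constant \<open>\<kappa>\<close>, with \<open>exp \<kappa> = - 1\<close>, selects the branch
  \<open>x + \<kappa> + Ln (1 - exp (\<zeta> - x))\<close> of \<open>ln (w - s)\<close>, which is defined for \<open>Re \<zeta> < Re x\<close>. At \<open>x = \<zeta>\<close>
  the kernel is \<open>0\<close> because of \<open>0 powr \<beta> = 0\<close>, which is its limit for \<open>Re \<beta> > 0\<close>.
\<close>
definition spiral_kernel ::
    "complex \<Rightarrow> complex \<Rightarrow> (complex \<Rightarrow> complex) \<Rightarrow> complex \<Rightarrow> complex \<Rightarrow> complex" where
  "spiral_kernel \<beta> \<kappa> f \<zeta> x = f x * exp x * exp (\<beta> * (x + \<kappa>)) * (1 - exp (\<zeta> - x)) powr \<beta>"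

lemma one_minus_exp_right_half_plane:
  assumes "Re \<zeta> < Re x \<or> x = \<zeta>"
  shows "1 - exp (\<zeta> - x) \<in> {q. Re q > 0 \<or> q = 0}"
proof (cases "x = \<zeta>")
  case False
  then have "Re (exp (\<zeta> - x)) < 1"
    using assms complex_Re_le_cmod[of "exp (\<zeta> - x)"] by (auto intro: le_less_trans)
  then show ?thesis by simp
qed simp

lemma Re_one_minus_exp_pos: "Re \<zeta> < Re x \<Longrightarrow> Re (1 - exp (\<zeta> - x)) > 0"
  using complex_Re_le_cmod[of "exp (\<zeta> - x)"] by (auto intro: le_less_trans)

text \<open>
  The vertical strip in which the kernel is continuous, together with the end point \<open>\<zeta>\<close> of the
  integrals. It is convex, so integrals over segments in it are path independent.
\<close>
definition half_strip :: "complex \<Rightarrow> real \<Rightarrow> complex set" where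
  "half_strip \<zeta> R = insert \<zeta> {x. Re \<zeta> < Re x \<and> Re x \<le> R}"

lemma convex_half_strip: "convex (half_strip \<zeta> R)"
proof (rule convexI)
  fix x y u v assume *: "x \<in> half_strip \<zeta> R" "y \<in> half_strip \<zeta> R" "0 \<le> u" "0 \<le> v" "u + v = (1::real)"
  consider "x = \<zeta>" "y = \<zeta>" | "u = 0" | "v = 0" | "u > 0" "v > 0" "x \<noteq> \<zeta> \<or> y \<noteq> \<zeta>"
    using * by fastforce
  then show "u *\<^sub>R x + v *\<^sub>R y \<in> half_strip \<zeta> R"
  proof cases
    case 1
    then show ?thesis using * by (simp add: half_strip_def flip: scaleR_add_left)
  next
    case 4
    have le: "Re \<zeta> \<le> Re x" "Re \<zeta> \<le> Re y" and lt: "Re \<zeta> < Re x \<or> Re \<zeta> < Re y" and R: "Re \<zeta> \<le> R"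
      using * 4 by (auto simp: half_strip_def)
    have R2: "Re x \<le> R" "Re y \<le> R" using * R by (auto simp: half_strip_def)
    have "u * Re \<zeta> + v * Re \<zeta> < u * Re x + v * Re y"
      using lt
    proof
      assume "Re \<zeta> < Re x"
      then show ?thesis using 4 le by (intro add_less_le_mono mult_strict_left_mono mult_left_mono) auto
    next
      assume "Re \<zeta> < Re y"
      then show ?thesis using 4 le by (intro add_le_less_mono mult_strict_left_mono mult_left_mono) auto
    qed
    moreover have "u * Re x + v * Re y \<le> R"
      using convex_bound_le[OF R2 *(3,4,5)] .
    ultimately show ?thesis using *(5) by (simp add: half_strip_def flip: distrib_right)
  qed (use * in auto)
qed

lemma interior_half_strip:
  assumes "x \<in> interior (half_strip \<zeta> R) - {\<zeta>}"
  shows "Re \<zeta> < Re x" "Re x < R"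
proof -
  show "Re \<zeta> < Re x" using assms interior_subset by (auto simp: half_strip_def)
  obtain e where e: "e > 0" "ball x e \<subseteq> half_strip \<zeta> R"
    using assms mem_interior by blast
  define y where "y = x + of_real (e / 2)"
  have "y \<in> ball x e" using e by (simp add: y_def dist_norm)
  moreover have "Re y > Re x" using e by (simp add: y_def)
  moreover have "y \<noteq> \<zeta>" using \<open>Re \<zeta> < Re x\<close> \<open>Re y > Re x\<close> by auto
  ultimately show "Re x < R" using e by (auto simp: half_strip_def)
qed

context
  fixes \<beta> \<kappa> :: complex and f :: "complex \<Rightarrow> complex" and R :: real
  assumes \<beta>: "Re \<beta> > 0"
    and fc: "continuous_on {x. Re x \<le> R} f" and fh: "f holomorphic_on {x. Re x < R}"
begin

lemma continuous_on_spiral_kernel: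
  "continuous_on {(\<zeta>, x). Re x \<le> R \<and> (Re \<zeta> < Re x \<or> x = \<zeta>)} (\<lambda>(\<zeta>, x). spiral_kernel \<beta> \<kappa> f \<zeta> x)"
proof -
  let ?D = "{(\<zeta>, x). Re x \<le> R \<and> (Re \<zeta> < Re x \<or> x = \<zeta>)}"
  have "continuous_on ?D (f \<circ> snd)"
    by (intro continuous_on_compose continuous_on_subset[OF fc] continuous_intros) auto
  then have c1: "continuous_on ?D (\<lambda>p. f (snd p))" by (simp add: o_def)
  have "continuous_on ?D ((\<lambda>q. q powr \<beta>) \<circ> (\<lambda>p. 1 - exp (fst p - snd p)))"
  proof (intro continuous_on_compose continuous_on_subset[OF continuous_on_powr_right_half_plane[OF \<beta>]]
      continuous_intros)
    show "(\<lambda>p. 1 - exp (fst p - snd p)) ` ?D \<subseteq> {q. Re q > 0 \<or> q = 0}"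
    proof (rule image_subsetI)
      fix p assume "p \<in> ?D"
      then show "1 - exp (fst p - snd p) \<in> {q. Re q > 0 \<or> q = 0}"
        by (intro one_minus_exp_right_half_plane) auto
    qed
  qed
  then have c2: "continuous_on ?D (\<lambda>p. (1 - exp (fst p - snd p)) powr \<beta>)" by (simp add: o_def)
  show ?thesis
    unfolding spiral_kernel_def case_prod_unfold
    by (intro continuous_on_mult c1[unfolded case_prod_unfold] c2[unfolded case_prod_unfold] continuous_on_exp
        continuous_on_add continuous_on_const continuous_on_snd continuous_on_id)
qed

lemma spiral_kernel_field_differentiable:
  "Re \<zeta> < Re x \<Longrightarrow> Re x < R \<Longrightarrow> spiral_kernel \<beta> \<kappa> f \<zeta> field_differentiable at x"
proof -
  assume x: "Re \<zeta> < Re x" "Re x < R"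
  let ?D = "{x. Re \<zeta> < Re x} \<inter> {x. Re x < R}"
  have "spiral_kernel \<beta> \<kappa> f \<zeta> holomorphic_on ?D"
    unfolding spiral_kernel_def
    by (intro holomorphic_intros holomorphic_on_subset[OF fh])
       (use Re_one_minus_exp_pos in \<open>fastforce simp: complex_nonpos_Reals_iff\<close>)+
  moreover have "open ?D" by (intro open_Int open_halfspace_Re_lt open_halfspace_Re_gt)
  ultimately show ?thesis
    using x by (auto simp: holomorphic_on_imp_differentiable_at)
qed

lemma continuous_on_spiral_kernel_half_strip:
  assumes "Re \<zeta> \<le> R"
  shows "continuous_on (half_strip \<zeta> R) (spiral_kernel \<beta> \<kappa> f \<zeta>)"
proof -
  have "continuous_on (half_strip \<zeta> R) ((\<lambda>(\<zeta>, x). spiral_kernel \<beta> \<kappa> f \<zeta> x) \<circ> (\<lambda>x. (\<zeta>, x)))"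
    by (intro continuous_on_compose continuous_on_subset[OF continuous_on_spiral_kernel] continuous_intros)
       (use assms in \<open>auto simp: half_strip_def\<close>)
  then show ?thesis by (simp add: o_def)
qed

lemma contour_integrable_spiral_kernel:
  assumes "Re \<zeta> \<le> R" "a \<in> half_strip \<zeta> R" "b \<in> half_strip \<zeta> R"
  shows "spiral_kernel \<beta> \<kappa> f \<zeta> contour_integrable_on linepath a b"
  by (intro contour_integrable_continuous_linepath
        continuous_on_subset[OF continuous_on_spiral_kernel_half_strip] assms
        closed_segment_subset convex_half_strip)

lemma contour_integral_spiral_kernel_split:
  assumes "Re \<zeta> \<le> R" and abc: "a \<in> half_strip \<zeta> R" "b \<in> half_strip \<zeta> R" "c \<in> half_strip \<zeta> R"
  shows "contour_integral (linepath a c) (spiral_kernel \<beta> \<kappa> f \<zeta>) =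
         contour_integral (linepath a b) (spiral_kernel \<beta> \<kappa> f \<zeta>) +
         contour_integral (linepath b c) (spiral_kernel \<beta> \<kappa> f \<zeta>)"
proof -
  obtain g where g: "\<And>x. x \<in> half_strip \<zeta> R \<Longrightarrow>
      (g has_field_derivative spiral_kernel \<beta> \<kappa> f \<zeta> x) (at x within half_strip \<zeta> R)"
  proof (rule holomorphic_convex_primitive[of "half_strip \<zeta> R" "{\<zeta>}" "spiral_kernel \<beta> \<kappa> f \<zeta>"])
    show "spiral_kernel \<beta> \<kappa> f \<zeta> field_differentiable at x" if "x \<in> interior (half_strip \<zeta> R) - {\<zeta>}" for x
      using interior_half_strip[OF that] spiral_kernel_field_differentiable by blast
  qed (use assms continuous_on_spiral_kernel_half_strip convex_half_strip in auto)
  have "contour_integral (linepath p q) (spiral_kernel \<beta> \<kappa> f \<zeta>) = g q - g p"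
    if "p \<in> half_strip \<zeta> R" "q \<in> half_strip \<zeta> R" for p q
    using contour_integral_primitive[OF g, of "linepath p q"] that
      closed_segment_subset[OF that convex_half_strip]
    by (auto intro!: contour_integral_unique)
  then show ?thesis using abc by simp
qed

text \<open>
  The segment is parametrized by \<open>s \<in> [0, 1]\<close>. Thus only the integrand depends on \<open>\<zeta>\<close>, and it stays
  continuous at \<open>s = 1\<close>, where it vanishes.
\<close>
lemma holomorphic_spiral_integral:
  assumes \<zeta>0: "Re \<zeta>0 = R"
  shows "(\<lambda>\<zeta>. contour_integral (linepath \<zeta>0 \<zeta>) (spiral_kernel \<beta> \<kappa> f \<zeta>)) holomorphic_on {\<zeta>. Re \<zeta> < R}"
proof -
  let ?x = "\<lambda>\<zeta> s. \<zeta>0 + s * (\<zeta> - \<zeta>0)"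
  let ?h = "\<lambda>\<zeta> s. spiral_kernel \<beta> \<kappa> f \<zeta> (?x \<zeta> s)"
  have x: "Re (?x \<zeta> s) \<le> R \<and> (Re \<zeta> < Re (?x \<zeta> s) \<or> ?x \<zeta> s = \<zeta>)"
      "s \<noteq> 0 \<Longrightarrow> Re (?x \<zeta> s) < R" "s \<noteq> 1 \<Longrightarrow> Re \<zeta> < Re (?x \<zeta> s)"
    if "s \<in> closed_segment 0 1" "Re \<zeta> < R" for \<zeta> s
  proof -
    from that(1) obtain t where t: "s = of_real t" "0 \<le> t" "t \<le> 1"
      by (auto simp: closed_segment_def scaleR_conv_of_real)
    have 1: "t * (Re \<zeta> - R) \<le> 0" using t that by (simp add: mult_nonneg_nonpos)
    have 2: "(1 - t) * (Re \<zeta> - R) < 0" if "t \<noteq> 1" using t that \<open>Re \<zeta> < R\<close> by (simp add: mult_pos_neg)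
    have 3: "t * (Re \<zeta> - R) < 0" if "t \<noteq> 0" using t that \<open>Re \<zeta> < R\<close> by (simp add: mult_pos_neg)
    show a: "s \<noteq> 0 \<Longrightarrow> Re (?x \<zeta> s) < R" "s \<noteq> 1 \<Longrightarrow> Re \<zeta> < Re (?x \<zeta> s)"
      using 2 3 t by (auto simp: \<zeta>0 algebra_simps)
    then show "Re (?x \<zeta> s) \<le> R \<and> (Re \<zeta> < Re (?x \<zeta> s) \<or> ?x \<zeta> s = \<zeta>)"
      using \<zeta>0 by (cases "s = 0"; cases "s = 1") auto
  qed
  have "(\<lambda>\<zeta>. contour_integral (linepath 0 1) (?h \<zeta>)) holomorphic_on {\<zeta>. Re \<zeta> < R}"
  proof (rule holomorphic_on_contour_integral_linepath)
    show "open {\<zeta>. Re \<zeta> < R}" by (rule open_halfspace_Re_lt)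
    have "continuous_on ({\<zeta>. Re \<zeta> < R} \<times> closed_segment 0 1)
       ((\<lambda>(\<zeta>, x). spiral_kernel \<beta> \<kappa> f \<zeta> x) \<circ> (\<lambda>(\<zeta>, s). (\<zeta>, ?x \<zeta> s)))"
    proof (rule continuous_on_compose[OF _ continuous_on_subset[OF continuous_on_spiral_kernel]])
      show "continuous_on ({\<zeta>. Re \<zeta> < R} \<times> closed_segment 0 1) (\<lambda>(\<zeta>, s). (\<zeta>, ?x \<zeta> s))"
        unfolding case_prod_unfold by (intro continuous_intros)
      show "(\<lambda>(\<zeta>, s). (\<zeta>, ?x \<zeta> s)) ` ({\<zeta>. Re \<zeta> < R} \<times> closed_segment 0 1)
              \<subseteq> {(\<zeta>, x). Re x \<le> R \<and> (Re \<zeta> < Re x \<or> x = \<zeta>)}"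
      proof (rule image_subsetI)
        fix p assume "p \<in> {\<zeta>. Re \<zeta> < R} \<times> closed_segment (0 :: complex) 1"
        then show "(\<lambda>(\<zeta>, s). (\<zeta>, ?x \<zeta> s)) p \<in> {(\<zeta>, x). Re x \<le> R \<and> (Re \<zeta> < Re x \<or> x = \<zeta>)}"
          using x(1)[of "snd p" "fst p"] by (auto simp: case_prod_unfold)
      qed
    qed
    then show "continuous_on ({\<zeta>. Re \<zeta> < R} \<times> closed_segment 0 1) (\<lambda>(\<zeta>, s). ?h \<zeta> s)"
      by (simp add: o_def case_prod_unfold)
    fix s :: complex assume s: "s \<in> closed_segment 0 1"
    have fx: "(\<lambda>\<zeta>. f (?x \<zeta> s)) holomorphic_on {\<zeta>. Re \<zeta> < R}"
    proof (cases "s = 0")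
      case False
      have "f \<circ> (\<lambda>\<zeta>. ?x \<zeta> s) holomorphic_on {\<zeta>. Re \<zeta> < R}"
        by (intro holomorphic_on_compose holomorphic_on_subset[OF fh] holomorphic_intros)
           (use x(2)[OF s] False in auto)
      then show ?thesis by (simp add: o_def)
    qed simp
    have qx: "(\<lambda>\<zeta>. (1 - exp (\<zeta> - ?x \<zeta> s)) powr \<beta>) holomorphic_on {\<zeta>. Re \<zeta> < R}"
    proof (cases "s = 1")
      case False
      then show ?thesis
        using x(3)[OF s] Re_one_minus_exp_pos
        by (intro holomorphic_intros) (fastforce simp: complex_nonpos_Reals_iff)+
    qed simp
    show "(\<lambda>\<zeta>. ?h \<zeta> s) holomorphic_on {\<zeta>. Re \<zeta> < R}"
      unfolding spiral_kernel_def by (intro holomorphic_intros fx qx)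
  qed
  then have "(\<lambda>\<zeta>. contour_integral (linepath 0 1) (?h \<zeta>) * (\<zeta> - \<zeta>0)) holomorphic_on {\<zeta>. Re \<zeta> < R}"
    by (intro holomorphic_intros)
  moreover have "contour_integral (linepath \<zeta>0 \<zeta>) (spiral_kernel \<beta> \<kappa> f \<zeta>) =
                 contour_integral (linepath 0 1) (?h \<zeta>) * (\<zeta> - \<zeta>0)" for \<zeta>
  proof -
    have "linepath \<zeta>0 \<zeta> t = ?x \<zeta> (of_real t)" "linepath 0 1 t = complex_of_real t" for t
      by (simp_all add: linepath_def scaleR_conv_of_real algebra_simps)
    then show ?thesis by (simp add: contour_integral_integral)
  qed
  ultimately show ?thesis by simp
qed

end

lemma spiral_kernel_periodic: "spiral_kernel \<beta> \<kappa> f (\<zeta> + 2 * of_real pi * \<i>) x = spiral_kernel \<beta> \<kappa> f \<zeta> x"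
proof -
  have "exp (\<zeta> + 2 * of_real pi * \<i> - x) = exp (\<zeta> - x)"
    using exp_plus_2pin[of "\<zeta> - x" 1] by (simp add: algebra_simps)
  then show ?thesis by (simp add: spiral_kernel_def)
qed

lemma spiral_kernel_shift:
  assumes "f (x + 2 * of_real pi * \<i>) = c * f x + g x"
  shows "spiral_kernel \<beta> \<kappa> f (\<zeta> + 2 * of_real pi * \<i>) (x + 2 * of_real pi * \<i>) =
         exp (2 * of_real pi * \<i> * \<beta>) * (c * spiral_kernel \<beta> \<kappa> f \<zeta> x + spiral_kernel \<beta> \<kappa> g \<zeta> x)"
proof -
  have "exp (x + 2 * of_real pi * \<i>) = exp x"
    using exp_plus_2pin[of x 1] by (simp add: mult_ac)
  moreover have "exp (\<beta> * (x + 2 * of_real pi * \<i> + \<kappa>)) = exp (2 * of_real pi * \<i> * \<beta>) * exp (\<beta> * (x + \<kappa>))"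
    by (simp add: algebra_simps flip: exp_add)
  ultimately show ?thesis
    unfolding spiral_kernel_def assms by (simp add: algebra_simps)
qed

lemma contour_integral_linepath_translate:
  "contour_integral (linepath (a + v) (b + v)) g = contour_integral (linepath a b) (\<lambda>x. g (x + v))"
proof -
  have "linepath (a + v) (b + v) t = linepath a b t + v" for t
    by (simp add: linepath_def algebra_simps)
  then show ?thesis by (simp add: contour_integral_integral)
qed

text \<open>
  For an analytic \<open>B\<close> the integral from \<open>c\<close> to \<open>\<zeta>\<close> depends on \<open>exp \<zeta>\<close> only. A solution \<open>Q\<close> of
  Euler's equation gives the primitive \<open>P\<close>, which vanishes at \<open>\<zeta>\<close> and whose value at \<open>c\<close> is a
  function of \<open>exp \<zeta>\<close>.
\<close>
lemma spiral_integral_of_regular_part: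
  assumes \<beta>: "Re \<beta> > 0" and \<kappa>: "exp \<kappa> = -1"
    and B: "B holomorphic_on ball 1 r" and c: "3 * exp (Re c) < r"
  shows "\<exists>V. \<forall>\<zeta>. exp \<zeta> = y \<and> Re \<zeta> < Re c \<longrightarrow>
           contour_integral (linepath c \<zeta>) (spiral_kernel \<beta> \<kappa> (\<lambda>x. B (1 + exp x)) \<zeta>) = V"
proof (cases "norm y < exp (Re c)")
  case False
  then have "\<not> (exp \<zeta> = y \<and> Re \<zeta> < Re c)" for \<zeta> by auto
  then show ?thesis by blast
next
  case y: True
  have sub: "ball y (2 * exp (Re c)) \<subseteq> ball 0 r"
  proof
    fix v assume "v \<in> ball y (2 * exp (Re c))"
    then have "norm (v - y) < 2 * exp (Re c)" by (simp add: dist_norm norm_minus_commute)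
    then have "norm v < 3 * exp (Re c)" using y norm_triangle_ineq2[of v y] by linarith
    then show "v \<in> ball 0 r" using c by simp
  qed
  have "(\<lambda>v. B (1 + v)) holomorphic_on ball 0 r"
  proof -
    have "B \<circ> (\<lambda>v. 1 + v) holomorphic_on ball 0 r"
      by (intro holomorphic_on_compose holomorphic_on_subset[OF B] holomorphic_intros) (auto simp: dist_norm)
    then show ?thesis by (simp add: o_def)
  qed
  then have "(\<lambda>v. B (1 + v)) holomorphic_on ball y (2 * exp (Re c))"
    using sub holomorphic_on_subset by blast
  moreover have \<beta>1: "Re (\<beta> + 1) > 0" using \<beta> by simp
  ultimately obtain Q where Q: "\<And>v. v \<in> ball y (2 * exp (Re c)) \<Longrightarrow>
      \<exists>Q'. (Q has_field_derivative Q') (at v) \<and> (v - y) * Q' + (\<beta> + 1) * Q v = B (1 + v)"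
    using euler_equation_solution by metis
  define P where "P \<zeta> x = - (exp ((\<beta> + 1) * (x + \<kappa>)) * (1 - exp (\<zeta> - x)) powr (\<beta> + 1) * Q (exp x))" for \<zeta> x
  have exp_mem: "exp x \<in> ball y (2 * exp (Re c))" if "Re x \<le> Re c" for x
  proof -
    have "norm (exp x - y) \<le> norm (exp x) + norm y" by (rule norm_triangle_ineq4)
    also have "\<dots> < exp (Re c) + exp (Re c)" using that y by (intro add_le_less_mono) auto
    finally show ?thesis by (simp add: dist_norm norm_minus_commute)
  qed
  have deriv: "(P \<zeta> has_field_derivative spiral_kernel \<beta> \<kappa> (\<lambda>x. B (1 + exp x)) \<zeta> x) (at x)"
    if \<zeta>: "exp \<zeta> = y" and x: "Re \<zeta> < Re x" "Re x \<le> Re c" for \<zeta> x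
  proof -
    let ?q = "1 - exp (\<zeta> - x)"
    have q: "?q \<notin> \<real>\<^sub>\<le>\<^sub>0" "?q \<noteq> 0"
      using Re_one_minus_exp_pos[OF x(1)] by (auto simp: complex_nonpos_Reals_iff)
    obtain Q' where Q': "(Q has_field_derivative Q') (at (exp x))"
        "(exp x - y) * Q' + (\<beta> + 1) * Q (exp x) = B (1 + exp x)"
      using Q[OF exp_mem[OF x(2)]] by blast
    \<comment> \<open>Here \<open>exp x - y = s - w\<close> is the variable of Euler's equation.\<close>
    have vq: "exp x * ?q = exp x - y"
      using \<zeta> by (simp add: algebra_simps exp_diff)
    have e: "exp ((\<beta> + 1) * (x + \<kappa>)) = - (exp x * exp (\<beta> * (x + \<kappa>)))"
      using \<kappa> by (simp add: algebra_simps exp_add)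
    have p: "?q powr (\<beta> + 1) = ?q powr \<beta> * ?q"
      using q(2) by (simp add: powr_add)
    have d1: "((\<lambda>x. Q (exp x)) has_field_derivative Q' * exp x) (at x)"
      using Q'(1) by (intro DERIV_chain2[where f = Q and g = exp]) (auto intro!: derivative_eq_intros)
    have d2: "((\<lambda>x. (1 - exp (\<zeta> - x)) powr (\<beta> + 1))
        has_field_derivative ((\<beta> + 1) * ?q powr \<beta>) * exp (\<zeta> - x)) (at x)"
      using has_field_derivative_powr[OF q(1), of "\<beta> + 1"]
      by (intro DERIV_chain2[where f = "\<lambda>q. q powr (\<beta> + 1)" and g = "\<lambda>x. 1 - exp (\<zeta> - x)"])
         (auto intro!: derivative_eq_intros)
    have d0: "((\<lambda>x. exp ((\<beta> + 1) * (x + \<kappa>))) has_field_derivative exp ((\<beta> + 1) * (x + \<kappa>)) * (\<beta> + 1)) (at x)"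
      by (auto intro!: derivative_eq_intros)
    have "(P \<zeta> has_field_derivative
        - (exp ((\<beta> + 1) * (x + \<kappa>)) * (\<beta> + 1) * ?q powr (\<beta> + 1) * Q (exp x) +
           exp ((\<beta> + 1) * (x + \<kappa>)) * ((\<beta> + 1) * ?q powr \<beta> * exp (\<zeta> - x)) * Q (exp x) +
           exp ((\<beta> + 1) * (x + \<kappa>)) * ?q powr (\<beta> + 1) * (Q' * exp x))) (at x)"
      unfolding P_def
      by (rule DERIV_cong[OF DERIV_minus[OF DERIV_mult[OF DERIV_mult[OF d0 d2] d1]]])
          (simp add: algebra_simps)
    also have "- (exp ((\<beta> + 1) * (x + \<kappa>)) * (\<beta> + 1) * ?q powr (\<beta> + 1) * Q (exp x) +
           exp ((\<beta> + 1) * (x + \<kappa>)) * ((\<beta> + 1) * ?q powr \<beta> * exp (\<zeta> - x)) * Q (exp x) +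
           exp ((\<beta> + 1) * (x + \<kappa>)) * ?q powr (\<beta> + 1) * (Q' * exp x))
       = exp x * exp (\<beta> * (x + \<kappa>)) * ?q powr \<beta> *
           ((\<beta> + 1) * Q (exp x) * (?q + exp (\<zeta> - x)) + (exp x * ?q) * Q')"
      unfolding e p by (simp add: algebra_simps)
    also have "\<dots> = spiral_kernel \<beta> \<kappa> (\<lambda>x. B (1 + exp x)) \<zeta> x"
      unfolding vq spiral_kernel_def Q'(2)[symmetric] by (simp add: algebra_simps)
    finally show ?thesis .
  qed
  have "contour_integral (linepath c \<zeta>) (spiral_kernel \<beta> \<kappa> (\<lambda>x. B (1 + exp x)) \<zeta>) =
          exp ((\<beta> + 1) * (c + \<kappa>)) * (1 - y * exp (- c)) powr (\<beta> + 1) * Q (exp c)"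
    if \<zeta>: "exp \<zeta> = y" "Re \<zeta> < Re c" for \<zeta>
  proof -
    have x: "linepath c \<zeta> t \<in> half_strip \<zeta> (Re c)" if "t \<in> {0..1}" for t
    proof -
      have "closed_segment c \<zeta> \<subseteq> half_strip \<zeta> (Re c)"
        using \<zeta> by (intro closed_segment_subset convex_half_strip) (auto simp: half_strip_def)
      then show ?thesis using that linepath_in_path by blast
    qed
    have "continuous_on (half_strip \<zeta> (Re c)) (P \<zeta>)"
    proof -
      have c1: "continuous_on (half_strip \<zeta> (Re c)) ((\<lambda>q. q powr (\<beta> + 1)) \<circ> (\<lambda>x. 1 - exp (\<zeta> - x)))"
      proof (intro continuous_on_compose
          continuous_on_subset[OF continuous_on_powr_right_half_plane[OF \<beta>1]] continuous_intros)
        show "(\<lambda>x. 1 - exp (\<zeta> - x)) ` half_strip \<zeta> (Re c) \<subseteq> {q. Re q > 0 \<or> q = 0}"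
        proof (rule image_subsetI)
          fix x assume "x \<in> half_strip \<zeta> (Re c)"
          then show "1 - exp (\<zeta> - x) \<in> {q. Re q > 0 \<or> q = 0}"
            by (intro one_minus_exp_right_half_plane) (auto simp: half_strip_def)
        qed
      qed
      have c2: "continuous_on (half_strip \<zeta> (Re c)) (Q \<circ> exp)"
      proof (intro continuous_on_compose continuous_intros)
        have "continuous_on (ball y (2 * exp (Re c))) Q"
          using Q DERIV_isCont by (blast intro: continuous_at_imp_continuous_on)
        then show "continuous_on (exp ` half_strip \<zeta> (Re c)) Q"
          by (rule continuous_on_subset) (use exp_mem \<zeta> in \<open>auto simp: half_strip_def\<close>)
      qed
      show ?thesis
        unfolding P_def
        by (intro continuous_on_minus continuous_on_mult c1[unfolded o_def] c2[unfolded o_def]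
            continuous_on_exp
            continuous_on_add continuous_on_const continuous_on_id)
    qed
    then have "continuous_on {0..1} (\<lambda>t. P \<zeta> (linepath c \<zeta> t))"
      by (rule continuous_on_compose2) (use x in \<open>auto intro: continuous_on_linepath\<close>)
    moreover have "((\<lambda>t. P \<zeta> (linepath c \<zeta> t)) has_vector_derivative
        spiral_kernel \<beta> \<kappa> (\<lambda>x. B (1 + exp x)) \<zeta> (linepath c \<zeta> t) * (\<zeta> - c)) (at t)"
      if t: "t \<in> {0<..<1}" for t
    proof -
      have "Re (linepath c \<zeta> t) - Re \<zeta> = (1 - t) * (Re c - Re \<zeta>)"
        by (simp add: linepath_def algebra_simps)
      moreover have "(1 - t) * (Re c - Re \<zeta>) > 0" using t \<zeta> by simp
      ultimately have lx: "Re \<zeta> < Re (linepath c \<zeta> t)" "Re (linepath c \<zeta> t) \<le> Re c"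
        using x[of t] t by (auto simp: half_strip_def)
      have "(P \<zeta> \<circ> linepath c \<zeta> has_vector_derivative
          (\<zeta> - c) * spiral_kernel \<beta> \<kappa> (\<lambda>x. B (1 + exp x)) \<zeta> (linepath c \<zeta> t)) (at t)"
        by (rule field_vector_diff_chain_at[OF has_vector_derivative_linepath_within deriv[OF \<zeta>(1) lx]])
      then show ?thesis by (simp add: o_def mult.commute)
    qed
    ultimately have "((\<lambda>t. spiral_kernel \<beta> \<kappa> (\<lambda>x. B (1 + exp x)) \<zeta> (linepath c \<zeta> t) * (\<zeta> - c)) has_integral
        (P \<zeta> (linepath c \<zeta> 1) - P \<zeta> (linepath c \<zeta> 0))) {0..1}"
      by (intro fundamental_theorem_of_calculus_interior) auto
    then have "contour_integral (linepath c \<zeta>) (spiral_kernel \<beta> \<kappa> (\<lambda>x. B (1 + exp x)) \<zeta>) = P \<zeta> \<zeta> - P \<zeta> c"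
      by (intro contour_integral_unique) (simp add: has_contour_integral_linepath linepath_0' linepath_1')
    then show ?thesis using \<zeta>(1) by (simp add: P_def exp_diff exp_minus field_simps)
  qed
  then show ?thesis by blast
qed

text \<open>
  The base point \<open>p\<close> is moved so far to the left that the monodromy relation holds from \<open>p\<close> on.
  The integrals \<open>E\<close> and \<open>D\<close> have fixed end points, hence the period of the kernel; \<open>K\<close> is the part
  with the moving end point.
\<close>
lemma spiral_integral_periodic:
  assumes \<beta>: "Re \<beta> > 0" and \<kappa>: "exp \<kappa> = -1"
    and fc: "continuous_on {x. Re x \<le> Re \<zeta>0} f" and fh: "f holomorphic_on {x. Re x < Re \<zeta>0}"
    and B: "B analytic_on {1}"
    and shift: "\<And>x. Re x < \<rho> \<Longrightarrow> f (x + 2 * of_real pi * \<i>) = c * f x + B (1 + exp x)"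
    and c: "c * exp (2 * of_real pi * \<i> * \<beta>) = -1"
  defines "S \<equiv> \<lambda>\<zeta>. contour_integral (linepath \<zeta>0 \<zeta>) (spiral_kernel \<beta> \<kappa> f \<zeta>)"
  shows "\<exists>\<rho>'\<le>Re \<zeta>0. \<forall>\<zeta>. Re \<zeta> < \<rho>' \<longrightarrow> S (\<zeta> + 4 * of_real pi * \<i>) = S \<zeta>"
proof -
  define \<tau> where "\<tau> = 2 * complex_of_real pi * \<i>"
  have Re\<tau> [simp]: "Re \<tau> = 0" and exp\<tau>: "exp (\<zeta> + \<tau>) = exp \<zeta>" for \<zeta>
    using exp_plus_2pin[of \<zeta> 1] by (simp_all add: \<tau>_def mult_ac)
  obtain r where r: "r > 0" "B holomorphic_on ball 1 r"
    using B by (auto simp: analytic_on_def)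
  define p where "p = complex_of_real (min (min \<rho> (Re \<zeta>0)) (ln (r / 3)) - 1)"
  have p1: "Re p < \<rho>" "Re p < Re \<zeta>0" by (auto simp: p_def)
  have p2: "3 * exp (Re p) < r"
  proof -
    have "exp (Re p) < exp (ln (r / 3))" unfolding exp_less_cancel_iff by (simp add: p_def)
    then show ?thesis using r by simp
  qed
  let ?k = "spiral_kernel \<beta> \<kappa> f"
  let ?b = "spiral_kernel \<beta> \<kappa> (\<lambda>x. B (1 + exp x))"
  define E where "E \<zeta> = contour_integral (linepath \<zeta>0 p) (?k \<zeta>)" for \<zeta>
  define K where "K \<zeta> = contour_integral (linepath p \<zeta>) (?k \<zeta>)" for \<zeta>
  define Kb where "Kb \<zeta> = contour_integral (linepath p \<zeta>) (?b \<zeta>)" for \<zeta>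
  define D where "D \<zeta> = contour_integral (linepath p (p + \<tau>)) (?k \<zeta>)" for \<zeta>
  define m where "m = exp (2 * of_real pi * \<i> * \<beta>)"
  have per: "?k (\<zeta> + \<tau>) = ?k \<zeta>" for \<zeta>
    unfolding \<tau>_def using spiral_kernel_periodic by blast
  have "E (\<zeta> + \<tau>) = E \<zeta>" "D (\<zeta> + \<tau>) = D \<zeta>" for \<zeta>
    by (simp_all add: E_def D_def per)
  note perED = this
  have bc: "continuous_on {x. Re x \<le> Re p} (\<lambda>x. B (1 + exp x))"
    and bh: "(\<lambda>x. B (1 + exp x)) holomorphic_on {x. Re x < Re p}"
  proof -
    have ball: "1 + exp x \<in> ball 1 r" if "Re x \<le> Re p" for x
    proof -
      have "exp (Re x) \<le> exp (Re p)" using that by simp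
      then have "exp (Re x) < r" using p2 exp_gt_zero[of "Re p"] by linarith
      then show ?thesis by (simp add: dist_norm)
    qed
    have "B \<circ> (\<lambda>x. 1 + exp x) holomorphic_on {x. Re x \<le> Re p}"
      by (intro holomorphic_on_compose holomorphic_on_subset[OF r(2)] holomorphic_intros)
         (use ball in auto)
    then have h: "(\<lambda>x. B (1 + exp x)) holomorphic_on {x. Re x \<le> Re p}" by (simp add: o_def)
    show "continuous_on {x. Re x \<le> Re p} (\<lambda>x. B (1 + exp x))"
      using h by (rule holomorphic_on_imp_continuous_on)
    show "(\<lambda>x. B (1 + exp x)) holomorphic_on {x. Re x < Re p}"
      using h by (rule holomorphic_on_subset) auto
  qed
  have perKb: "Kb (\<zeta> + \<tau>) = Kb \<zeta>" if "Re \<zeta> < Re p" for \<zeta>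
  proof -
    obtain V where "\<forall>\<zeta>'. exp \<zeta>' = exp \<zeta> \<and> Re \<zeta>' < Re p \<longrightarrow> Kb \<zeta>' = V"
      using spiral_integral_of_regular_part[OF \<beta> \<kappa> r(2) p2, of "exp \<zeta>"] unfolding Kb_def by blast
    then show ?thesis using that exp\<tau> by simp
  qed
  have S: "S \<zeta> = E \<zeta> + K \<zeta>" if "Re \<zeta> < Re p" for \<zeta>
    unfolding S_def E_def K_def using that p1
    by (intro contour_integral_spiral_kernel_split[OF \<beta> fc fh]) (auto simp: half_strip_def)
  have K: "K (\<zeta> + \<tau>) = D \<zeta> - K \<zeta> + m * Kb \<zeta>" if \<zeta>: "Re \<zeta> < Re p" for \<zeta>
  proof -
    have Rz: "Re (\<zeta> + \<tau>) \<le> Re \<zeta>0" "Re \<zeta> \<le> Re \<zeta>0" "Re \<zeta> \<le> Re p" using \<zeta> p1 by auto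
    have seg: "closed_segment p \<zeta> \<subseteq> {x. Re x < \<rho>}"
      using \<zeta> p1 by (intro closed_segment_subset convex_halfspace_Re_lt) auto
    have "K (\<zeta> + \<tau>) = D (\<zeta> + \<tau>) + contour_integral (linepath (p + \<tau>) (\<zeta> + \<tau>)) (?k (\<zeta> + \<tau>))"
      unfolding K_def D_def using \<zeta> p1
      by (intro contour_integral_spiral_kernel_split[OF \<beta> fc fh]) (auto simp: half_strip_def)
    also have "contour_integral (linepath (p + \<tau>) (\<zeta> + \<tau>)) (?k (\<zeta> + \<tau>)) =
               contour_integral (linepath p \<zeta>) (\<lambda>x. ?k (\<zeta> + \<tau>) (x + \<tau>))"
      by (rule contour_integral_linepath_translate)
    also have "\<dots> = contour_integral (linepath p \<zeta>) (\<lambda>x. m * (c * ?k \<zeta> x + ?b \<zeta> x))"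
    proof (rule contour_integral_cong)
      fix x assume "x \<in> path_image (linepath p \<zeta>)"
      then have "Re x < \<rho>" using seg by auto
      from spiral_kernel_shift[where g = "\<lambda>x. B (1 + exp x)", OF shift[OF this], of \<beta> \<kappa> \<zeta>]
      show "?k (\<zeta> + \<tau>) (x + \<tau>) = m * (c * ?k \<zeta> x + ?b \<zeta> x)"
        by (simp add: \<tau>_def m_def)
    qed auto
    also have "\<dots> = m * (c * K \<zeta> + Kb \<zeta>)"
    proof -
      have "?k \<zeta> contour_integrable_on linepath p \<zeta>"
        using \<zeta> p1 Rz by (intro contour_integrable_spiral_kernel[OF \<beta> fc fh]) (auto simp: half_strip_def)
      moreover have "?b \<zeta> contour_integrable_on linepath p \<zeta>"
        using \<zeta> Rz by (intro contour_integrable_spiral_kernel[OF \<beta> bc bh]) (auto simp: half_strip_def)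
      ultimately show ?thesis
        unfolding K_def Kb_def
        by (simp add: contour_integral_lmul contour_integral_add contour_integrable_lmul
            contour_integrable_add)
    qed
    also have "D (\<zeta> + \<tau>) + m * (c * K \<zeta> + Kb \<zeta>) = D \<zeta> + (c * m) * K \<zeta> + m * Kb \<zeta>"
      unfolding perED by (simp add: algebra_simps)
    also have "c * m = -1" using c by (simp add: m_def)
    finally show ?thesis by simp
  qed
  have "S (\<zeta> + 4 * of_real pi * \<i>) = S \<zeta>" if \<zeta>: "Re \<zeta> < Re p" for \<zeta>
  proof -
    \<comment> \<open>The right-hand side has the period \<open>\<tau>\<close>.\<close>
    have step: "S (\<zeta> + \<tau>) + S \<zeta> = 2 * E \<zeta> + D \<zeta> + m * Kb \<zeta>" if "Re \<zeta> < Re p" for \<zeta>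
      using S[of \<zeta>] S[of "\<zeta> + \<tau>"] K[OF that] perED that by simp
    have "S (\<zeta> + \<tau> + \<tau>) + S (\<zeta> + \<tau>) = S (\<zeta> + \<tau>) + S \<zeta>"
      using step[OF \<zeta>] step[of "\<zeta> + \<tau>"] \<zeta> perED perKb[OF \<zeta>] by simp
    then have "S (\<zeta> + \<tau> + \<tau>) = S \<zeta>" by (simp add: add.commute)
    moreover have "\<zeta> + \<tau> + \<tau> = \<zeta> + 4 * of_real pi * \<i>" by (simp add: \<tau>_def)
    ultimately show ?thesis by simp
  qed
  then show ?thesis using p1(2) by (intro exI[of _ "Re p"]) auto
qed

text \<open>
  For \<open>N \<le> Re \<beta>\<close> the kernel is bounded on horizontal half-strips.
\<close>
lemma norm_spiral_integral_le:
  assumes \<beta>: "Re \<beta> > 0"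
    and fc: "continuous_on {x. Re x \<le> Re \<zeta>0} f" and fh: "f holomorphic_on {x. Re x < Re \<zeta>0}"
    and N: "N \<le> Re \<beta>" and C: "\<And>x. Re x < \<rho> \<Longrightarrow> \<bar>Im x\<bar> \<le> M \<Longrightarrow> norm (f x) \<le> C * exp (- N * Re x)"
    and M: "\<bar>Im \<zeta>0\<bar> \<le> M"
  shows "\<exists>C'. \<forall>\<zeta>. Re \<zeta> < Re \<zeta>0 \<and> \<bar>Im \<zeta>\<bar> \<le> M \<longrightarrow>
           norm (contour_integral (linepath \<zeta>0 \<zeta>) (spiral_kernel \<beta> \<kappa> f \<zeta>)) \<le> C' * norm (\<zeta> - \<zeta>0)"
proof -
  let ?Z = "cbox (Complex (min \<rho> (Re \<zeta>0)) (-M)) (Complex (Re \<zeta>0) M)"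
  have "continuous_on ?Z (\<lambda>x. f x * exp (of_real N * x))"
    by (intro continuous_intros continuous_on_subset[OF fc]) (auto simp: in_cbox_complex_iff)
  then have "compact ((\<lambda>x. f x * exp (of_real N * x)) ` ?Z)"
    by (intro compact_continuous_image) auto
  then have "bounded ((\<lambda>x. f x * exp (of_real N * x)) ` ?Z)" by (rule compact_imp_bounded)
  then obtain C1 where C1: "\<And>x. x \<in> ?Z \<Longrightarrow> norm (f x * exp (of_real N * x)) \<le> C1"
    by (auto simp: bounded_iff)
  define C2 where "C2 = max (max C C1) 0"
  have f: "norm (f x) \<le> C2 * exp (- N * Re x)" if "Re x \<le> Re \<zeta>0" "\<bar>Im x\<bar> \<le> M" for x
  proof (cases "Re x < \<rho>")
    case True
    then have "norm (f x) \<le> C * exp (- N * Re x)" using C that by blast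
    also have "\<dots> \<le> C2 * exp (- N * Re x)" by (intro mult_right_mono) (auto simp: C2_def)
    finally show ?thesis .
  next
    case False
    then have "x \<in> ?Z" using that by (auto simp: in_cbox_complex_iff)
    from C1[OF this] have "norm (f x) * exp (N * Re x) \<le> C2"
      by (auto simp: norm_mult C2_def)
    then have "norm (f x) \<le> C2 / exp (N * Re x)" by (simp add: pos_le_divide_eq)
    then show ?thesis by (simp add: exp_minus divide_inverse)
  qed
  define C3 where "C3 = C2 * exp ((Re \<beta> - N + 1) * Re \<zeta>0) * exp (\<bar>Im \<beta>\<bar> * (M + \<bar>Im \<kappa>\<bar>) + Re \<beta> * Re \<kappa>) *
        (2 powr Re \<beta> * exp (pi * \<bar>Im \<beta>\<bar>))"
  have "norm (spiral_kernel \<beta> \<kappa> f \<zeta> x) \<le> C3"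
    if x: "Re x \<le> Re \<zeta>0" "\<bar>Im x\<bar> \<le> M" "Re \<zeta> \<le> Re x" for \<zeta> x
  proof -
    have q: "norm ((1 - exp (\<zeta> - x)) powr \<beta>) \<le> 2 powr Re \<beta> * exp (pi * \<bar>Im \<beta>\<bar>)"
    proof (cases "1 - exp (\<zeta> - x) = 0")
      case False
      have "norm (1 - exp (\<zeta> - x)) \<le> norm (1 :: complex) + norm (exp (\<zeta> - x))" by (rule norm_triangle_ineq4)
      also have "\<dots> \<le> 2" using x by simp
      finally have "norm (1 - exp (\<zeta> - x)) powr Re \<beta> \<le> 2 powr Re \<beta>"
        using \<beta> by (intro powr_mono2) auto
      then show ?thesis
        by (intro order_trans[OF norm_powr_le_complex[OF False]] mult_right_mono) auto
    qed simp
    have e: "norm (exp (\<beta> * (x + \<kappa>))) \<le> exp (Re \<beta> * Re x) * exp (\<bar>Im \<beta>\<bar> * (M + \<bar>Im \<kappa>\<bar>) + Re \<beta> * Re \<kappa>)"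
    proof -
      have "- (Im \<beta> * (Im x + Im \<kappa>)) \<le> \<bar>Im \<beta>\<bar> * \<bar>Im x + Im \<kappa>\<bar>"
        by (metis abs_ge_minus_self abs_mult)
      also have "\<dots> \<le> \<bar>Im \<beta>\<bar> * (M + \<bar>Im \<kappa>\<bar>)"
        using x by (intro mult_left_mono) auto
      finally show ?thesis by (simp add: algebra_simps flip: exp_add)
    qed
    have "norm (spiral_kernel \<beta> \<kappa> f \<zeta> x) =
          norm (f x) * exp (Re x) * norm (exp (\<beta> * (x + \<kappa>))) * norm ((1 - exp (\<zeta> - x)) powr \<beta>)"
      by (simp only: spiral_kernel_def norm_mult norm_exp_eq_Re)
    also have "\<dots> \<le> (C2 * exp (- N * Re x)) * exp (Re x) *
        (exp (Re \<beta> * Re x) * exp (\<bar>Im \<beta>\<bar> * (M + \<bar>Im \<kappa>\<bar>) + Re \<beta> * Re \<kappa>)) * (2 powr Re \<beta> * exp (pi * \<bar>Im \<beta>\<bar>))"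
      by (intro mult_mono q e f x order_refl) (auto simp: C2_def)
    also have "\<dots> = C2 * exp ((Re \<beta> - N + 1) * Re x) * exp (\<bar>Im \<beta>\<bar> * (M + \<bar>Im \<kappa>\<bar>) + Re \<beta> * Re \<kappa>) *
        (2 powr Re \<beta> * exp (pi * \<bar>Im \<beta>\<bar>))"
    proof -
      have "exp ((Re \<beta> - N + 1) * Re x) = exp (- N * Re x) * exp (Re x) * exp (Re \<beta> * Re x)"
        unfolding exp_add[symmetric] by (simp add: algebra_simps)
      then show ?thesis by (simp only: mult_ac)
    qed
    also have "\<dots> \<le> C3"
      unfolding C3_def using N x by (intro mult_right_mono mult_left_mono)
          (auto simp: C2_def intro!: mult_left_mono)
    finally show ?thesis .
  qed
  note bound = this
  have C3: "C3 \<ge> 0" unfolding C3_def C2_def by simp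
  have "norm (contour_integral (linepath \<zeta>0 \<zeta>) (spiral_kernel \<beta> \<kappa> f \<zeta>)) \<le> C3 * norm (\<zeta> - \<zeta>0)"
    if \<zeta>: "Re \<zeta> < Re \<zeta>0" "\<bar>Im \<zeta>\<bar> \<le> M" for \<zeta>
  proof (rule contour_integral_bound_linepath)
    show "spiral_kernel \<beta> \<kappa> f \<zeta> contour_integrable_on linepath \<zeta>0 \<zeta>"
      using \<zeta> by (intro contour_integrable_spiral_kernel[OF \<beta> fc fh]) (auto simp: half_strip_def)
    fix x assume "x \<in> closed_segment \<zeta>0 \<zeta>"
    moreover have "closed_segment \<zeta>0 \<zeta> \<subseteq> {x. Re x \<le> Re \<zeta>0} \<inter> {x. Re x \<ge> Re \<zeta>} \<inter> {x. Im x
        \<le> M} \<inter> {x. Im x \<ge> - M}"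
      using \<zeta> M
      by (intro closed_segment_subset convex_Int convex_halfspace_Re_le convex_halfspace_Re_ge
            convex_halfspace_Im_le convex_halfspace_Im_ge) auto
    ultimately show "norm (spiral_kernel \<beta> \<kappa> f \<zeta> x) \<le> C3"
      by (intro bound) (auto simp: abs_le_iff)
  qed (use C3 in auto)
  then show ?thesis by blast
qed

lemma spiral_integral_double_cover_analytic:
  assumes \<beta>: "Re \<beta> > 0" and \<kappa>: "exp \<kappa> = -1"
    and fc: "continuous_on {x. Re x \<le> Re \<zeta>0} f" and fh: "f holomorphic_on {x. Re x < Re \<zeta>0}"
    and B: "B analytic_on {1}"
    and shift: "\<And>x. Re x < \<rho> \<Longrightarrow> f (x + 2 * of_real pi * \<i>) = c * f x + B (1 + exp x)"
    and c: "c * exp (2 * of_real pi * \<i> * \<beta>) = -1"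
    and N: "N \<le> Re \<beta>"
    and growth: "\<And>M. \<exists>C \<rho>. \<forall>x. Re x < \<rho> \<and> \<bar>Im x\<bar> \<le> M \<longrightarrow> norm (f x) \<le> C * exp (- N * Re x)"
  shows "\<exists>G \<rho>'. G analytic_on {1} \<and> (\<forall>u. Re u < \<rho>' \<longrightarrow>
           contour_integral (linepath \<zeta>0 (2 * u + v)) (spiral_kernel \<beta> \<kappa> f (2 * u + v)) = G (1 + exp u))"
proof -
  define S where "S \<zeta> = contour_integral (linepath \<zeta>0 \<zeta>) (spiral_kernel \<beta> \<kappa> f \<zeta>)" for \<zeta>
  obtain \<rho>1 where \<rho>1: "\<rho>1 \<le> Re \<zeta>0" "\<And>\<zeta>. Re \<zeta> < \<rho>1 \<Longrightarrow> S (\<zeta> + 4 * of_real pi * \<i>) = S \<zeta>"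
    using spiral_integral_periodic[OF \<beta> \<kappa> fc fh B shift c] unfolding S_def by blast
  define M where "M = 2 * pi + \<bar>Im v\<bar> + \<bar>Im \<zeta>0\<bar>"
  obtain C \<rho>2 where "\<And>x. Re x < \<rho>2 \<Longrightarrow> \<bar>Im x\<bar> \<le> M \<Longrightarrow> norm (f x) \<le> C * exp (- N * Re x)"
    using growth[of M] by blast
  moreover have "\<bar>Im \<zeta>0\<bar> \<le> M" by (simp add: M_def)
  ultimately obtain C' where C': "\<And>\<zeta>. Re \<zeta> < Re \<zeta>0 \<Longrightarrow> \<bar>Im \<zeta>\<bar> \<le> M \<Longrightarrow> norm (S \<zeta>) \<le> C' * norm (\<zeta> - \<zeta>0)"
    using norm_spiral_integral_le[OF \<beta> fc fh N] unfolding S_def by meson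
  have "S holomorphic_on {\<zeta>. Re \<zeta> < Re \<zeta>0}"
    unfolding S_def by (rule holomorphic_spiral_integral[OF \<beta> fc fh]) simp
  then have hol: "S \<circ> (\<lambda>u. 2 * u + v) holomorphic_on {u. Re u < (\<rho>1 - Re v) / 2}"
    by (intro holomorphic_on_compose holomorphic_intros)
       (erule holomorphic_on_subset, use \<rho>1(1) in auto)
  have "\<exists>G. G analytic_on {1} \<and> (\<forall>u. Re u < (\<rho>1 - Re v) / 2 \<longrightarrow> (S \<circ> (\<lambda>u. 2 * u + v)) u = G (1 + exp u))"
  proof (rule periodic_function_extends[OF hol])
    fix u assume u: "Re u < (\<rho>1 - Re v) / 2"
    show "(S \<circ> (\<lambda>u. 2 * u + v)) (u + 2 * of_real pi * \<i>) = (S \<circ> (\<lambda>u. 2 * u + v)) u"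
      using \<rho>1(2)[of "2 * u + v"] u by (simp add: algebra_simps)
    assume "\<bar>Im u\<bar> \<le> pi"
    then have "norm (S (2 * u + v)) \<le> C' * norm (2 * u + v - \<zeta>0)"
      using u \<rho>1(1) by (intro C') (auto simp: M_def)
    also have "\<dots> \<le> \<bar>C'\<bar> * ((2 + norm (v - \<zeta>0)) * (1 + norm u))"
    proof (intro mult_mono)
      have "norm (2 * u + v - \<zeta>0) \<le> norm (2 * u) + norm (v - \<zeta>0)"
        by (metis add_diff_eq norm_triangle_ineq)
      also have "\<dots> \<le> (2 + norm (v - \<zeta>0)) * (1 + norm u)"
        by (simp add: algebra_simps norm_mult)
      finally show "norm (2 * u + v - \<zeta>0) \<le> (2 + norm (v - \<zeta>0)) * (1 + norm u)" .
    qed auto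
    finally show "norm ((S \<circ> (\<lambda>u. 2 * u + v)) u) \<le> \<bar>C'\<bar> * (2 + norm (v - \<zeta>0)) * (1 + norm u)"
      by (simp add: mult.assoc)
  qed
  then show ?thesis unfolding S_def o_def by blast
qed

section \<open>Monodromy of elementary singularities\<close>

lemma analytic_at_one_bounded:
  assumes "A analytic_on {1}"
  shows "\<exists>C \<rho>. C \<ge> 0 \<and> (\<forall>x. Re x < \<rho> \<longrightarrow> norm (A (1 + exp x)) \<le> C)"
proof -
  have "isCont A 1"
    using assms analytic_on_imp_differentiable_at field_differentiable_imp_continuous_at by blast
  then obtain d where d: "d > 0" "\<And>w. dist w 1 < d \<Longrightarrow> dist (A w) (A 1) < 1"
    unfolding continuous_at_eps_delta using zero_less_one by blast
  have "norm (A (1 + exp x)) \<le> norm (A 1) + 1" if "Re x < ln d" for x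
  proof -
    have "exp (Re x) < exp (ln d)" using that by simp
    then have "dist (1 + exp x) 1 < d" using d(1) by (simp add: dist_norm)
    then have "norm (A (1 + exp x) - A 1) < 1" using d(2) by (simp add: dist_norm)
    then show ?thesis using norm_triangle_ineq2[of "A (1 + exp x)" "A 1"] by linarith
  qed
  then show ?thesis by (intro exI[of _ "norm (A 1) + 1"] exI[of _ "ln d"]) auto
qed

lemma DERIV_comp_one_plus_exp:
  assumes "A analytic_on {1}"
  shows "\<exists>\<rho>. \<forall>x. Re x < \<rho> \<longrightarrow>
           ((\<lambda>x. A (1 + exp x)) has_field_derivative deriv A (1 + exp x) * exp x) (at x)"
proof -
  obtain r where r: "r > 0" "A holomorphic_on ball 1 r"
    using assms by (auto simp: analytic_on_def)
  have "((\<lambda>x. A (1 + exp x)) has_field_derivative deriv A (1 + exp x) * exp x) (at x)" if "Re x < ln r" for x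
  proof -
    have "exp (Re x) < exp (ln r)" using that by simp
    then have "1 + exp x \<in> ball 1 r" using r(1) by (simp add: dist_norm)
    then have "(A has_field_derivative deriv A (1 + exp x)) (at (1 + exp x))"
      using r(2) holomorphic_derivI open_ball by blast
    then show ?thesis
      by (rule DERIV_chain2[where f = A and g = "\<lambda>x. 1 + exp x"]) (auto intro!: derivative_eq_intros)
  qed
  then show ?thesis by blast
qed

lemma tendsto_analytic_at_one:
  assumes "A analytic_on {1}"
  shows "(\<lambda>n. A (1 + exp (complex_of_real (- real n)))) \<longlonglongrightarrow> A 1"
proof -
  have "isCont A 1"
    using assms analytic_on_imp_differentiable_at field_differentiable_imp_continuous_at by blast
  moreover have "(\<lambda>n. 1 + complex_of_real (exp (- real n))) \<longlonglongrightarrow> 1 + of_real 0"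
    by (intro tendsto_intros filterlim_compose[OF exp_at_bot]
        filterlim_compose[OF filterlim_uminus_at_bot_at_top]
          filterlim_real_sequentially)
  ultimately show ?thesis
    by (intro isCont_tendsto_compose[of 1 A]) (simp_all flip: exp_of_real)
qed

text \<open>
  The derivation is determined by the values on a left half-plane.
\<close>
lemma deriv_w_eqI:
  assumes "\<And>x. Re x < \<rho> \<Longrightarrow> g x = h x" and "Re x < \<rho>" and "(h has_field_derivative D) (at x)"
  shows "deriv_w g x = exp (- x) * D"
proof -
  have "(g has_field_derivative D) (at x)"
    by (rule has_field_derivative_transform_within_open[OF assms(3) open_halfspace_Re_lt[of \<rho>]])
       (use assms in auto)
  then show ?thesis unfolding deriv_w_def by (simp add: DERIV_imp_deriv)
qed

text \<open>
  Derivatives of \<open>ln (w - 1) * a w\<close>: the coefficient \<open>b\<close> of the logarithm stays analytic, being the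
  \<open>k\<close>-th derivative of \<open>a\<close>, and the rest has a pole of order at most \<open>k\<close>.
\<close>
lemma deriv_w_iterate_log:
  assumes "a analytic_on {1}"
  shows "\<exists>b E \<rho>. b analytic_on {1} \<and> E analytic_on {1} \<and> (\<forall>x. Re x < \<rho> \<longrightarrow>
           (deriv_w ^^ k) (\<lambda>x. x * a (1 + exp x)) x = x * b (1 + exp x)
               + exp (- of_nat k * x) * E (1 + exp x))"
proof (induction k)
  case 0
  show ?case using assms by (intro exI[of _ a] exI[of _ "\<lambda>_. 0"]) auto
next
  case (Suc k)
  then obtain b E \<rho> where b: "b analytic_on {1}" and E: "E analytic_on {1}"
    and eq: "\<And>x. Re x < \<rho> \<Longrightarrow> (deriv_w ^^ k) (\<lambda>x. x * a (1 + exp x)) x =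
                x * b (1 + exp x) + exp (- of_nat k * x) * E (1 + exp x)"
    by blast
  obtain \<rho>1 where \<rho>1: "\<And>x. Re x < \<rho>1 \<Longrightarrow> ((\<lambda>x. b (1 + exp x))
      has_field_derivative deriv b (1 + exp x) * exp x) (at x)"
    using DERIV_comp_one_plus_exp[OF b] by blast
  obtain \<rho>2 where \<rho>2: "\<And>x. Re x < \<rho>2 \<Longrightarrow> ((\<lambda>x. E (1 + exp x))
      has_field_derivative deriv E (1 + exp x) * exp x) (at x)"
    using DERIV_comp_one_plus_exp[OF E] by blast
  define E' where "E' w = (w - 1) ^ k * b w - of_nat k * E w + (w - 1) * deriv E w" for w
  have "E' analytic_on {1}"
    unfolding E'_def using b E by (intro analytic_intros) auto
  moreover have "deriv b analytic_on {1}" using b by (rule analytic_deriv)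
  moreover have "(deriv_w ^^ Suc k) (\<lambda>x. x * a (1 + exp x)) x =
      x * deriv b (1 + exp x) + exp (- of_nat (Suc k) * x) * E' (1 + exp x)"
    if x: "Re x < min \<rho> (min \<rho>1 \<rho>2)" for x
  proof -
    have d: "((\<lambda>x. x * b (1 + exp x) + exp (- of_nat k * x) * E (1 + exp x)) has_field_derivative
        b (1 + exp x) + x * (deriv b (1 + exp x) * exp x) +
        (exp (- of_nat k * x) * (- of_nat k) * E (1 + exp x)
            + exp (- of_nat k * x) * (deriv E (1 + exp x) * exp x))) (at x)"
      using \<rho>1[of x] \<rho>2[of x] x by (auto intro!: derivative_eq_intros)
    have 1: "exp (- x) * exp x = 1" by (simp flip: exp_add)
    have 2: "exp (- of_nat (Suc k) * x) = exp (- x) * exp (- of_nat k * x)"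
      by (simp add: algebra_simps flip: exp_add)
    have 3: "exp (- of_nat k * x) * exp x ^ k = 1"
      by (simp flip: exp_of_nat_mult exp_add)
    have "(deriv_w ^^ Suc k) (\<lambda>x. x * a (1 + exp x)) x = exp (- x) *
       (b (1 + exp x) + x * (deriv b (1 + exp x) * exp x) +
        (exp (- of_nat k * x) * (- of_nat k) * E (1 + exp x)
            + exp (- of_nat k * x) * (deriv E (1 + exp x) * exp x)))"
      unfolding funpow.simps o_def using x by (intro deriv_w_eqI[OF eq _ d]) auto
    also have "\<dots> = x * deriv b (1 + exp x) * (exp (- x) * exp x) +
        exp (- x) * (b (1 + exp x) * (exp (- of_nat k * x) * exp x ^ k)
          - exp (- of_nat k * x) * of_nat k * E (1 + exp x)
              + exp (- of_nat k * x) * (deriv E (1 + exp x) * exp x))"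
      unfolding 3 by (simp add: algebra_simps)
    also have "\<dots> = x * deriv b (1 + exp x) + exp (- of_nat (Suc k) * x) * E' (1 + exp x)"
      unfolding 1 2 E'_def by (simp add: algebra_simps)
    finally show ?thesis .
  qed
  ultimately show ?case
    by (intro exI[of _ "deriv b"] exI[of _ E'] exI[of _ "min \<rho> (min \<rho>1 \<rho>2)"]) auto
qed

text \<open>
  If \<open>\<alpha>\<close> is not a natural number, each derivative lowers the exponent of the leading term by
  exactly one. What matters below is that the values of \<open>A1\<close>
      and \<open>A2\<close> at \<open>1\<close> are multiples of \<open>A 1\<close>, with factors
  that do not depend on \<open>A\<close>.
\<close>
lemma deriv_w_iterate_pole:
  assumes \<alpha>: "\<And>j. \<alpha> \<noteq> of_nat j"
  shows "\<exists>c1 c2. c1 \<noteq> 0 \<and> (\<forall>A. A analytic_on {1} \<longrightarrow>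
           (\<exists>A1 A2 \<rho>. A1 analytic_on {1} \<and> A2 analytic_on {1} \<and> A1 1 = c1 * A 1 \<and> A2 1 = c2 * A 1 \<and>
             (\<forall>x. Re x < \<rho> \<longrightarrow> (deriv_w ^^ k) (\<lambda>x. exp (\<alpha> * x) * x * A (1 + exp x)) x =
                exp ((\<alpha> - of_nat k) * x) * (x * A1 (1 + exp x) + A2 (1 + exp x)))))"
proof (induction k)
  case 0
  show ?case
  proof (rule exI[of _ 1], rule exI[of _ 0], intro conjI allI impI)
    fix A :: "complex \<Rightarrow> complex" assume "A analytic_on {1}"
    then show "\<exists>A1 A2 \<rho>. A1 analytic_on {1} \<and> A2 analytic_on {1} \<and> A1 1 = 1 * A 1 \<and> A2 1 = 0 * A 1 \<and>
             (\<forall>x. Re x < \<rho> \<longrightarrow> (deriv_w ^^ 0) (\<lambda>x. exp (\<alpha> * x) * x * A (1 + exp x)) x =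
                exp ((\<alpha> - of_nat 0) * x) * (x * A1 (1 + exp x) + A2 (1 + exp x)))"
      by (intro exI[of _ A] exI[of _ "\<lambda>_. 0"]) (auto simp: mult_ac)
  qed simp
next
  case (Suc k)
  then obtain c1 c2 where c1: "c1 \<noteq> 0" and IH: "\<And>A. A analytic_on {1} \<Longrightarrow>
           (\<exists>A1 A2 \<rho>. A1 analytic_on {1} \<and> A2 analytic_on {1} \<and> A1 1 = c1 * A 1 \<and> A2 1 = c2 * A 1 \<and>
             (\<forall>x. Re x < \<rho> \<longrightarrow> (deriv_w ^^ k) (\<lambda>x. exp (\<alpha> * x) * x * A (1 + exp x)) x =
                exp ((\<alpha> - of_nat k) * x) * (x * A1 (1 + exp x) + A2 (1 + exp x))))"
    by blast
  let ?g = "\<alpha> - of_nat k"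
  show ?case
  proof (rule exI[of _ "?g * c1"], rule exI[of _ "?g * c2 + c1"], intro conjI allI impI)
    show "?g * c1 \<noteq> 0" using \<alpha>[of k] c1 by simp
    fix A :: "complex \<Rightarrow> complex" assume "A analytic_on {1}"
    then obtain A1 A2 \<rho> where A: "A1 analytic_on {1}" "A2 analytic_on {1}" "A1 1 = c1 * A 1" "A2 1 = c2 * A 1"
      and eq: "\<And>x. Re x < \<rho> \<Longrightarrow> (deriv_w ^^ k) (\<lambda>x. exp (\<alpha> * x) * x * A (1 + exp x)) x =
                exp (?g * x) * (x * A1 (1 + exp x) + A2 (1 + exp x))"
      using IH by blast
    obtain \<rho>1 where \<rho>1: "\<And>x. Re x < \<rho>1 \<Longrightarrow> ((\<lambda>x. A1 (1 + exp x))
        has_field_derivative deriv A1 (1 + exp x) * exp x) (at x)"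
      using DERIV_comp_one_plus_exp[OF A(1)] by blast
    obtain \<rho>2 where \<rho>2: "\<And>x. Re x < \<rho>2 \<Longrightarrow> ((\<lambda>x. A2 (1 + exp x))
        has_field_derivative deriv A2 (1 + exp x) * exp x) (at x)"
      using DERIV_comp_one_plus_exp[OF A(2)] by blast
    define B1 where "B1 w = ?g * A1 w + (w - 1) * deriv A1 w" for w
    define B2 where "B2 w = ?g * A2 w + A1 w + (w - 1) * deriv A2 w" for w
    have "B1 analytic_on {1}" "B2 analytic_on {1}"
      unfolding B1_def B2_def using A by (auto intro!: analytic_intros)
    moreover have "B1 1 = ?g * c1 * A 1" "B2 1 = (?g * c2 + c1) * A 1"
      using A by (simp_all add: B1_def B2_def algebra_simps)
    moreover have "(deriv_w ^^ Suc k) (\<lambda>x. exp (\<alpha> * x) * x * A (1 + exp x)) x =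
        exp ((\<alpha> - of_nat (Suc k)) * x) * (x * B1 (1 + exp x) + B2 (1 + exp x))"
      if x: "Re x < min \<rho> (min \<rho>1 \<rho>2)" for x
    proof -
      have d: "((\<lambda>x. exp (?g * x) * (x * A1 (1 + exp x) + A2 (1 + exp x))) has_field_derivative
          exp (?g * x) * ?g * (x * A1 (1 + exp x) + A2 (1 + exp x)) +
          exp (?g * x) * (A1 (1 + exp x) + x * (deriv A1 (1 + exp x) * exp x)
              + deriv A2 (1 + exp x) * exp x)) (at x)"
        using \<rho>1[of x] \<rho>2[of x] x by (auto intro!: derivative_eq_intros)
      have 2: "exp ((\<alpha> - of_nat (Suc k)) * x) = exp (- x) * exp (?g * x)"
        by (simp add: algebra_simps flip: exp_add)
      have "(deriv_w ^^ Suc k) (\<lambda>x. exp (\<alpha> * x) * x * A (1 + exp x)) x = exp (- x) *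
         (exp (?g * x) * ?g * (x * A1 (1 + exp x) + A2 (1 + exp x)) +
          exp (?g * x) * (A1 (1 + exp x) + x * (deriv A1 (1 + exp x) * exp x)
              + deriv A2 (1 + exp x) * exp x))"
        unfolding funpow.simps o_def using x by (intro deriv_w_eqI[OF eq _ d]) auto
      also have "\<dots> = exp ((\<alpha> - of_nat (Suc k)) * x) * (x * B1 (1 + exp x) + B2 (1 + exp x))"
        unfolding 2 B1_def B2_def by (simp add: algebra_simps)
      finally show ?thesis .
    qed
    ultimately show "\<exists>A1 A2 \<rho>. A1 analytic_on {1} \<and> A2 analytic_on {1} \<and> A1 1 = ?g * c1 * A 1 \<and>
        A2 1 = (?g * c2 + c1) * A 1 \<and>
        (\<forall>x. Re x < \<rho> \<longrightarrow> (deriv_w ^^ Suc k) (\<lambda>x. exp (\<alpha> * x) * x * A (1 + exp x)) x =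
          exp ((\<alpha> - of_nat (Suc k)) * x) * (x * A1 (1 + exp x) + A2 (1 + exp x)))"
      by (intro exI[of _ B1] exI[of _ B2] exI[of _ "min \<rho> (min \<rho>1 \<rho>2)"]) auto
  qed
qed

lemma log_point_translate:
  "log_point S \<delta> (\<zeta>0 + 2 * of_real pi * \<i>) (x + 2 * of_real pi * \<i>) = log_point S \<delta> \<zeta>0 x"
proof -
  have "linepath (\<zeta>0 + 2 * of_real pi * \<i>) (x + 2 * of_real pi * \<i>) t = linepath \<zeta>0 x t
      + 2 * of_real pi * \<i>" for t
    by (simp add: linepath_def algebra_simps)
  moreover have "exp (y + 2 * of_real pi * \<i>) = exp y" for y
    using exp_plus_2pin[of y 1] by (simp add: mult_ac)
  ultimately show ?thesis by (simp add: log_point_def spiral_curve_def)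
qed

lemma log_coordinate_translate:
  assumes "log_coordinate S \<omega> \<delta> \<zeta>0"
  shows "log_coordinate S \<omega> \<delta> (\<zeta>0 + 2 * of_real pi * \<i>)"
proof -
  have "exp (\<zeta>0 + 2 * of_real pi * \<i>) = exp \<zeta>0"
    using exp_plus_2pin[of \<zeta>0 1] by (simp add: mult_ac)
  then show ?thesis using assms by (simp add: log_coordinate_def)
qed

lemma exp_Ints_period:
  assumes "g \<in> \<int>"
  shows "exp (g * (x + 2 * of_real pi * \<i>)) = exp (g * x)"
proof -
  obtain n :: int where "g = of_int n" using assms by (auto elim: Ints_cases)
  then show ?thesis
    using exp_plus_2pin[of "g * x" n] by (simp add: algebra_simps)
qed

text \<open>
  On two neighbouring sheets the functions \<open>A\<close> must agree at \<open>1\<close>, hence so do the functions \<open>A2\<close>. But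
  passing to the other sheet adds \<open>2 * pi * \<i> * A1\<close> to \<open>A2\<close>, which for a pole cannot be absorbed in
  \<open>B\<close>; this contradicts \<open>A1 1 \<noteq> 0\<close>.
\<close>
lemma log_singularity_exponent_nonneg:
  assumes \<alpha>: "\<alpha> \<in> \<int>" and L: "log_coordinate S \<omega> \<delta> \<zeta>0"
    and form: "\<And>\<delta> \<zeta>0. log_coordinate S \<omega> \<delta> \<zeta>0 \<Longrightarrow>
           \<exists>A B \<rho>. A analytic_on {1} \<and> B analytic_on {1} \<and> A 1 \<noteq> 0 \<and>
              (\<forall>\<zeta>. Re \<zeta> < \<rho> \<longrightarrow>
                 F (log_point S \<delta> \<zeta>0 \<zeta>) =
                   (deriv_w ^^ k) (\<lambda>x. exp (\<alpha> * x) * x * A (1 + exp x)) \<zeta> + B (1 + exp \<zeta>))"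
  shows "\<exists>n. \<alpha> = of_nat n"
proof (rule ccontr)
  assume "\<nexists>n. \<alpha> = of_nat n"
  then have nat: "\<alpha> \<noteq> of_nat n" for n by blast
  define \<tau> where "\<tau> = 2 * complex_of_real pi * \<i>"
  let ?g = "\<alpha> - of_nat k"
  have g: "?g \<in> \<int>" using \<alpha> by simp
  have \<tau>: "Re \<tau> = 0" "\<tau> \<noteq> 0" "exp (x + \<tau>) = exp x" "exp (?g * (x + \<tau>)) = exp (?g * x)" for x
    using exp_plus_2pin[of x 1] exp_Ints_period[OF g, of x] by (simp_all add: \<tau>_def mult_ac)
  obtain c1 c2 where c1: "c1 \<noteq> 0" and J: "\<And>A. A analytic_on {1} \<Longrightarrow>
           (\<exists>A1 A2 \<rho>. A1 analytic_on {1} \<and> A2 analytic_on {1} \<and> A1 1 = c1 * A 1 \<and> A2 1 = c2 * A 1 \<and>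
             (\<forall>x. Re x < \<rho> \<longrightarrow> (deriv_w ^^ k) (\<lambda>x. exp (\<alpha> * x) * x * A (1 + exp x)) x =
                exp (?g * x) * (x * A1 (1 + exp x) + A2 (1 + exp x))))"
    using deriv_w_iterate_pole[OF nat] by blast
  have form': "\<exists>A A1 A2 B \<rho>. A1 analytic_on {1} \<and> A2 analytic_on {1} \<and> B analytic_on {1} \<and> A 1 \<noteq> 0 \<and>
        A1 1 = c1 * A 1 \<and> A2 1 = c2 * A (1 :: complex) \<and>
        (\<forall>x. Re x < \<rho> \<longrightarrow> F (log_point S \<delta> \<zeta> x) = exp (?g * x) * (x * A1 (1 + exp x) + A2 (1 + exp x))
            + B (1 + exp x))"
    if L: "log_coordinate S \<omega> \<delta> \<zeta>" for \<zeta>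
  proof -
    obtain A B \<rho>1 where A: "A analytic_on {1}" "B analytic_on {1}" "A 1 \<noteq> 0"
      "\<And>x. Re x < \<rho>1 \<Longrightarrow> F (log_point S \<delta> \<zeta> x) =
                   (deriv_w ^^ k) (\<lambda>x. exp (\<alpha> * x) * x * A (1 + exp x)) x + B (1 + exp x)"
      using form[OF L] by blast
    obtain A1 A2 \<rho>2 where A12: "A1 analytic_on {1}" "A2 analytic_on {1}" "A1 1 = c1 * A 1" "A2 1 = c2 * A 1"
      "\<And>x. Re x < \<rho>2 \<Longrightarrow> (deriv_w ^^ k) (\<lambda>x. exp (\<alpha> * x) * x * A (1 + exp x)) x =
                exp (?g * x) * (x * A1 (1 + exp x) + A2 (1 + exp x))"
      using J[OF A(1)] by blast
    show ?thesis
      using A A12 by (intro exI[of _ A] exI[of _ A1] exI[of _ A2] exI[of _ B] exI[of _ "min \<rho>1 \<rho>2"]) auto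
  qed
  obtain A A1 A2 B \<rho>1 where A: "A1 analytic_on {1}" "A2 analytic_on {1}" "B analytic_on {1}" "A 1 \<noteq> 0"
      "A1 1 = c1 * A 1" "A2 1 = c2 * A (1 :: complex)"
      "\<And>x. Re x < \<rho>1 \<Longrightarrow> F (log_point S \<delta> \<zeta>0 x) = exp (?g * x) * (x * A1 (1 + exp x) + A2 (1 + exp x))
          + B (1 + exp x)"
    using form'[OF L] by blast
  obtain A' A1' A2' B' \<rho>2 where A': "A1' analytic_on {1}" "A2' analytic_on {1}" "B' analytic_on {1}" "A'
      1 \<noteq> 0"
      "A1' 1 = c1 * A' 1" "A2' 1 = c2 * A' (1 :: complex)"
      "\<And>x. Re x < \<rho>2 \<Longrightarrow> F (log_point S \<delta> (\<zeta>0 + 2 * of_real pi * \<i>) x) =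
          exp (?g * x) * (x * A1' (1 + exp x) + A2' (1 + exp x)) + B' (1 + exp x)"
    using form'[OF log_coordinate_translate[OF L]] by blast
  define \<rho> where "\<rho> = min \<rho>1 \<rho>2"
  have eq: "exp (?g * x) * (x * A1 (1 + exp x) + A2 (1 + exp x)) + B (1 + exp x) =
            exp (?g * x) * ((x + \<tau>) * A1' (1 + exp x) + A2' (1 + exp x)) + B' (1 + exp x)" if "Re x < \<rho>" for x
  proof -
    have "F (log_point S \<delta> (\<zeta>0 + 2 * of_real pi * \<i>) (x + \<tau>)) = F (log_point S \<delta> \<zeta>0 x)"
      unfolding \<tau>_def log_point_translate ..
    then show ?thesis
      using A(7)[of x] A'(7)[of "x + \<tau>"] that \<tau> by (simp add: \<rho>_def)
  qed
  have A1eq: "A1 (1 + exp x) = A1' (1 + exp x)" if "Re x < \<rho>" for x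
  proof -
    define E where "E = exp (?g * x)"
    have "Re (x + \<tau>) < \<rho>" using that \<tau>(1) by simp
    \<comment> \<open>The difference of the relations at \<open>x + \<tau>\<close> and at \<open>x\<close> isolates the coefficients of \<open>x\<close>.\<close>
    note e2 = eq[OF this, unfolded \<tau>(3,4), folded E_def]
    have "E * (\<tau> * (A1 (1 + exp x) - A1' (1 + exp x))) =
        (E * ((x + \<tau>) * A1 (1 + exp x) + A2 (1 + exp x))
            + B (1 + exp x) - (E * (x * A1 (1 + exp x) + A2 (1 + exp x)) + B (1 + exp x))) -
        (E * ((x + \<tau> + \<tau>) * A1' (1 + exp x) + A2' (1 + exp x))
            + B' (1 + exp x) - (E * ((x + \<tau>) * A1' (1 + exp x) + A2' (1 + exp x)) + B' (1 + exp x)))"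
      by (simp add: algebra_simps)
    also have "\<dots> = 0"
      unfolding e2 eq[OF that, folded E_def] by simp
    finally have "E * (\<tau> * (A1 (1 + exp x) - A1' (1 + exp x))) = 0" .
    moreover have "E \<noteq> 0" by (simp add: E_def)
    ultimately show ?thesis using \<tau>(2) by simp
  qed
  have eq2: "A2 (1 + exp x) + exp (- ?g * x) * B (1 + exp x) =
             \<tau> * A1 (1 + exp x) + A2' (1 + exp x) + exp (- ?g * x) * B' (1 + exp x)" if "Re x < \<rho>" for x
  proof -
    have 1: "exp (- ?g * x) * exp (?g * x) = 1"
      unfolding mult_minus_left exp_minus by simp
    have cancel: "a2 + E' * b = t * a + a2' + E' * b'"
      if "E' * E = 1" "E * (y * a + a2) + b = E * ((y + t) * a + a2')
          + b'" for E E' a a2 a2' b b' t y :: complex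
      using that by algebra
    show ?thesis
      using eq[OF that] unfolding A1eq[OF that, symmetric] by (rule cancel[OF 1])
  qed
  let ?x = "\<lambda>n. complex_of_real (- real n)"
  have ev: "\<forall>\<^sub>F n in sequentially. Re (?x n) < \<rho>"
  proof -
    have "\<forall>\<^sub>F n in sequentially. real n > - \<rho>"
      using filterlim_real_sequentially filterlim_at_top_dense by blast
    then show ?thesis by eventually_elim simp
  qed
  have "A1 1 = A1' 1"
  proof (rule LIMSEQ_unique[OF tendsto_analytic_at_one[OF A(1)]])
    show "(\<lambda>n. A1 (1 + exp (?x n))) \<longlonglongrightarrow> A1' 1"
      by (rule Lim_transform_eventually[OF tendsto_analytic_at_one[OF A'(1)]])
         (use ev in eventually_elim, use A1eq in auto)
  qed
  then have A12: "A2 1 = A2' 1" using A(5,6) A'(5,6) c1 by simp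
  obtain n where n: "?g = - of_nat (Suc n)"
  proof -
    obtain i :: int where i: "\<alpha> = of_int i" using \<alpha> by (auto elim: Ints_cases)
    then have "i < 0" using nat[of "nat i"] by (cases "i \<ge> 0") auto
    then have "?g = - of_nat (Suc (nat (- i - 1) + k))" using i by simp
    then show ?thesis using that by blast
  qed
  have e0: "(\<lambda>n. exp (- ?g * ?x n)) \<longlonglongrightarrow> 0"
  proof -
    have "(\<lambda>w. (w - 1) ^ Suc n) analytic_on {1 :: complex}" by (intro analytic_intros)
    from tendsto_analytic_at_one[OF this]
    have "(\<lambda>n'. (1 + exp (?x n') - 1) ^ Suc n) \<longlonglongrightarrow> 0" by simp
    moreover have "exp (- ?g * y) = (1 + exp y - 1) ^ Suc n" for y
      unfolding n by (simp only: add_diff_cancel_left' minus_minus exp_of_nat_mult)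
    ultimately show ?thesis by (simp only:)
  qed
  have "(\<lambda>n. A2 (1 + exp (?x n)) + exp (- ?g * ?x n) * B (1 + exp (?x n))) \<longlonglongrightarrow> A2 1 + 0 * B 1"
    by (intro tendsto_intros tendsto_analytic_at_one A e0)
  moreover have "(\<lambda>n. A2 (1 + exp (?x n)) + exp (- ?g * ?x n) * B (1 + exp (?x n))) \<longlonglongrightarrow> \<tau> * A1 1 + A2' 1
      + 0 * B' 1"
  proof (rule Lim_transform_eventually)
    show "(\<lambda>n. \<tau> * A1 (1 + exp (?x n)) + A2' (1 + exp (?x n)) + exp (- ?g * ?x n) * B' (1 + exp (?x n)))
            \<longlonglongrightarrow> \<tau> * A1 1 + A2' 1 + 0 * B' 1"
      by (intro tendsto_intros tendsto_analytic_at_one A A' e0)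
    show "\<forall>\<^sub>F n in sequentially. \<tau> * A1 (1 + exp (?x n)) + A2' (1 + exp (?x n))
        + exp (- ?g * ?x n) * B' (1 + exp (?x n))
        = A2 (1 + exp (?x n)) + exp (- ?g * ?x n) * B (1 + exp (?x n))"
      using ev by eventually_elim (use eq2 in metis)
  qed
  ultimately have "A2 1 + 0 * B 1 = \<tau> * A1 1 + A2' 1 + 0 * B' 1" by (rule LIMSEQ_unique)
  then have "\<tau> * A1 1 = 0" using A12 by simp
  then show False using \<tau>(2) A(4,5) c1 by simp
qed

lemma exp_half_odd: "exp (2 * of_real pi * \<i> * (of_nat n + 1 / 2)) = -1"
proof -
  have "2 * of_real pi * \<i> * (of_nat n + 1 / 2) = of_real pi * \<i> + (2 * of_nat n) * of_real pi * \<i>"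
    by (simp add: algebra_simps)
  then have "exp (2 * of_real pi * \<i> * (of_nat n + 1 / 2))
      = exp (of_real pi * \<i>) * exp ((2 * of_nat n) * of_real pi * \<i>)"
    by (simp only: exp_add)
  also have "exp ((2 * of_nat n) * of_real pi * \<i>) = 1"
    using exp_plus_2pin[of 0 "int n"] by (simp add: mult_ac)
  finally show ?thesis by (simp add: mult.commute)
qed

lemma monodromy_power:
  fixes \<alpha> :: complex
  assumes A: "A analytic_on {1}" and B: "B analytic_on {1}"
    and f: "\<And>x. Re x < \<rho> \<Longrightarrow> f x = exp (\<alpha> * x) * A (1 + exp x) + B (1 + exp x)"
  shows "\<exists>B' \<rho>. B' analytic_on {1} \<and> (\<forall>x. Re x < \<rho> \<longrightarrow>
           f (x + 2 * of_real pi * \<i>) = exp (2 * of_real pi * \<i> * \<alpha>) * f x + B' (1 + exp x))"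
    and "\<exists>C \<rho>. \<forall>x. Re x < \<rho> \<and> \<bar>Im x\<bar> \<le> M \<longrightarrow> norm (f x) \<le> C * exp (- \<bar>Re \<alpha>\<bar> * Re x)"
proof -
  let ?c = "exp (2 * of_real pi * \<i> * \<alpha>)"
  have "f (x + 2 * of_real pi * \<i>) = ?c * f x + (1 - ?c) * B (1 + exp x)" if "Re x < \<rho>" for x
  proof -
    have "exp (x + 2 * of_real pi * \<i>) = exp x" using exp_plus_2pin[of x 1] by (simp add: mult_ac)
    moreover have "exp (\<alpha> * (x + 2 * of_real pi * \<i>)) = ?c * exp (\<alpha> * x)"
      by (simp add: algebra_simps flip: exp_add)
    ultimately show ?thesis using f[of x] f[of "x + 2 * of_real pi * \<i>"] that by (simp add: algebra_simps)
  qed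
  moreover have "(\<lambda>w. (1 - ?c) * B w) analytic_on {1}" using B by (intro analytic_intros)
  ultimately show "\<exists>B' \<rho>. B' analytic_on {1} \<and> (\<forall>x. Re x < \<rho> \<longrightarrow>
           f (x + 2 * of_real pi * \<i>) = ?c * f x + B' (1 + exp x))"
    by (intro exI[of _ "\<lambda>w. (1 - ?c) * B w"] exI[of _ \<rho>]) auto
  obtain CA \<rho>A where CA: "CA \<ge> 0" "\<And>x. Re x < \<rho>A \<Longrightarrow> norm (A (1 + exp x)) \<le> CA"
    using analytic_at_one_bounded[OF A] by blast
  obtain CB \<rho>B where CB: "CB \<ge> 0" "\<And>x. Re x < \<rho>B \<Longrightarrow> norm (B (1 + exp x)) \<le> CB"
    using analytic_at_one_bounded[OF B] by blast
  have "norm (f x) \<le> (exp (\<bar>Im \<alpha>\<bar> * M) * CA + CB) * exp (- \<bar>Re \<alpha>\<bar> * Re x)"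
    if x: "Re x < min (min \<rho> 0) (min \<rho>A \<rho>B)" "\<bar>Im x\<bar> \<le> M" for x
  proof -
    have "Re \<alpha> * Re x \<le> - \<bar>Re \<alpha>\<bar> * Re x"
      using x by (intro mult_right_mono_neg) auto
    moreover have "- (Im \<alpha> * Im x) \<le> \<bar>Im \<alpha>\<bar> * M"
    proof -
      have "- (Im \<alpha> * Im x) \<le> \<bar>Im \<alpha>\<bar> * \<bar>Im x\<bar>" by (metis abs_ge_minus_self abs_mult)
      also have "\<dots> \<le> \<bar>Im \<alpha>\<bar> * M" using x by (intro mult_left_mono) auto
      finally show ?thesis .
    qed
    ultimately have "Re (\<alpha> * x) \<le> \<bar>Im \<alpha>\<bar> * M + - \<bar>Re \<alpha>\<bar> * Re x" by simp
    then have "exp (Re (\<alpha> * x)) \<le> exp (\<bar>Im \<alpha>\<bar> * M + - \<bar>Re \<alpha>\<bar> * Re x)" by (simp only: exp_le_cancel_iff)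
    then have e: "norm (exp (\<alpha> * x)) \<le> exp (\<bar>Im \<alpha>\<bar> * M) * exp (- \<bar>Re \<alpha>\<bar> * Re x)"
      unfolding norm_exp_eq_Re by (simp only: exp_add)
    have one: "1 \<le> exp (- \<bar>Re \<alpha>\<bar> * Re x)" using x by (simp add: mult_nonneg_nonpos)
    have "norm (f x) \<le> norm (exp (\<alpha> * x)) * norm (A (1 + exp x)) + norm (B (1 + exp x))"
      using f[of x] x norm_triangle_ineq[of "exp (\<alpha> * x) * A (1 + exp x)" "B (1 + exp x)"]
      by (simp add: norm_mult)
    also have "\<dots> \<le> (exp (\<bar>Im \<alpha>\<bar> * M) * exp (- \<bar>Re \<alpha>\<bar> * Re x)) * CA + CB * exp (- \<bar>Re \<alpha>\<bar> * Re x)"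
    proof (intro add_mono mult_mono e)
      have "norm (B (1 + exp x)) \<le> CB * 1" using CB(2) x by simp
      also have "\<dots> \<le> CB * exp (- \<bar>Re \<alpha>\<bar> * Re x)" using CB(1) one by (intro mult_left_mono)
      finally show "norm (B (1 + exp x)) \<le> CB * exp (- \<bar>Re \<alpha>\<bar> * Re x)" .
    qed (use CA x in auto)
    also have "\<dots> = (exp (\<bar>Im \<alpha>\<bar> * M) * CA + CB) * exp (- \<bar>Re \<alpha>\<bar> * Re x)"
    proof -
      have "(a * e) * c + d * e = (a * c + d) * e" for a c d e :: real by (simp add: algebra_simps)
      then show ?thesis .
    qed
    finally show ?thesis .
  qed
  then show "\<exists>C \<rho>. \<forall>x. Re x < \<rho> \<and> \<bar>Im x\<bar> \<le> M \<longrightarrow> norm (f x) \<le> C * exp (- \<bar>Re \<alpha>\<bar> * Re x)"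
    by blast
qed

lemma monodromy_log:
  assumes A: "A analytic_on {1}" and B: "B analytic_on {1}"
    and f: "\<And>x. Re x < \<rho> \<Longrightarrow> f x = (deriv_w ^^ k) (\<lambda>x. exp (of_nat n * x) * x * A (1 + exp x)) x
        + B (1 + exp x)"
  shows "\<exists>B' \<rho>. B' analytic_on {1} \<and> (\<forall>x. Re x < \<rho> \<longrightarrow>
           f (x + 2 * of_real pi * \<i>) = 1 * f x + B' (1 + exp x))"
    and "\<exists>C \<rho>. \<forall>x. Re x < \<rho> \<and> \<bar>Im x\<bar> \<le> M \<longrightarrow> norm (f x) \<le> C * exp (- real (Suc k) * Re x)"
proof -
  define a where "a w = (w - 1) ^ n * A w" for w
  have a: "a analytic_on {1}" unfolding a_def using A by (intro analytic_intros)
  have fun_eq: "(\<lambda>x. exp (of_nat n * x) * x * A (1 + exp x)) = (\<lambda>x. x * a (1 + exp x))"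
    by (auto simp: a_def exp_of_nat_mult)
  obtain b E \<rho>1 where b: "b analytic_on {1}" and E: "E analytic_on {1}"
    and eq: "\<And>x. Re x < \<rho>1 \<Longrightarrow> (deriv_w ^^ k) (\<lambda>x. x * a (1 + exp x)) x =
                x * b (1 + exp x) + exp (- of_nat k * x) * E (1 + exp x)"
    using deriv_w_iterate_log[OF a] by blast
  have f': "f x = x * b (1 + exp x) + exp (- of_nat k * x) * E (1 + exp x) + B (1 + exp x)"
    if "Re x < min \<rho> \<rho>1" for x
    using f[of x] eq[of x] that unfolding fun_eq by simp
  have "f (x + 2 * of_real pi * \<i>) = 1 * f x + 2 * of_real pi * \<i> * b (1
      + exp x)" if x: "Re x < min \<rho> \<rho>1" for x
  proof -
    have 1: "exp (x + 2 * of_real pi * \<i>) = exp x" using exp_plus_2pin[of x 1] by (simp add: mult_ac)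
    have "- of_nat k \<in> (\<int> :: complex set)" by simp
    note 2 = exp_Ints_period[OF this, of x]
    have "Re (x + 2 * of_real pi * \<i>) < min \<rho> \<rho>1" using x by simp
    from f'[OF this] show ?thesis
      unfolding 1 2 f'[OF x] by (simp add: distrib_right)
  qed
  moreover have "(\<lambda>w. 2 * of_real pi * \<i> * b w) analytic_on {1}" using b by (intro analytic_intros)
  ultimately show "\<exists>B' \<rho>. B' analytic_on {1} \<and> (\<forall>x. Re x < \<rho> \<longrightarrow>
           f (x + 2 * of_real pi * \<i>) = 1 * f x + B' (1 + exp x))"
    by (intro exI[of _ "\<lambda>w. 2 * of_real pi * \<i> * b w"] exI[of _ "min \<rho> \<rho>1"]) auto
  obtain Cb \<rho>b where Cb: "Cb \<ge> 0" "\<And>x. Re x < \<rho>b \<Longrightarrow> norm (b (1 + exp x)) \<le> Cb"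
    using analytic_at_one_bounded[OF b] by blast
  obtain CE \<rho>E where CE: "CE \<ge> 0" "\<And>x. Re x < \<rho>E \<Longrightarrow> norm (E (1 + exp x)) \<le> CE"
    using analytic_at_one_bounded[OF E] by blast
  obtain CB \<rho>B where CB: "CB \<ge> 0" "\<And>x. Re x < \<rho>B \<Longrightarrow> norm (B (1 + exp x)) \<le> CB"
    using analytic_at_one_bounded[OF B] by blast
  have "norm (f x) \<le> ((1 + \<bar>M\<bar>) * Cb + CE + CB) * exp (- real (Suc k) * Re x)"
    if x: "Re x < min (min (min \<rho> \<rho>1) 0) (min \<rho>b (min \<rho>E \<rho>B))" "\<bar>Im x\<bar> \<le> M" for x
  proof -
    let ?e = "exp (- real (Suc k) * Re x)"
    have neg: "Re x < 0" using x by simp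
    have e1: "exp (- Re x) \<le> ?e" "exp (- real k * Re x) \<le> ?e" "1 \<le> ?e"
    proof -
      have "real k * Re x \<le> 0" using neg by (simp add: mult_nonneg_nonpos)
      moreover have "- real (Suc k) * Re x = - (real k * Re x) - Re x" by (simp add: algebra_simps)
      ultimately show "exp (- Re x) \<le> ?e" "exp (- real k * Re x) \<le> ?e" "1 \<le> ?e"
        using neg by (simp_all del: of_nat_Suc)
    qed
    have "norm x \<le> \<bar>Re x\<bar> + \<bar>Im x\<bar>" by (rule cmod_le)
    also have "\<bar>Re x\<bar> \<le> exp (- Re x)" using neg exp_ge_add_one_self[of "- Re x"] by linarith
    also have "exp (- Re x) + \<bar>Im x\<bar> \<le> ?e + \<bar>M\<bar> * ?e"
    proof (intro add_mono e1)
      have "\<bar>Im x\<bar> \<le> \<bar>M\<bar> * 1" using x by simp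
      also have "\<dots> \<le> \<bar>M\<bar> * ?e" using e1(3) by (intro mult_left_mono) auto
      finally show "\<bar>Im x\<bar> \<le> \<bar>M\<bar> * ?e" .
    qed
    finally have nx: "norm x \<le> (1 + \<bar>M\<bar>) * ?e" by (simp add: algebra_simps)
    have "norm (f x) \<le> norm x * norm (b (1 + exp x)) + exp (- real k * Re x) * norm (E (1 + exp x))
        + norm (B (1 + exp x))"
    proof -
      have lt: "Re x < min \<rho> \<rho>1" using x by simp
      have "norm (f x) \<le> norm (x * b (1 + exp x)) + norm (exp (- of_nat k * x) * E (1 + exp x))
          + norm (B (1 + exp x))"
        unfolding f'[OF lt] by (rule order_trans[OF norm_triangle_ineq add_right_mono[OF norm_triangle_ineq]])
      then show ?thesis by (simp add: norm_mult)
    qed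
    also have "\<dots> \<le> ((1 + \<bar>M\<bar>) * ?e) * Cb + ?e * CE + ?e * CB"
    proof (intro add_mono mult_mono nx e1)
      have "norm (B (1 + exp x)) \<le> 1 * CB" using CB(2) x by simp
      also have "\<dots> \<le> ?e * CB" using CB(1) e1(3) by (intro mult_right_mono)
      finally show "norm (B (1 + exp x)) \<le> ?e * CB" .
    qed (use Cb CE x in auto)
    also have "\<dots> = ((1 + \<bar>M\<bar>) * Cb + CE + CB) * ?e"
    proof -
      have "(m * e) * b + e * c + e * d = (m * b + c + d) * e" for m b c d e :: real
          by (simp add: algebra_simps)
      then show ?thesis .
    qed
    finally show ?thesis .
  qed
  then show "\<exists>C \<rho>. \<forall>x. Re x < \<rho> \<and> \<bar>Im x\<bar> \<le> M \<longrightarrow> norm (f x) \<le> C * exp (- real (Suc k) * Re x)"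
    by blast
qed

lemma elementary_singularity_monodromy:
  assumes "elementary_singularity S F \<omega>"
  shows "\<exists>\<beta> c N. Re \<beta> > 0 \<and> c * exp (2 * of_real pi * \<i> * \<beta>) = -1 \<and> N \<le> Re \<beta> \<and>
    (\<forall>\<delta> \<zeta>0. log_coordinate S \<omega> \<delta> \<zeta>0 \<longrightarrow>
       (\<exists>B \<rho>. B analytic_on {1} \<and> (\<forall>x. Re x < \<rho> \<longrightarrow>
          F (log_point S \<delta> \<zeta>0 (x + 2 * of_real pi * \<i>)) = c * F (log_point S \<delta> \<zeta>0 x) + B (1 + exp x))) \<and>
       (\<forall>M. \<exists>C \<rho>. \<forall>x. Re x < \<rho> \<and> \<bar>Im x\<bar> \<le> M \<longrightarrow>
          norm (F (log_point S \<delta> \<zeta>0 x)) \<le> C * exp (- N * Re x)))"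
  using assms unfolding elementary_singularity_def
proof (elim disjE exE conjE)
  fix \<alpha>
  assume form: "\<forall>\<delta> \<zeta>0. log_coordinate S \<omega> \<delta> \<zeta>0 \<longrightarrow>
           (\<exists>A B \<rho>. A analytic_on {1} \<and> B analytic_on {1} \<and> A 1 \<noteq> 0 \<and>
              (\<forall>\<zeta>. Re \<zeta> < \<rho> \<longrightarrow>
                 F (log_point S \<delta> \<zeta>0 \<zeta>) = exp (\<alpha> * \<zeta>) * A (1 + exp \<zeta>) + B (1 + exp \<zeta>)))"
  \<comment> \<open>The exponent of the singularity of \<open>L\<^sub>\<beta> F\<close> is \<open>\<alpha> + \<beta> + 1 = n + 3 / 2\<close>.\<close>
  define n where "n = nat \<lceil>2 * \<bar>Re \<alpha>\<bar>\<rceil>"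
  define \<beta> where "\<beta> = of_nat n + 1 / 2 - \<alpha>"
  have "2 * \<bar>Re \<alpha>\<bar> \<le> real n" unfolding n_def by linarith
  then have \<beta>: "Re \<beta> > 0" "\<bar>Re \<alpha>\<bar> \<le> Re \<beta>" by (auto simp: \<beta>_def)
  have "exp (2 * of_real pi * \<i> * \<alpha>) * exp (2 * of_real pi * \<i> * \<beta>)
      = exp (2 * of_real pi * \<i> * (of_nat n + 1 / 2))"
    unfolding exp_add[symmetric] \<beta>_def by (simp add: algebra_simps)
  then have c: "exp (2 * of_real pi * \<i> * \<alpha>) * exp (2 * of_real pi * \<i> * \<beta>) = -1"
    unfolding exp_half_odd .
  show ?thesis
  proof (rule exI[of _ \<beta>], rule exI[of _ "exp (2 * of_real pi * \<i> * \<alpha>)"], rule exI[of _ "\<bar>Re \<alpha>\<bar>"], intro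
      conjI allI impI)
    fix \<delta> \<zeta>0 assume "log_coordinate S \<omega> \<delta> \<zeta>0"
    then obtain A B \<rho> where AB: "A analytic_on {1}" "B analytic_on {1}"
      "\<And>x. Re x < \<rho> \<Longrightarrow> F (log_point S \<delta> \<zeta>0 x) = exp (\<alpha> * x) * A (1 + exp x) + B (1 + exp x)"
      using form by blast
    show "\<exists>B \<rho>. B analytic_on {1} \<and> (\<forall>x. Re x < \<rho> \<longrightarrow>
          F (log_point S \<delta> \<zeta>0 (x + 2 * of_real pi * \<i>)) =
          exp (2 * of_real pi * \<i> * \<alpha>) * F (log_point S \<delta> \<zeta>0 x) + B (1 + exp x))"
      by (rule monodromy_power(1)[where f = "\<lambda>x. F (log_point S \<delta> \<zeta>0 x)", OF AB])
    show "\<exists>C \<rho>. \<forall>x. Re x < \<rho> \<and> \<bar>Im x\<bar> \<le> M \<longrightarrow> norm (F (log_point S \<delta> \<zeta>0 x)) \<le> C * exp (- \<bar>Re \<alpha>\<bar> * Re x)" for M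
      by (rule monodromy_power(2)[where f = "\<lambda>x. F (log_point S \<delta> \<zeta>0 x)", OF AB])
  qed (use \<beta> c in auto)
next
  fix \<alpha> k
  assume \<alpha>: "\<alpha> \<in> \<int>" and form: "\<forall>\<delta> \<zeta>0. log_coordinate S \<omega> \<delta> \<zeta>0 \<longrightarrow>
           (\<exists>A B \<rho>. A analytic_on {1} \<and> B analytic_on {1} \<and> A 1 \<noteq> 0 \<and>
              (\<forall>\<zeta>. Re \<zeta> < \<rho> \<longrightarrow>
                 F (log_point S \<delta> \<zeta>0 \<zeta>) =
                   (deriv_w ^^ k) (\<lambda>x. exp (\<alpha> * x) * x * A (1 + exp x)) \<zeta> + B (1 + exp \<zeta>)))"
  \<comment> \<open>The pole has order at most \<open>k\<close>; one more power accounts for the logarithm.\<close>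
  define \<beta> :: complex where "\<beta> = of_nat (Suc k) + 1 / 2"
  have \<beta>: "Re \<beta> > 0" "real (Suc k) \<le> Re \<beta>" by (auto simp: \<beta>_def)
  have c: "1 * exp (2 * of_real pi * \<i> * \<beta>) = -1"
    unfolding \<beta>_def exp_half_odd by simp
  show ?thesis
  proof (rule exI[of _ \<beta>], rule exI[of _ 1], rule exI[of _ "real (Suc k)"], intro conjI allI impI)
    fix \<delta> \<zeta>0 assume L: "log_coordinate S \<omega> \<delta> \<zeta>0"
    obtain n where n: "\<alpha> = of_nat n"
      using log_singularity_exponent_nonneg[OF \<alpha> L form[rule_format]] by blast
    obtain A B \<rho> where AB: "A analytic_on {1}" "B analytic_on {1}"
      "\<And>x. Re x < \<rho> \<Longrightarrow> F (log_point S \<delta> \<zeta>0 x) =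
         (deriv_w ^^ k) (\<lambda>x. exp (of_nat n * x) * x * A (1 + exp x)) x + B (1 + exp x)"
      using form L unfolding n by blast
    show "\<exists>B \<rho>. B analytic_on {1} \<and> (\<forall>x. Re x < \<rho> \<longrightarrow>
          F (log_point S \<delta> \<zeta>0 (x + 2 * of_real pi * \<i>)) = 1 * F (log_point S \<delta> \<zeta>0 x) + B (1 + exp x))"
      by (rule monodromy_log(1)[where f = "\<lambda>x. F (log_point S \<delta> \<zeta>0 x)", OF AB])
    show "\<exists>C \<rho>. \<forall>x. Re x < \<rho> \<and> \<bar>Im x\<bar> \<le> M \<longrightarrow> norm (F (log_point S \<delta> \<zeta>0 x))
        \<le> C * exp (- real (Suc k) * Re x)" for M
      by (rule monodromy_log(2)[where f = "\<lambda>x. F (log_point S \<delta> \<zeta>0 x)", OF AB])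
  qed (use \<beta> c in auto)
qed

section \<open>Homotopies of curves on the sphere\<close>

text \<open>
  The finite points of the sphere other than the origin and the punctures.
\<close>
definition regular_points :: "complex option set \<Rightarrow> complex set" where
  "regular_points S = {z. z \<noteq> 0 \<and> Some z \<notin> S}"

text \<open>
  Curves in the finite plane whose classes are points of \<open>\<Omega>\<close>: unlike the members of
  \<^term>\<open>curves S\<close> they also end at a regular point. Only the values on \<open>[0, 1]\<close> matter.
\<close>
definition regular_path :: "complex option set \<Rightarrow> (real \<Rightarrow> complex) \<Rightarrow> bool" where
  "regular_path S g \<longleftrightarrow> continuous_on {0..1} g \<and> g 0 = 0 \<and> (\<forall>t\<in>{0<..1}. g t \<in> regular_points S)"

lemma closed_finite_punctures:
  assumes "discrete_punctures S"
  shows "closed (Some -` S)"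
proof -
  have "closedin euclidean {z \<in> topspace euclidean. Some z \<in> S}"
    using assms continuous_map_Some closedin_continuous_map_preimage
    unfolding discrete_punctures_def riemann_sphere_def by blast
  then show ?thesis by (simp add: vimage_def)
qed

lemma open_regular_points:
  assumes "discrete_punctures S"
  shows "open (regular_points S)"
proof -
  have "regular_points S = - (Some -` S) - {0}"
    by (auto simp: regular_points_def)
  then show ?thesis using
      open_Diff[OF open_Compl[OF closed_finite_punctures[OF assms]] closed_singleton[of 0]] by simp
qed

lemma pathin_Some_comp: "continuous_on {0..1} g \<Longrightarrow> pathin riemann_sphere (Some \<circ> g)"
  unfolding pathin_def riemann_sphere_def
  by (rule continuous_map_compose[OF _ continuous_map_Some]) simp

lemma regular_path_in_curves:
  assumes "regular_path S g"
  shows "Some \<circ> g \<in> curves S"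
  using assms by (auto simp: curves_def regular_path_def regular_points_def pathin_Some_comp)

lemma curve_class_eqI:
  assumes "(\<gamma>, \<eta>) \<in> homotopic_curves S"
  shows "curve_class S \<gamma> = curve_class S \<eta>"
proof -
  have h: "homotopic_with (\<lambda>\<kappa>. \<kappa> \<in> curves S \<and> \<kappa> 1 = \<gamma> 1) (top_of_set {0..1}) riemann_sphere \<gamma> \<eta>"
    and c: "\<gamma> \<in> curves S" "\<eta> \<in> curves S"
    using assms by (auto simp: homotopic_curves_def)
  have e: "\<eta> 1 = \<gamma> 1" using homotopic_with_imp_property[OF h] by simp
  show ?thesis
    using c h e homotopic_with_trans homotopic_with_symD
    unfolding curve_class_def homotopic_curves_def by (auto; blast)
qed

text \<open>
  A homotopy of regular paths with fixed end points, given by a function of two real variables on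
  the unit square.
\<close>
lemma curve_class_eq_homotopy:
  fixes h :: "real \<Rightarrow> real \<Rightarrow> complex"
  assumes cont: "continuous_on ({0..1} \<times> {0..1}) (\<lambda>(u, s). h u s)"
    and h0: "\<And>u. u \<in> {0..1} \<Longrightarrow> h u 0 = 0"
    and h1: "\<And>u. u \<in> {0..1} \<Longrightarrow> h u 1 = h 0 1"
    and reg: "\<And>u s. u \<in> {0..1} \<Longrightarrow> s \<in> {0<..1} \<Longrightarrow> h u s \<in> regular_points S"
    and p: "\<And>s. s \<in> {0..1} \<Longrightarrow> h 0 s = p s" and q: "\<And>s. s \<in> {0..1} \<Longrightarrow> h 1 s = q s"
  shows "curve_class S (Some \<circ> p) = curve_class S (Some \<circ> q)"
proof (rule curve_class_eqI)
  have rp: "regular_path S (h u)" if "u \<in> {0..1}" for u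
  proof -
    have "continuous_on {0..1} ((\<lambda>(u, s). h u s) \<circ> (\<lambda>s. (u, s)))"
      by (intro continuous_on_compose continuous_intros continuous_on_subset[OF cont]) (use that in auto)
    then show ?thesis using that h0 reg by (simp add: regular_path_def o_def)
  qed
  have cong: "regular_path S b" if "regular_path S a" "\<And>s. s \<in> {0..1} \<Longrightarrow> a s = b s" for a b
    using that continuous_on_cong[of "{0..1}" "{0..1}" a b] by (force simp: regular_path_def)
  have "regular_path S p" "regular_path S q"
    using cong[OF rp[of 0] p] cong[OF rp[of 1] q] by auto
  then have c: "Some \<circ> p \<in> curves S" "Some \<circ> q \<in> curves S"
    by (auto intro: regular_path_in_curves)
  have "homotopic_with (\<lambda>\<kappa>. \<kappa> \<in> curves S \<and> \<kappa> 1
      = (Some \<circ> p) 1) (top_of_set {0..1}) riemann_sphere (Some \<circ> p) (Some \<circ> q)"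
  proof (subst homotopic_with)
    show "(\<phi> \<in> curves S \<and> \<phi> 1 = (Some \<circ> p) 1) \<longleftrightarrow> (\<psi> \<in> curves S \<and> \<psi> 1 = (Some \<circ> p) 1)"
      if eq: "\<And>x. x \<in> topspace (top_of_set {0..1}) \<Longrightarrow> \<phi> x = \<psi> x" for \<phi> \<psi> :: "real \<Rightarrow> complex option"
    proof -
      have eq': "\<phi> x = \<psi> x" if "0 \<le> x" "x \<le> 1" for x using eq that by simp
      have "pathin riemann_sphere \<phi> \<longleftrightarrow> pathin riemann_sphere \<psi>"
        unfolding pathin_def using eq continuous_map_eq by metis
      then show ?thesis using eq' by (auto simp: curves_def)
    qed
    show "\<exists>k. continuous_map (prod_topology (top_of_set {0..1::real}) (top_of_set {0..1::real}))
        riemann_sphere k \<and>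
        (\<forall>x\<in>topspace (top_of_set {0..1}). k (0, x) = (Some \<circ> p) x) \<and>
        (\<forall>x\<in>topspace (top_of_set {0..1}). k (1, x) = (Some \<circ> q) x) \<and>
        (\<forall>t\<in>{0..1::real}. (\<lambda>x. k (t, x)) \<in> curves S \<and> k (t, 1) = (Some \<circ> p) 1)"
    proof (intro exI[of _ "Some \<circ> (\<lambda>(u, s). h u s)"] conjI ballI)
      have "continuous_map (top_of_set ({0..1} \<times> {0..1})) riemann_sphere (Some \<circ> (\<lambda>(u, s). h u s))"
        unfolding riemann_sphere_def
        by (rule continuous_map_compose[OF _ continuous_map_Some]) (use cont in simp)
      then show "continuous_map (prod_topology (top_of_set {0..1}) (top_of_set {0..1})) riemann_sphere
          (Some \<circ> (\<lambda>(u, s). h u s))"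
        by (simp add: subtopology_Times[symmetric] euclidean_product_topology)
    next
      fix t :: real assume t: "t \<in> {0..1}"
      show "(\<lambda>x. (Some \<circ> (\<lambda>(u, s). h u s)) (t, x)) \<in> curves S"
        using regular_path_in_curves[OF rp[OF t]] by (simp add: o_def)
      show "(Some \<circ> (\<lambda>(u, s). h u s)) (t, 1) = (Some \<circ> p) 1"
        using h1[OF t] p by simp
    qed (use p q in auto)
  qed
  then show "(Some \<circ> p, Some \<circ> q) \<in> homotopic_curves S"
    using c by (simp add: homotopic_curves_def)
qed

lemma curve_class_eq_linear:
  assumes p: "regular_path S p" and q: "regular_path S q" and e: "p 1 = q 1"
    and seg: "\<And>s. s \<in> {0<..1} \<Longrightarrow> closed_segment (p s) (q s) \<subseteq> regular_points S"
  shows "curve_class S (Some \<circ> p) = curve_class S (Some \<circ> q)"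
proof (rule curve_class_eq_homotopy[where h = "\<lambda>u s. linepath (p s) (q s) u"])
  have comp: "continuous_on ({0..1} \<times> {0..1}) (\<lambda>x::real \<times> real. r (snd x))" if "regular_path S r" for r
  proof (rule continuous_on_compose2[where g = r and f = snd])
    show "continuous_on {0..1} r" using that by (simp add: regular_path_def)
  qed (auto intro!: continuous_intros)
  show "continuous_on ({0..1} \<times> {0..1}) (\<lambda>(u, s). linepath (p s) (q s) u)"
    unfolding linepath_def case_prod_unfold
    by (intro continuous_on_add continuous_on_scaleR continuous_on_diff continuous_on_const continuous_on_fst
          continuous_on_id comp p q)
  show "linepath (p s) (q s) u \<in> regular_points S" if "u \<in> {0..1}" "s \<in> {0<..1}" for u s
    using seg[OF that(2)] linepath_in_path[OF that(1)] by blast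
qed (use p q e in \<open>auto simp: regular_path_def linepath_def algebra_simps simp flip: scaleR_add_left\<close>)

lemma regular_path_reparam:
  assumes g: "regular_path S g" and r: "continuous_on {0..1} r" "r 0 = 0" "\<And>s. s \<in> {0<..1} \<Longrightarrow> r s \<in> {0<..1}"
  shows "regular_path S (g \<circ> r)"
proof -
  have "r s \<in> {0..1}" if "s \<in> {0..1}" for s using r(2) r(3)[of s] that by (cases "s = 0") auto
  then have "continuous_on {0..1} (\<lambda>s. g (r s))"
    using g r(1) by (intro continuous_on_compose2[where g = g and f = r]) (auto simp: regular_path_def)
  then show ?thesis
    using g r by (auto simp: regular_path_def o_def)
qed

lemma curve_class_reparam:
  assumes g: "regular_path S g" and r: "continuous_on {0..1} r" "r 0 = 0" "r 1 = 1"
    "\<And>s. s \<in> {0<..1} \<Longrightarrow> r s \<in> {0<..1}"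
  shows "curve_class S (Some \<circ> (g \<circ> r)) = curve_class S (Some \<circ> g)"
proof (rule curve_class_eq_homotopy[where h = "\<lambda>u s. g ((1 - u) * r s + u * s)"])
  have conv: "(1 - u) * r s + u * s \<in> {0<..1}" if "u \<in> {0..1}" "s \<in> {0<..1}" for u s
  proof -
    have rs: "0 < r s" "r s \<le> 1" using r(4)[OF that(2)] by auto
    have "(1 - u) * r s + u * s \<le> 1"
      using that rs convex_bound_le[of "r s" 1 s "1 - u" u] by auto
    moreover have "(1 - u) * r s + u * s > 0"
      using that rs by (cases "u = 0") (auto intro!: add_nonneg_pos)
    ultimately show ?thesis by simp
  qed
  have conv': "(1 - u) * r s + u * s \<in> {0..1}" if "u \<in> {0..1}" "s \<in> {0..1}" for u s
    using conv[OF that(1), of s] that r(2) by (cases "s = 0") auto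
  have cr: "continuous_on ({0..1} \<times> {0..1}) (\<lambda>x::real \<times> real. r (snd x))"
    by (rule continuous_on_compose2[OF r(1)]) (auto intro!: continuous_intros)
  show "continuous_on ({0..1} \<times> {0..1}) (\<lambda>(u, s). g ((1 - u) * r s + u * s))"
    unfolding case_prod_unfold
  proof (rule continuous_on_compose2[where g = g])
    show "continuous_on {0..1} g" using g by (simp add: regular_path_def)
    show "continuous_on ({0..1} \<times> {0..1}) (\<lambda>x. (1 - fst x) * r (snd x) + fst x * snd x)"
      by (intro continuous_intros cr)
  qed (use conv' in auto)
  show "g ((1 - u) * r s + u * s) \<in> regular_points S" if "u \<in> {0..1}" "s \<in> {0<..1}" for u s
    using conv[OF that] g by (auto simp: regular_path_def)
qed (use g r in \<open>auto simp: regular_path_def\<close>)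

lemma regular_path_subpath:
  assumes "regular_path S g" "t \<in> {0<..1}"
  shows "regular_path S (subpath 0 t g)"
proof -
  have "regular_path S (g \<circ> (\<lambda>s. t * s))"
    using assms(2) by (intro regular_path_reparam[OF assms(1)] continuous_intros) (auto intro: mult_le_one)
  then show ?thesis by (simp add: subpath_def o_def)
qed

lemma regular_path_join:
  assumes p: "regular_path S p" and q: "continuous_on {0..1} q" "\<And>s. s \<in> {0..1} \<Longrightarrow> q s \<in> regular_points S"
    and e: "p 1 = q 0"
  shows "regular_path S (p +++ q)"
proof -
  have "path (p +++ q)"
    using p q e by (intro path_join_imp) (auto simp: path_def regular_path_def pathfinish_def pathstart_def)
  then have "continuous_on {0..1} (p +++ q)" by (simp add: path_def)
  moreover have "(p +++ q) 0 = 0" using p by (simp add: joinpaths_def regular_path_def)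
  moreover have "(p +++ q) t \<in> regular_points S" if "t \<in> {0<..1}" for t
    using that p q(2)[of "2 * t - 1"] by (auto simp: joinpaths_def regular_path_def)
  ultimately show ?thesis by (simp add: regular_path_def)
qed

lemma curve_join_Some: "curve_join (Some \<circ> p) (Some \<circ> q) = Some \<circ> (p +++ q)"
  by (auto simp: curve_join_def joinpaths_def fun_eq_iff)

text \<open>
  Analyticity on \<open>\<Omega>\<close> at the class of a regular path, in the finite chart.
\<close>
lemma analytic_on_segment_continuation:
  assumes F: "analytic_on_Omega S F" and g: "regular_path S g"
  shows "(\<lambda>w. F (curve_class S (Some \<circ> (g +++ linepath (g 1) w)))) analytic_on {g 1}"
proof -
  let ?\<gamma> = "Some \<circ> g"
  let ?P = "curve_class S ?\<gamma>"
  have c: "?\<gamma> \<in> curves S" using g by (rule regular_path_in_curves)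
  have reg: "g 1 \<noteq> 0" "Some (g 1) \<notin> S" using g by (auto simp: regular_path_def regular_points_def)
  have "homotopic_with (\<lambda>\<kappa>. \<kappa> \<in> curves S \<and> \<kappa> 1 = ?\<gamma> 1) (top_of_set {0..1}) riemann_sphere ?\<gamma> ?\<gamma>"
    using c by (auto simp: homotopic_with_refl curves_def pathin_def)
  then have mem: "?\<gamma> \<in> ?P" using c by (simp add: curve_class_def homotopic_curves_def)
  have P1: "?P \<in> Omega S"
    unfolding Omega_def fibre_def using c reg by auto
  have P2: "?P \<noteq> origin"
    using mem reg by (auto simp: origin_def fun_eq_iff)
  have "analytic_at_point S F ?P" using F P1 unfolding analytic_on_Omega_def by blast
  then have *: "\<forall>\<gamma>\<in>?P. \<forall>chart\<in>{Some, sphere_inverse}. \<forall>z. chart z = \<gamma> 1 \<longrightarrow>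
             (\<lambda>w. F (curve_class S (curve_join \<gamma> (chart \<circ> linepath z w)))) analytic_on {z}"
    unfolding analytic_at_point_def if_not_P[OF P2] .
  have "(\<lambda>w. F (curve_class S (curve_join ?\<gamma> (Some \<circ> linepath (g 1) w)))) analytic_on {g 1}"
    by (rule *[rule_format, OF mem]) simp_all
  then show ?thesis by (simp only: curve_join_Some)
qed

section \<open>Branches of a function on \<open>\<Omega>\<close> along curves\<close>

text \<open>
  Along a regular path, the values of \<open>F\<close> are locally a holomorphic function of the point: the curve
  up to a nearby parameter \<open>t\<close> is homotopic to the curve up to \<open>t0\<close> followed by a segment.
\<close>
lemma local_branch_at_positive:
  assumes S: "discrete_punctures S" and F: "analytic_on_Omega S F" and g: "regular_path S g"
    and t0: "t0 \<in> {0<..1}"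
  shows "\<exists>f r e. r > 0 \<and> e > 0 \<and> f holomorphic_on ball (g t0) r \<and>
           (\<forall>t\<in>{0<..1}. \<bar>t - t0\<bar> < e \<longrightarrow> g t \<in> ball (g t0) r \<and>
              F (curve_class S (Some \<circ> subpath 0 t g)) = f (g t))"
proof -
  let ?z = "g t0"
  let ?p = "subpath 0 t0 g"
  define f where "f w = F (curve_class S (Some \<circ> (?p +++ linepath ?z w)))" for w
  have p: "regular_path S ?p" using regular_path_subpath[OF g t0] .
  have p1: "?p 1 = ?z" by (simp add: subpath_def)
  have "f analytic_on {?z}"
    using analytic_on_segment_continuation[OF F p] unfolding f_def p1 .
  then obtain r1 where r1: "r1 > 0" "f holomorphic_on ball ?z r1"
    by (auto simp: analytic_on_def)
  have "?z \<in> regular_points S" using g t0 by (simp add: regular_path_def)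
  then obtain r2 where r2: "r2 > 0" "ball ?z r2 \<subseteq> regular_points S"
    using open_regular_points[OF S] open_contains_ball by blast
  define r where "r = min r1 r2"
  have r: "r > 0" "f holomorphic_on ball ?z r" "ball ?z r \<subseteq> regular_points S"
    using r1 r2 by (auto simp: r_def elim!: holomorphic_on_subset)
  have gc: "continuous_on {0..1} g" using g by (simp add: regular_path_def)
  have "t0 \<in> {0..1}" using t0 by auto
  then obtain e where e0: "e > 0" "\<And>t. t \<in> {0..1} \<Longrightarrow> dist t t0 < e \<Longrightarrow> dist (g t) ?z < r"
    using gc r(1) unfolding continuous_on_iff by blast
  have e: "e > 0" "\<And>t. t \<in> {0..1} \<Longrightarrow> \<bar>t - t0\<bar> < e \<Longrightarrow> g t \<in> ball ?z r"
    using e0 by (auto simp: dist_real_def dist_commute)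
  have ball: "closed_segment a b \<subseteq> ball ?z r" if "a \<in> ball ?z r" "b \<in> ball ?z r" for a b
    using that by (intro closed_segment_subset convex_ball)
  have zz: "?z \<in> ball ?z r" using r(1) by simp
  have "F (curve_class S (Some \<circ> subpath 0 t g)) = f (g t)"
    if t: "t \<in> {0<..1}" "\<bar>t - t0\<bar> < e" for t
  proof -
    let ?q = "subpath 0 t g"
    let ?P = "?p +++ linepath ?z (g t)"
    \<comment> \<open>The curve up to \<open>t\<close>, in a parametrization that agrees with that of \<open>?P\<close> where possible:
      its first half runs to \<open>min t0 t\<close>, its second half from there to \<open>t\<close>.\<close>
    define \<rho> where "\<rho> s = min (min (2 * s) 1 * t0) t + max (2 * s - 1) 0 * (t - min t0 t)" for s :: real
    have \<rho>_simps: "s \<le> 1/2 \<Longrightarrow> \<rho> s = min (2 * s * t0) t"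
        "s > 1/2 \<Longrightarrow> \<rho> s = min t0 t + (2 * s - 1) * (t - min t0 t)" for s
      by (simp_all add: \<rho>_def)
    have gt: "g t \<in> ball ?z r" using e(2) t by auto
    have q: "regular_path S ?q" using regular_path_subpath[OF g t(1)] .
    have P: "regular_path S ?P"
    proof (rule regular_path_join[OF p])
      show "linepath ?z (g t) s \<in> regular_points S" if "s \<in> {0..1}" for s
        using r(3) linepath_in_path[OF that] ball[OF zz gt] by blast
      show "continuous_on {0..1} (linepath ?z (g t))" by (rule continuous_on_linepath)
    qed (simp add: p1 linepath_def)
    have \<rho>: "continuous_on {0..1} \<rho>"
      unfolding \<rho>_def by (intro continuous_intros)
    have \<rho>pos: "\<rho> s \<in> {0<..t}" if "s \<in> {0<..1}" for s
    proof (cases "s \<le> 1/2")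
      case False
      define X where "X = (2 * s - 1) * (t - min t0 t)"
      have "X \<le> 1 * (t - min t0 t)"
        unfolding X_def using that False by (intro mult_right_mono) auto
      then have "X \<le> t - min t0 t" by simp
      moreover have "X \<ge> 0" unfolding X_def using that False by (intro mult_nonneg_nonneg) auto
      moreover have "min t0 t > 0" "\<rho> s = min t0 t + X"
        using t t0 False by (auto simp: \<rho>_simps X_def)
      ultimately have "0 < \<rho> s" "\<rho> s \<le> t" by linarith+
      then show ?thesis by simp
    qed (use that t t0 in \<open>auto simp: \<rho>_simps\<close>)
    have \<rho>t: "continuous_on {0..1} (\<lambda>s. \<rho> s / t)" "\<rho> 0 / t = 0" "\<rho> 1 / t = 1"
        "\<And>s. s \<in> {0<..1} \<Longrightarrow> \<rho> s / t \<in> {0<..1}"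
      using t t0 \<rho>pos by (auto intro!: continuous_intros \<rho> simp: \<rho>_simps divide_le_eq)
    have "curve_class S (Some \<circ> (?q \<circ> (\<lambda>s. \<rho> s / t))) = curve_class S (Some \<circ> ?q)"
      by (rule curve_class_reparam[OF q \<rho>t])
    moreover have eq: "?q \<circ> (\<lambda>s. \<rho> s / t) = (\<lambda>s. g (\<rho> s))"
      using t by (auto simp: subpath_def fun_eq_iff)
    ultimately have "curve_class S (Some \<circ> ?q) = curve_class S (Some \<circ> (\<lambda>s. g (\<rho> s)))" by simp
    also have "\<dots> = curve_class S (Some \<circ> ?P)"
    proof (rule curve_class_eq_linear)
      show "regular_path S (\<lambda>s. g (\<rho> s))"
        using regular_path_reparam[OF q \<rho>t(1,2,4)] by (simp only: eq)
      show "regular_path S ?P" by (rule P)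
      show "g (\<rho> 1) = ?P 1" by (simp add: \<rho>_simps joinpaths_def linepath_def)
      fix s :: real assume s: "s \<in> {0<..1}"
      have "g (\<rho> s) = ?P s \<and> ?P s \<in> regular_points S \<or> g (\<rho> s) \<in> ball ?z r \<and> ?P s \<in> ball ?z r"
      proof (cases "s \<le> 1/2")
        case True
        then have Ps: "?P s = g (2 * s * t0)" by (simp add: joinpaths_def subpath_def mult_ac)
        show ?thesis
        proof (cases "2 * s * t0 \<le> t")
          case le: True
          then have "g (\<rho> s) = ?P s" using True Ps by (simp add: \<rho>_simps)
          moreover have "?P s \<in> regular_points S" using P s by (simp add: regular_path_def)
          ultimately show ?thesis by blast
        next
          case False
          have le: "2 * s * t0 \<le> t0" using True t0 s by (intro mult_left_le_one_le) auto
          have "2 * s * t0 \<ge> 0" "t0 \<le> 1" using t0 s by auto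
          then have "2 * s * t0 \<in> {0..1}" using le by simp
          moreover have "\<bar>2 * s * t0 - t0\<bar> < e" using le False t by linarith
          ultimately have "?P s \<in> ball ?z r" unfolding Ps by (rule e(2))
          moreover have "g (\<rho> s) = g t" using True False by (simp add: \<rho>_simps)
          ultimately show ?thesis using gt by simp
        qed
      next
        case False
        then have Ps: "?P s = linepath ?z (g t) (2 * s - 1)" by (simp add: joinpaths_def)
        have "linepath ?z (g t) (2 * s - 1) \<in> closed_segment ?z (g t)"
          using False s by (intro linepath_in_path) auto
        then have "?P s \<in> ball ?z r" using ball[OF zz gt] unfolding Ps by blast
        moreover have "g (\<rho> s) \<in> ball ?z r"
        proof (rule e(2))
          show "\<rho> s \<in> {0..1}" using \<rho>pos[OF s] t by auto
          have "\<rho> s \<le> t" "\<rho> s \<ge> min t0 t"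
            using \<rho>pos[OF s] False s by (auto simp: \<rho>_simps)
          then show "\<bar>\<rho> s - t0\<bar> < e" using t e(1) by (auto simp: min_def split: if_splits)
        qed
        ultimately show ?thesis by blast
      qed
      then show "closed_segment (g (\<rho> s)) (?P s) \<subseteq> regular_points S"
      proof
        assume "g (\<rho> s) \<in> ball ?z r \<and> ?P s \<in> ball ?z r"
        then show ?thesis using r(3) ball by blast
      qed simp
    qed
    finally show ?thesis by (simp add: f_def)
  qed
  then show ?thesis using r(1,2) e by (intro exI[of _ f] exI[of _ r] exI[of _ e]) auto
qed

text \<open>
  The branch of \<open>F\<close> in a disk around the origin of the first sheet.
\<close>
definition origin_branch :: "complex option set \<Rightarrow> (surface_point \<Rightarrow> complex) \<Rightarrow> complex \<Rightarrow> complex" where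
  "origin_branch S F w = F (if w = 0 then origin else curve_class S (Some \<circ> linepath 0 w))"

lemma origin_branch_analytic:
  assumes "analytic_on_Omega S F"
  shows "origin_branch S F analytic_on {0}"
proof -
  have "analytic_at_point S F origin"
    using assms unfolding analytic_on_Omega_def Omega_def by blast
  then show ?thesis
    unfolding analytic_at_point_def if_P[OF refl] origin_branch_def .
qed

text \<open>
  A regular path may wind infinitely often around the origin near its start. It is nevertheless
  homotopic to a segment there: replace the part up to the fraction \<open>u\<close> by the chord.
\<close>
lemma local_branch_at_origin:
  assumes S: "discrete_punctures S" and F: "analytic_on_Omega S F" and g: "regular_path S g"
  shows "\<exists>f r e. r > 0 \<and> e > 0 \<and> f holomorphic_on ball 0 r \<and>
           (\<forall>t\<in>{0<..1}. t < e \<longrightarrow> g t \<in> ball 0 r \<and>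
              F (curve_class S (Some \<circ> subpath 0 t g)) = f (g t))"
proof -
  obtain r1 where r1: "r1 > 0" "origin_branch S F holomorphic_on ball 0 r1"
    using origin_branch_analytic[OF F] by (auto simp: analytic_on_def)
  have "0 \<in> - (Some -` S)" "open (- (Some -` S))"
    using S closed_finite_punctures[OF S] by (auto simp: discrete_punctures_def)
  then obtain r2 where r2: "r2 > 0" "ball 0 r2 \<subseteq> - (Some -` S)"
    using open_contains_ball by blast
  define r where "r = min r1 r2"
  have r: "r > 0" "origin_branch S F holomorphic_on ball 0 r" "\<And>z. z \<in> ball 0 r \<Longrightarrow> z \<noteq> 0
      \<Longrightarrow> z \<in> regular_points S"
    using r1 r2 by (auto simp: r_def regular_points_def elim!: holomorphic_on_subset)
  have gc: "continuous_on {0..1} g" and g0: "g 0 = 0" and gn: "\<And>t. t \<in> {0<..1} \<Longrightarrow> g t \<noteq> 0"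
    using g by (auto simp: regular_path_def regular_points_def)
  obtain e where e: "e > 0" "\<And>t. t \<in> {0..1} \<Longrightarrow> t < e \<Longrightarrow> g t \<in> ball 0 r"
  proof -
    have "(0::real) \<in> {0..1}" by simp
    then obtain e where "e > 0" "\<And>t. t \<in> {0..1} \<Longrightarrow> dist t 0 < e \<Longrightarrow> dist (g t) (g 0) < r"
      using gc r(1) unfolding continuous_on_iff by blast
    then show ?thesis using g0 by (intro that[of e]) (auto simp: dist_norm)
  qed
  have "F (curve_class S (Some \<circ> subpath 0 t g)) = origin_branch S F (g t)"
    if t: "t \<in> {0<..1}" "t < e" for t
  proof -
    define h where "h u s = (if s \<le> u then of_real (s / u) * g (u * t) else g (s * t))" for u s
    have mem: "v * t \<in> {0..1}" "v * t < e" if "v \<in> {0..1}" for v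
    proof -
      have "v * t \<le> t" "v * t \<ge> 0" "t \<le> 1" using that t by (auto intro: mult_left_le_one_le)
      then show "v * t \<in> {0..1}" "v * t < e" using t(2) unfolding atLeastAtMost_iff by linarith+
    qed
    have shrink: "norm (of_real c * z) \<le> norm z" if "0 \<le> c" "c \<le> 1" for c :: real and z :: complex
      using that by (simp add: norm_mult mult_left_le_one_le)
    have gv: "continuous_on {0..1} (\<lambda>v. g (v * t))"
      by (rule continuous_on_compose2[OF gc, where f = "\<lambda>v. v * t"])
         (use mem in \<open>auto intro!: continuous_intros\<close>)
    have "curve_class S (Some \<circ> subpath 0 t g) = curve_class S (Some \<circ> linepath 0 (g t))"
    proof (rule curve_class_eq_homotopy[where h = h])
      let ?A = "({0..1} \<times> {0..1}) \<inter> {x::real \<times> real. snd x \<le> fst x}"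
      let ?B = "({0..1} \<times> {0..1}) \<inter> {x::real \<times> real. fst x \<le> snd x}"
      have AB: "?A \<union> ?B = {0..1} \<times> {0..1}" by auto
      have cl: "closed ?A" "closed ?B"
        by (intro closed_Int closed_Times closed_atLeastAtMost closed_Collect_le
              continuous_on_fst continuous_on_snd continuous_on_id)+
      have fstc: "continuous_on ?A fst" "continuous_on ?B snd"
        by (intro continuous_on_fst continuous_on_snd continuous_on_id)+
      have cg1: "continuous_on ?A (\<lambda>x. g (fst x * t))"
        by (rule continuous_on_compose2[OF gv fstc(1)]) auto
      have cA: "continuous_on ?A (\<lambda>x. of_real (snd x / fst x) * g (fst x * t))"
        unfolding continuous_on_def
      proof
        fix x assume x: "x \<in> ?A"
        have lim0: "((\<lambda>x. g (fst x * t)) \<longlongrightarrow> g (fst x * t)) (at x within ?A)"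
          using cg1 x unfolding continuous_on_def by blast
        show "((\<lambda>x. of_real (snd x / fst x) * g (fst x * t)) \<longlongrightarrow> of_real (snd x / fst x) * g (fst x * t))
            (at x within ?A)"
        proof (cases "fst x = 0")
          case False
          then show ?thesis by (intro tendsto_mult tendsto_of_real tendsto_divide tendsto_fst
              tendsto_snd tendsto_ident_at lim0)
        next
          case True
          have lim: "((\<lambda>x. g (fst x * t)) \<longlongrightarrow> 0) (at x within ?A)"
            using lim0 True g0 by simp
          have "((\<lambda>x. of_real (snd x / fst x) * g (fst x * t)) \<longlongrightarrow> 0) (at x within ?A)"
          proof (rule Lim_null_comparison[OF _ tendsto_norm_zero[OF lim]])
            have "norm (of_real (snd y / fst y) * g (fst y * t)) \<le> norm (g (fst y * t))" if "y \<in> ?A" for y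
            proof -
              have "0 \<le> snd y / fst y" "snd y / fst y \<le> 1" using that by (auto simp: divide_le_eq)
              then show ?thesis by (rule shrink)
            qed
            then show "\<forall>\<^sub>F y in at x within ?A. norm (of_real (snd y / fst y) * g (fst y * t))
                \<le> norm (g (fst y * t))"
              unfolding eventually_at_filter by (intro always_eventually) blast
          qed
          then show ?thesis using True by simp
        qed
      qed
      have cB: "continuous_on ?B (\<lambda>x. g (snd x * t))"
        by (rule continuous_on_compose2[OF gv fstc(2)]) auto
      have "continuous_on (?A \<union> ?B) (\<lambda>x. if snd x
          \<le> fst x then of_real (snd x / fst x) * g (fst x * t) else g (snd x * t))"
      proof (rule continuous_on_cases[OF cl cA cB])
        show "\<forall>x. x \<in> ?A \<and> \<not> snd x \<le> fst x \<or> x \<in> ?B \<and> snd x \<le> fst x \<longrightarrow>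
                of_real (snd x / fst x) * g (fst x * t) = g (snd x * t)"
          using g0 by auto
      qed
      then show "continuous_on ({0..1} \<times> {0..1}) (\<lambda>(u, s). h u s)"
        unfolding AB h_def case_prod_unfold .
      show "h u 0 = 0" if "u \<in> {0..1}" for u using that g0 by (auto simp: h_def)
      show "h u 1 = h 0 1" if "u \<in> {0..1}" for u using that by (auto simp: h_def)
      show "h u s \<in> regular_points S" if "u \<in> {0..1}" "s \<in> {0<..1}" for u s
      proof (cases "s \<le> u")
        case True
        then have u: "u > 0" "u \<in> {0..1}" using that by auto
        have "0 \<le> s / u" "s / u \<le> 1" using True u that by (auto simp: divide_le_eq)
        then have "norm (of_real (s / u) * g (u * t)) \<le> norm (g (u * t))"
          by (rule shrink)
        also have "\<dots> < r" using e(2)[OF mem[OF u(2)]] by simp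
        finally have "of_real (s / u) * g (u * t) \<in> ball 0 r" by simp
        moreover have "u * t \<in> {0<..1}" using u t mem(1)[OF u(2)] by auto
        then have "of_real (s / u) * g (u * t) \<noteq> 0" using gn[of "u * t"] u that by simp
        ultimately show ?thesis using r(3) True unfolding h_def by simp
      next
        case False
        have "s * t \<in> {0<..1}" using mem(1)[of s] that t by auto
        then show ?thesis using False g by (simp add: h_def regular_path_def)
      qed
      show "h 0 s = subpath 0 t g s" if "s \<in> {0..1}" for s
        using that g0 by (auto simp: h_def subpath_def mult.commute)
      show "h 1 s = linepath 0 (g t) s" if "s \<in> {0..1}" for s
        using that by (auto simp: h_def linepath_def scaleR_conv_of_real)
    qed
    then show ?thesis using gn t by (simp add: origin_branch_def)
  qed
  then show ?thesis using r(1,2) e by (intro exI[of _ "origin_branch S F"] exI[of _ r] exI[of _ e]) auto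
qed

text \<open>
  A segment from \<open>1 + E\<close> to \<open>1 + E * q\<close> with \<open>q\<close> near \<open>1\<close> avoids the point \<open>1\<close>
  and stays in the disk.
\<close>
lemma closed_segment_around_one:
  fixes E q :: complex
  assumes "E \<noteq> 0" "norm (q - 1) < 1" "norm E \<le> \<rho>" "norm (E * q) \<le> \<rho>" 
  shows "closed_segment (1 + E) (1 + E * q) \<subseteq> {w. 0 < dist w 1 \<and> dist w 1 \<le> \<rho>}"
proof
  fix w assume "w \<in> closed_segment (1 + E) (1 + E * q)"
  then obtain u where u: "0 \<le> u" "u \<le> 1" "w = (1 - u) *\<^sub>R (1 + E) + u *\<^sub>R (1 + E * q)"
    by (auto simp: in_segment)
  then have w: "w - 1 = E * (1 + of_real u * (q - 1))"
    by (simp add: scaleR_conv_of_real algebra_simps)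
  have "norm (of_real u * (q - 1)) < 1"
  proof -
    have "norm (of_real u * (q - 1)) \<le> 1 * norm (q - 1)"
      using u by (simp add: norm_mult mult_left_le_one_le)
    then show ?thesis using assms by simp
  qed
  then have "1 + of_real u * (q - 1) \<noteq> 0"
    by (metis add_eq_0_iff less_irrefl norm_minus_cancel norm_one)
  then have "w \<noteq> 1" using w assms(1) by auto
  moreover have "w \<in> cball 1 \<rho>"
  proof -
    have "closed_segment (1 + E) (1 + E * q) \<subseteq> cball 1 \<rho>"
      using assms by (intro closed_segment_subset) (auto simp: dist_norm)
    then show ?thesis using \<open>w \<in> closed_segment (1 + E) (1 + E * q)\<close> by blast
  qed
  ultimately show "w \<in> {w. 0 < dist w 1 \<and> dist w 1 \<le> \<rho>}" by (auto simp: dist_commute)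
qed

text \<open>
  The end point of \<open>\<delta>\<close> is regular because it lies on the boundary circle of the punctured disk around
  \<open>1\<close> that is free of punctures.
\<close>
lemma log_coordinate_regular_path:
  assumes "log_coordinate S \<omega> \<delta> \<zeta>0"
  shows "regular_path S \<delta>" and "{w. 0 < dist w 1 \<and> dist w 1 \<le> exp (Re \<zeta>0)} \<subseteq> regular_points S"
    and "\<delta> 1 = 1 + exp \<zeta>0"
proof -
  show sub: "{w. 0 < dist w 1 \<and> dist w 1 \<le> exp (Re \<zeta>0)} \<subseteq> regular_points S"
    using assms by (auto simp: log_coordinate_def regular_points_def)
  show \<delta>1: "\<delta> 1 = 1 + exp \<zeta>0" using assms by (simp add: log_coordinate_def pathfinish_def)
  have "\<delta> 1 \<in> regular_points S"
    unfolding \<delta>1 by (rule subsetD[OF sub]) (simp add: dist_norm)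
  moreover have "\<delta> t \<in> regular_points S" if "t \<in> {0<..<1}" for t
    using assms that by (auto simp: log_coordinate_def curves_def regular_points_def)
  ultimately have "\<delta> t \<in> regular_points S" if "t \<in> {0<..1}" for t
    using that by (cases "t = 1") auto
  moreover have "continuous_on {0..1} \<delta>" "\<delta> 0 = 0"
    using assms valid_path_imp_path by (auto simp: log_coordinate_def path_def curves_def)
  ultimately show "regular_path S \<delta>" by (simp add: regular_path_def)
qed

lemma one_plus_exp_regular:
  assumes "log_coordinate S \<omega> \<delta> \<zeta>0" "Re x \<le> Re \<zeta>0"
  shows "1 + exp x \<in> regular_points S"
  using log_coordinate_regular_path(2)[OF assms(1)] assms(2) by (auto simp: dist_norm)

lemma Re_linepath_le: "Re a \<le> R \<Longrightarrow> Re b \<le> R \<Longrightarrow> t \<in> {0..1} \<Longrightarrow> Re (linepath a b t) \<le> R"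
  using convex_bound_le[of "Re a" R "Re b" "1 - t" t] by (simp add: linepath_def)

lemma regular_path_spiral_curve:
  assumes L: "log_coordinate S \<omega> \<delta> \<zeta>0" and x: "Re x \<le> Re \<zeta>0"
  shows "regular_path S (spiral_curve \<delta> \<zeta>0 x)"
  unfolding spiral_curve_def
proof (rule regular_path_join)
  show "regular_path S \<delta>" by (rule log_coordinate_regular_path[OF L])
  show "1 + exp (linepath \<zeta>0 x s) \<in> regular_points S" if "s \<in> {0..1}" for s
    using one_plus_exp_regular[OF L Re_linepath_le] x that by auto
  show "\<delta> 1 = 1 + exp (linepath \<zeta>0 x 0)"
    using log_coordinate_regular_path[OF L] by (simp add: linepath_def)
qed (intro continuous_intros continuous_on_linepath)

lemma spiral_curve_1: "spiral_curve \<delta> \<zeta>0 x 1 = 1 + exp x"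
  by (simp add: spiral_curve_def joinpaths_def linepath_def)

text \<open>
  Two spirals with nearby end coordinates are homotopic along chords once the second one is
  prolonged by a segment.
\<close>
lemma log_point_local_branch:
  assumes F: "analytic_on_Omega S F"
    and L: "log_coordinate S \<omega> \<delta> \<zeta>0" and x0: "Re x0 \<le> Re \<zeta>0"
  shows "\<exists>g e. e > 0 \<and> g analytic_on {1 + exp x0} \<and>
     (\<forall>x. Re x \<le> Re \<zeta>0 \<and> dist x x0 < e \<longrightarrow> F (log_point S \<delta> \<zeta>0 x) = g (1 + exp x))"
proof -
  let ?s = "spiral_curve \<delta> \<zeta>0"
  let ?D = "{w. 0 < dist w 1 \<and> dist w 1 \<le> exp (Re \<zeta>0)}"
  have D: "?D \<subseteq> regular_points S" by (rule log_coordinate_regular_path[OF L])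
  define g where "g w = F (curve_class S (Some \<circ> (?s x0 +++ linepath (?s x0 1) w)))" for w
  have g: "g analytic_on {1 + exp x0}"
    using analytic_on_segment_continuation[OF F regular_path_spiral_curve[OF L x0]]
    unfolding g_def by (simp add: spiral_curve_1)
  have "isCont exp (0::complex)" by simp
  then obtain e where e: "e > 0" "\<And>z::complex. dist z 0 < e \<Longrightarrow> dist (exp z) (exp 0) < 1"
    unfolding continuous_at_eps_delta by (metis zero_less_one)
  have "F (log_point S \<delta> \<zeta>0 x) = g (1 + exp x)" if x: "Re x \<le> Re \<zeta>0" "dist x x0 < e" for x
  proof -
    let ?P = "?s x0 +++ linepath (1 + exp x0) (1 + exp x)"
    have near: "norm (exp (of_real \<tau> * (x - x0)) - 1) < 1" if "\<tau> \<in> {0..1}" for \<tau>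
    proof -
      have "norm (of_real \<tau> * (x - x0)) \<le> 1 * norm (x - x0)"
        using that by (simp add: norm_mult mult_left_le_one_le)
      also have "\<dots> < e" using x by (simp add: dist_norm)
      finally show ?thesis using e(2)[of "of_real \<tau> * (x - x0)"] by (simp add: dist_norm)
    qed
    have seg: "closed_segment (1 + exp (linepath \<zeta>0 x0 \<tau>)) (1 + exp (linepath \<zeta>0 x \<tau>)) \<subseteq> ?D"
      if "\<tau> \<in> {0..1}" for \<tau>
    proof -
      have eq: "linepath \<zeta>0 x \<tau> = linepath \<zeta>0 x0 \<tau> + of_real \<tau> * (x - x0)"
        by (simp add: linepath_def scaleR_conv_of_real algebra_simps)
      have ex: "exp (linepath \<zeta>0 x \<tau>) = exp (linepath \<zeta>0 x0 \<tau>) * exp (of_real \<tau> * (x - x0))"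
        unfolding eq by (rule exp_add)
      have le: "norm (exp (linepath \<zeta>0 x \<tau>)) \<le> exp (Re \<zeta>0)" "norm (exp (linepath \<zeta>0 x0 \<tau>)) \<le> exp (Re \<zeta>0)"
        using Re_linepath_le[of \<zeta>0 "Re \<zeta>0" _ \<tau>] x x0 that by simp_all
      show ?thesis
        unfolding ex by (rule
            closed_segment_around_one[OF exp_not_eq_zero near[OF that] le(2) le(1)[unfolded ex]])
    qed
    have s1: "linepath a b 1 = b" for a b :: complex by (simp add: linepath_def)
    have seg1: "closed_segment (1 + exp x0) (1 + exp x) \<subseteq> ?D"
      using seg[of 1] by (simp add: s1)
    have rx: "regular_path S (?s x)" by (rule regular_path_spiral_curve[OF L x(1)])
    have P: "regular_path S ?P"
    proof (rule regular_path_join[OF regular_path_spiral_curve[OF L x0]])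
      show "linepath (1 + exp x0) (1 + exp x) s \<in> regular_points S" if "s \<in> {0..1}" for s
        using seg1 D linepath_in_path[OF that] by blast
    qed (simp_all add: spiral_curve_1 linepath_def continuous_on_linepath[unfolded linepath_def]
        continuous_intros)
    have r: "continuous_on {0..1} (\<lambda>s::real. min (2 * s) 1)"
      by (intro continuous_intros)
    have "log_point S \<delta> \<zeta>0 x = curve_class S (Some \<circ> (?s x \<circ> (\<lambda>s. min (2 * s) 1)))"
      unfolding log_point_def by (rule curve_class_reparam[OF rx r, symmetric]) auto
    also have "\<dots> = curve_class S (Some \<circ> ?P)"
    proof (rule curve_class_eq_linear[OF _ P])
      show "regular_path S (?s x \<circ> (\<lambda>s. min (2 * s) 1))"
        by (rule regular_path_reparam[OF rx r]) auto
      show "(?s x \<circ> (\<lambda>s. min (2 * s) 1)) 1 = ?P 1"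
        by (simp add: spiral_curve_1 joinpaths_def linepath_def)
      fix s :: real assume s: "s \<in> {0<..1}"
      let ?q = "?s x \<circ> (\<lambda>s. min (2 * s) 1)"
      show "closed_segment (?q s) (?P s) \<subseteq> regular_points S"
      proof (cases "s \<le> 1/2")
        case True
        then have qP: "?q s = ?s x (2 * s)" "?P s = ?s x0 (2 * s)"
          by (auto simp: joinpaths_def min_def)
        show ?thesis
        proof (cases "2 * s \<le> 1/2")
          case le: True
          then have "?q s = ?P s" unfolding qP by (simp add: spiral_curve_def joinpaths_def)
          moreover have "?P s \<in> regular_points S" using P s by (simp add: regular_path_def)
          ultimately show ?thesis by simp
        next
          case False
          have "?q s = 1 + exp (linepath \<zeta>0 x (2 * (2 * s) - 1))" "?P s = 1
              + exp (linepath \<zeta>0 x0 (2 * (2 * s) - 1))"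
            unfolding qP using False by (simp_all add: spiral_curve_def joinpaths_def)
          then show ?thesis
            using seg[of "2 * (2 * s) - 1"] True False D by (simp add: closed_segment_commute) 
        qed
      next
        case False
        then have "?q s = 1 + exp x" "?P s = linepath (1 + exp x0) (1 + exp x) (2 * s - 1)"
          by (auto simp: joinpaths_def min_def spiral_curve_1)
        moreover have "linepath (1 + exp x0) (1 + exp x) (2 * s - 1) \<in> closed_segment (1 + exp x0) (1
            + exp x)"
          using False s by (intro linepath_in_path) auto
        ultimately have "closed_segment (?q s) (?P s) \<subseteq> closed_segment (1 + exp x0) (1 + exp x)"
          by (intro closed_segment_subset) auto
        then show ?thesis using seg1 D by blast
      qed
    qed
    finally show ?thesis by (simp add: g_def spiral_curve_1)
  qed
  then show ?thesis using g e(1) by blast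
qed

lemma log_point_continuous_holomorphic:
  assumes F: "analytic_on_Omega S F" and L: "log_coordinate S \<omega> \<delta> \<zeta>0"
  shows "continuous_on {x. Re x \<le> Re \<zeta>0} (\<lambda>x. F (log_point S \<delta> \<zeta>0 x))"
    and "(\<lambda>x. F (log_point S \<delta> \<zeta>0 x)) holomorphic_on {x. Re x < Re \<zeta>0}"
proof -
  let ?f = "\<lambda>x. F (log_point S \<delta> \<zeta>0 x)"
  have loc: "\<exists>h e. e > 0 \<and> h field_differentiable at x0 \<and> (\<forall>x. Re x \<le> Re \<zeta>0 \<and> dist x x0 < e \<longrightarrow> ?f x = h x)"
    if x0: "Re x0 \<le> Re \<zeta>0" for x0
  proof -
    obtain g e where g: "e > 0" "g analytic_on {1 + exp x0}"
      "\<And>x. Re x \<le> Re \<zeta>0 \<Longrightarrow> dist x x0 < e \<Longrightarrow> ?f x = g (1 + exp x)"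
      using log_point_local_branch[OF F L x0] by blast
    have "g \<circ> (\<lambda>x. 1 + exp x) field_differentiable at x0"
    proof (rule field_differentiable_compose)
      show "(\<lambda>x. 1 + exp x) field_differentiable at x0"
        by (intro field_differentiable_add field_differentiable_const field_differentiable_within_exp)
      show "g field_differentiable at (1 + exp x0)"
        using g(2) analytic_on_imp_differentiable_at by blast
    qed
    then show ?thesis using g by (intro exI[of _ "g \<circ> (\<lambda>x. 1 + exp x)"] exI[of _ e]) auto
  qed
  show "continuous_on {x. Re x \<le> Re \<zeta>0} ?f"
    unfolding continuous_on_eq_continuous_within
  proof
    fix x0 assume x0: "x0 \<in> {x. Re x \<le> Re \<zeta>0}"
    then obtain h e where h: "e > 0" "h field_differentiable at x0"
        "\<And>x. Re x \<le> Re \<zeta>0 \<Longrightarrow> dist x x0 < e \<Longrightarrow> ?f x = h x"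
      using loc[of x0] by auto
    have "continuous (at x0 within {x. Re x \<le> Re \<zeta>0}) h"
      using h(2) field_differentiable_imp_continuous_at continuous_at_imp_continuous_at_within by blast
    then show "continuous (at x0 within {x. Re x \<le> Re \<zeta>0}) ?f"
      by (rule continuous_transform_within[OF _ h(1)]) (use x0 h in auto)
  qed
  show "?f holomorphic_on {x. Re x < Re \<zeta>0}"
    unfolding holomorphic_on_def
  proof
    fix x0 assume x0: "x0 \<in> {x. Re x < Re \<zeta>0}"
    then obtain h e where h: "e > 0" "h field_differentiable at x0"
        "\<And>x. Re x \<le> Re \<zeta>0 \<Longrightarrow> dist x x0 < e \<Longrightarrow> ?f x = h x"
      using loc[of x0] by auto
    have "h field_differentiable at x0 within {x. Re x < Re \<zeta>0}"
      using h(2) by (rule field_differentiable_at_within)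
    then show "?f field_differentiable at x0 within {x. Re x < Re \<zeta>0}"
      by (rule field_differentiable_transform_within[OF h(1), rotated 2]) (use x0 h in auto)
  qed
qed

text \<open>
  A part of a spiral curve that reaches into the spiral is itself a spiral curve, up to
  reparametrization.
\<close>
lemma curve_class_subpath_spiral_curve_right:
  assumes L: "log_coordinate S \<omega> \<delta> \<zeta>0" and \<zeta>: "Re \<zeta> \<le> Re \<zeta>0" and t: "1/2 < t" "t \<le> 1"
  shows "curve_class S (Some \<circ> subpath 0 t (spiral_curve \<delta> \<zeta>0 \<zeta>))
      = log_point S \<delta> \<zeta>0 (linepath \<zeta>0 \<zeta> (2 * t - 1))"
proof -
  let ?g = "spiral_curve \<delta> \<zeta>0 \<zeta>"
  let ?x = "linepath \<zeta>0 \<zeta> (2 * t - 1)"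
  define R where "R s = min s (1/2) + max (2 * s - 1) 0 * (t - 1/2)" for s :: real
  have R_simps: "s \<le> 1/2 \<Longrightarrow> R s = s" "s > 1/2 \<Longrightarrow> R s = 1/2 + (2 * s - 1) * (t - 1/2)" for s
    by (simp_all add: R_def)
  have g: "regular_path S (subpath 0 t ?g)"
    using t by (intro regular_path_subpath regular_path_spiral_curve[OF L \<zeta>]) auto
  have Rc: "continuous_on {0..1} R"
    unfolding R_def by (intro continuous_intros)
  have Rb: "0 < R s \<and> R s \<le> t" if "s \<in> {0<..1}" for s
  proof (cases "s \<le> 1/2")
    case False
    have "(2 * s - 1) * (t - 1/2) \<le> 1 * (t - 1/2)" using that t False by (intro mult_right_mono) auto
    moreover have "(2 * s - 1) * (t - 1/2) \<ge> 0" using that t False by (intro mult_nonneg_nonneg) auto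
    ultimately show ?thesis using False by (simp add: R_simps)
  qed (use that t in \<open>auto simp: R_simps\<close>)
  have "subpath 0 t ?g \<circ> (\<lambda>s. R s / t) = spiral_curve \<delta> \<zeta>0 ?x"
  proof
    fix s
    have "(subpath 0 t ?g \<circ> (\<lambda>s. R s / t)) s = ?g (R s)" using t by (simp add: subpath_def)
    also have "\<dots> = spiral_curve \<delta> \<zeta>0 ?x s"
    proof (cases "s \<le> 1/2")
      case False
      then have "(2 * s - 1) * (t - 1/2) > 0" using t by simp
      then have "R s > 1/2" using False by (simp add: R_simps)
      then have "?g (R s) = 1 + exp (linepath \<zeta>0 \<zeta> (2 * R s - 1))"
        by (simp add: spiral_curve_def joinpaths_def)
      also have "linepath \<zeta>0 \<zeta> (2 * R s - 1) = linepath \<zeta>0 ?x (2 * s - 1)"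
        using False by (simp add: R_simps linepath_def scaleR_conv_of_real algebra_simps)
      finally show ?thesis using False by (simp add: spiral_curve_def joinpaths_def)
    qed (simp add: spiral_curve_def joinpaths_def R_simps)
    finally show "(subpath 0 t ?g \<circ> (\<lambda>s. R s / t)) s = spiral_curve \<delta> \<zeta>0 ?x s" .
  qed
  moreover have "curve_class S (Some \<circ> (subpath 0 t ?g \<circ> (\<lambda>s. R s / t)))
      = curve_class S (Some \<circ> subpath 0 t ?g)"
  proof (rule curve_class_reparam[OF g])
    show "R s / t \<in> {0<..1}" if "s \<in> {0<..1}" for s using Rb[OF that] t by auto
  qed (use t in \<open>auto intro!: continuous_intros Rc simp: R_simps\<close>)
  ultimately show ?thesis by (simp add: log_point_def)
qed

section \<open>The operator near the origin\<close>

text \<open>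
  On the segment from \<open>0\<close> to \<open>w\<close> the branches of the powers combine to
  \<open>L\<^sub>\<beta> F w = w * H w\<close>, where \<open>H w\<close> is the integral of \<open>F (s * w) * (1 - s) powr \<beta>\<close> over
  \<open>0 \<le> s \<le> 1\<close>.
\<close>
lemma L_comp_analytic_at_0_phi0:
  assumes F: "analytic_on_Omega S F" and \<beta>: "Re \<beta> > 0"
  shows "L_comp_analytic_at_0 \<beta> S F (\<lambda>z. 2 * z - z\<^sup>2)"
proof -
  let ?F = "origin_branch S F"
  let ?\<phi> = "\<lambda>z::complex. 2 * z - z\<^sup>2"
  obtain r where r: "r > 0" "?F holomorphic_on ball 0 r"
    using origin_branch_analytic[OF F] by (auto simp: analytic_on_def)
  define h where "h w s = ?F (s * w) * (1 - s) powr \<beta>" for w s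
  define H where "H w = contour_integral (linepath 0 1) (h w)" for w
  have seg: "Im s = 0" "0 \<le> Re s" "Re s \<le> 1" if "s \<in> closed_segment 0 1" for s :: complex
    using that by (auto simp: closed_segment_def)
  have mem: "s * w \<in> ball 0 r" if "s \<in> closed_segment 0 1" "w \<in> ball 0 r" for s w :: complex
  proof -
    have "norm s \<le> 1" using seg[OF that(1)] by (simp add: cmod_eq_Re)
    then have "norm (s * w) \<le> norm w" by (simp add: norm_mult mult_left_le_one_le)
    then show ?thesis using that by simp
  qed
  have cont: "continuous_on (ball 0 r \<times> closed_segment 0 1) (\<lambda>(w, s). h w s)"
    unfolding case_prod_unfold h_def
  proof (rule continuous_on_mult)
    show "continuous_on (ball 0 r \<times> closed_segment 0 1) (\<lambda>x. ?F (snd x * fst x))"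
      by (rule continuous_on_compose2[where g = ?F and f = "\<lambda>x. snd x * fst x" and t = "ball 0 r"])
         (use r(2) mem in \<open>auto intro!: holomorphic_on_imp_continuous_on continuous_on_mult
             continuous_on_fst continuous_on_snd continuous_on_id\<close>)
    show "continuous_on (ball 0 r \<times> closed_segment 0 1) (\<lambda>x::complex \<times> complex. (1 - snd x) powr \<beta>)"
    proof (rule continuous_on_compose2[OF continuous_on_powr_right_half_plane[OF \<beta>], where f
        = "\<lambda>x. 1 - snd x"])
      show "continuous_on (ball 0 r \<times> closed_segment 0 1) (\<lambda>x::complex \<times> complex. 1 - snd x)"
        by (intro continuous_on_diff continuous_on_const continuous_on_snd continuous_on_id)
      show "(\<lambda>x. 1 - snd x) ` (ball 0 r \<times> closed_segment 0 1) \<subseteq> {q::complex. 0 < Re q \<or> q = 0}"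
        using seg by (force simp: complex_eq_iff)
    qed
  qed
  have holH: "H holomorphic_on ball 0 r"
    unfolding H_def
  proof (rule holomorphic_on_contour_integral_linepath[OF open_ball cont])
    fix s :: complex assume s: "s \<in> closed_segment 0 1"
    have "?F \<circ> (\<lambda>w. s * w) holomorphic_on ball 0 r"
      by (intro holomorphic_on_compose holomorphic_on_subset[OF r(2)] holomorphic_intros)
          (use mem[OF s] in blast)
    then show "(\<lambda>w. h w s) holomorphic_on ball 0 r"
      unfolding h_def o_def by (intro holomorphic_on_mult holomorphic_on_const)
  qed
  have hasL: "has_L \<beta> S F (linepath 0 w) (w * H w)" if w: "w \<in> ball 0 r" "w \<noteq> 0" for w
    unfolding has_L_def
  proof (intro exI conjI)
    let ?l = "\<lambda>t::real. Ln w + complex_of_real (ln (1 - t))"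
    show "continuous_on {0..<1} ?l" by (intro continuous_intros) auto
    show "\<forall>t\<in>{0..<1}. exp (?l t) = linepath 0 w 1 - linepath 0 w t"
    proof
      fix t :: real assume "t \<in> {0..<1}"
      then have e: "exp (complex_of_real (ln (1 - t))) = 1 - of_real t" by (simp add: exp_of_real)
      have "exp (?l t) = w * (1 - of_real t)"
        unfolding exp_add e using w(2) by simp
      then show "exp (?l t) = linepath 0 w 1 - linepath 0 w t"
        by (simp add: linepath_def scaleR_conv_of_real algebra_simps)
    qed
    have "continuous_on (closed_segment 0 1) ((\<lambda>(w, s). h w s) \<circ> (\<lambda>s. (w, s)))"
      by (intro continuous_on_compose continuous_on_subset[OF cont] continuous_on_Pair
          continuous_on_const continuous_on_id)
         (use w in auto)
    then have "continuous_on (closed_segment 0 1) (h w)" by (simp add: o_def)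
    then have "(h w has_contour_integral H w) (linepath 0 1)"
      unfolding H_def by (intro has_contour_integral_integral contour_integrable_continuous_linepath)
    then have "((\<lambda>t. h w (linepath 0 1 t) * (1 - 0)) has_integral H w) {0..1}"
      by (simp only: has_contour_integral_linepath)
    then have "((\<lambda>t. h w (of_real t)) has_integral H w) {0..1}"
      by (simp add: linepath_def scaleR_conv_of_real)
    then have "((\<lambda>t. exp (\<beta> * Ln w) * w * h w (of_real t)) has_integral (exp (\<beta> * Ln w) * w * H w)) {0..1}"
      by (rule has_integral_mult_right)
    then show "((\<lambda>t. F (curve_class S (Some \<circ> subpath 0 t (linepath 0 w))) * exp (\<beta> * ?l t) *
               vector_derivative (linepath 0 w) (at t within {0..1}))
                   has_integral (exp (\<beta> * Ln w) * w * H w)) {0..1}"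
    proof (rule has_integral_spike_finite[of "{0, 1}", rotated 2])
      fix t :: real assume t: "t \<in> {0..1} - {0, 1}"
      have "subpath 0 t (linepath 0 w) = linepath 0 (of_real t * w)"
        by (auto simp: subpath_def linepath_def scaleR_conv_of_real fun_eq_iff)
      then have 1: "F (curve_class S (Some \<circ> subpath 0 t (linepath 0 w))) = ?F (of_real t * w)"
        using t w(2) by (simp add: origin_branch_def)
      have "(1 - complex_of_real t) powr \<beta> = exp (\<beta> * Ln (of_real (1 - t)))"
        using t by (simp add: powr_def)
      also have "Ln (complex_of_real (1 - t)) = of_real (ln (1 - t))"
        using t by (intro Ln_of_real) auto
      finally have 2: "exp (\<beta> * ?l t) = exp (\<beta> * Ln w) * (1 - complex_of_real t) powr \<beta>"
        by (simp add: distrib_left exp_add)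
      have 3: "vector_derivative (linepath 0 w) (at t within {0..1}) = w"
        using t by (subst vector_derivative_linepath_within) auto
      show "F (curve_class S (Some \<circ> subpath 0 t (linepath 0 w))) * exp (\<beta> * ?l t) *
               vector_derivative (linepath 0 w) (at t within {0..1}) = exp (\<beta> * Ln w) * w * h w (of_real t)"
        unfolding 1 2 3 h_def by (simp only: mult_ac)
    qed simp
    have "exp (- \<beta> * ?l 0) * exp (\<beta> * Ln w) = 1"
      by (simp flip: exp_add)
    then show "w * H w = exp (- \<beta> * ?l 0) * (exp (\<beta> * Ln w) * w * H w)"
      by (simp only: mult.assoc[symmetric] mult_1_left)
  qed
  have \<phi>: "?\<phi> analytic_on {0}" by (intro analytic_intros)
  have "H analytic_on {?\<phi> 0}" using holH r(1) analytic_on_open[OF open_ball]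
      analytic_on_subset[of H "ball 0 r" "{?\<phi> 0}"] by auto
  then have "(H \<circ> ?\<phi>) analytic_on {0}" using \<phi> by (intro analytic_on_compose) auto
  then have G: "(\<lambda>z. ?\<phi> z * H (?\<phi> z)) analytic_on {0}" 
    using analytic_on_mult[OF \<phi>] by (simp add: o_def)
  have "isCont ?\<phi> 0" by (intro continuous_intros)
  then have "\<forall>\<^sub>F z in at 0. ?\<phi> z \<in> ball 0 r"
    using r(1) by (intro topological_tendstoD[of ?\<phi> "?\<phi> 0"]) (auto simp: isCont_def)
  moreover have "\<forall>\<^sub>F z in at 0. z \<noteq> (2::complex)"
    using eventually_neq_at_within[of 2 0 UNIV] by simp
  moreover have "\<forall>\<^sub>F z in at 0. z \<noteq> (0::complex)"
    by (simp add: eventually_at_filter)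
  ultimately have "\<forall>\<^sub>F z in at 0. has_L \<beta> S F (linepath 0 (?\<phi> z)) (?\<phi> z * H (?\<phi> z))"
  proof eventually_elim
    case (elim z)
    have "?\<phi> z = z * (2 - z)" by (simp add: power2_eq_square algebra_simps)
    then have "?\<phi> z \<noteq> 0" using elim by auto
    then show ?case using elim by (intro hasL)
  qed
  then show ?thesis using G unfolding L_comp_analytic_at_0_def by blast
qed

section \<open>The operator near the singularity\<close>

lemma curve_class_cong:
  assumes "regular_path S p" "regular_path S q" "\<And>s. s \<in> {0..1} \<Longrightarrow> p s = q s"
  shows "curve_class S (Some \<circ> p) = curve_class S (Some \<circ> q)"
proof (rule curve_class_eq_linear[OF assms(1,2)])
  show "p 1 = q 1" using assms(3) by simp
  show "closed_segment (p s) (q s) \<subseteq> regular_points S" if "s \<in> {0<..1}" for s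
  proof -
    have "p s \<in> regular_points S" using assms(1) that by (simp add: regular_path_def)
    moreover have "q s = p s" using assms(3)[of s] that by simp
    ultimately show ?thesis by simp
  qed
qed

lemma local_branch_along_path:
  assumes S: "discrete_punctures S" and F: "analytic_on_Omega S F" and g: "regular_path S g"
    and t0: "t0 \<in> {0..1}"
  shows "\<exists>f r e. r > 0 \<and> e > 0 \<and> f holomorphic_on ball (g t0) r \<and>
           (\<forall>t\<in>{0<..1}. \<bar>t - t0\<bar> < e \<longrightarrow> g t \<in> ball (g t0) r \<and>
              F (curve_class S (Some \<circ> subpath 0 t g)) = f (g t))"
proof (cases "t0 = 0")
  case True
  then show ?thesis
    using local_branch_at_origin[OF S F g] g by (fastforce simp: regular_path_def)
next
  case False
  then show ?thesis using local_branch_at_positive[OF S F g, of t0] t0 by auto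
qed

text \<open>
  The factor \<open>exp (\<beta> * m t)\<close>, with \<open>m\<close> a continuous branch of \<open>ln (1 - g t)\<close>, is locally a
  holomorphic function of \<open>g t\<close> as well.
\<close>
lemma local_branch_with_power:
  assumes S: "discrete_punctures S" and F: "analytic_on_Omega S F" and g: "regular_path S g"
    and t0: "t0 \<in> {0..1}"
    and m: "continuous_on {0..1} m" "\<And>t. t \<in> {0..1} \<Longrightarrow> exp (m t) = 1 - g t"
  shows "\<exists>f r e. r > 0 \<and> e > 0 \<and> f holomorphic_on ball (g t0) r \<and>
           (\<forall>t\<in>{0<..1}. \<bar>t - t0\<bar> < e \<longrightarrow> g t \<in> ball (g t0) r \<and>
              F (curve_class S (Some \<circ> subpath 0 t g)) * exp (\<beta> * m t) = f (g t))"
proof -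
  obtain f r e where f: "r > 0" "e > 0" "f holomorphic_on ball (g t0) r"
    "\<And>t. t \<in> {0<..1} \<Longrightarrow> \<bar>t - t0\<bar> < e \<Longrightarrow> g t \<in> ball (g t0) r \<and>
              F (curve_class S (Some \<circ> subpath 0 t g)) = f (g t)"
    using local_branch_along_path[OF S F g t0] by blast
  let ?a = "1 - g t0"
  have a: "?a \<noteq> 0" using m(2)[OF t0] exp_not_eq_zero by metis
  define r' where "r' = min r (norm ?a)"
  have r': "r' > 0" using f(1) a by (simp add: r'_def)
  define f' where "f' s = f s * exp (\<beta> * (m t0 + Ln ((1 - s) / ?a)))" for s
  have pos: "(1 - s) / ?a \<notin> \<real>\<^sub>\<le>\<^sub>0" if "s \<in> ball (g t0) r'" for s
  proof -
    have "(1 - s) / ?a = 1 + (g t0 - s) / ?a" using a by (simp add: field_simps)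
    moreover have "norm ((g t0 - s) / ?a) < 1"
      using that a by (simp add: norm_divide dist_norm r'_def)
    then have "\<bar>Re ((g t0 - s) / ?a)\<bar> < 1" using abs_Re_le_cmod le_less_trans by blast
    ultimately have "Re ((1 - s) / ?a) > 0" by simp
    then show ?thesis by (simp add: complex_nonpos_Reals_iff)
  qed
  have "f' holomorphic_on ball (g t0) r'"
    unfolding f'_def using pos a
    by (intro holomorphic_intros holomorphic_on_subset[OF f(3)]) (auto simp: r'_def)
  moreover obtain e1 where e1: "e1 > 0" "\<And>t. t \<in> {0..1} \<Longrightarrow> dist t t0 < e1 \<Longrightarrow> dist (m t) (m t0) < 1"
    using m(1) t0 zero_less_one unfolding continuous_on_iff by blast
  moreover obtain e2 where e2: "e2 > 0" "\<And>t. t \<in> {0..1} \<Longrightarrow> dist t t0 < e2 \<Longrightarrow> dist (g t) (g t0) < r'"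
  proof -
    have "continuous_on {0..1} g" using g by (simp add: regular_path_def)
    then show ?thesis using that t0 r' unfolding continuous_on_iff by blast
  qed
  moreover have "g t \<in> ball (g t0) r' \<and> F (curve_class S (Some \<circ> subpath 0 t g)) * exp (\<beta> * m t) = f' (g t)"
    if t: "t \<in> {0<..1}" "\<bar>t - t0\<bar> < min e (min e1 e2)" for t
  proof -
    have t01: "t \<in> {0..1}" using t by auto
    have gt: "g t \<in> ball (g t0) r'" using e2(2)[OF t01] t by (simp add: dist_real_def dist_commute)
    have "exp (m t - m t0) = (1 - g t) / ?a" using m(2)[OF t01] m(2)[OF t0] by (simp add: exp_diff)
    moreover have "\<bar>Im (m t - m t0)\<bar> < 1"
      using e1(2)[OF t01] t abs_Im_le_cmod[of "m t - m t0"] by (simp add: dist_norm)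
    then have "Ln (exp (m t - m t0)) = m t - m t0" using pi_gt3 by (intro Ln_exp) auto
    ultimately have "m t = m t0 + Ln ((1 - g t) / ?a)" by simp
    then have "F (curve_class S (Some \<circ> subpath 0 t g)) * exp (\<beta> * m t) = f' (g t)"
      using f(4)[of t] t by (simp add: f'_def)
    then show ?thesis using gt by simp
  qed
  ultimately show ?thesis using f(2) r'
    by (intro exI[of _ f'] exI[of _ r'] exI[of _ "min e (min e1 e2)"]) auto
qed

lemma vector_derivative_join_left:
  fixes p q :: "real \<Rightarrow> complex"
  assumes "finite K" "\<And>t. t \<in> {0..1} - K \<Longrightarrow> p differentiable at t"
    and t: "0 < t" "t < 1/2" "2 * t \<notin> K"
  shows "vector_derivative (p +++ q) (at t within {0..1})
      = 2 * vector_derivative p (at (2 * t) within {0..1})"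
proof -
  have "(p has_vector_derivative vector_derivative p (at (2 * t))) (at (2 * t))"
    using assms by (simp add: vector_derivative_works)
  note p = this
  have "((\<lambda>t. 2 * t) has_vector_derivative 2) (at t)"
    by (auto intro!: derivative_eq_intros simp flip: has_real_derivative_iff_has_vector_derivative)
  from vector_diff_chain_at[OF this p]
  have "(p \<circ> (\<lambda>t. 2 * t) has_vector_derivative 2 *\<^sub>R vector_derivative p (at (2 * t))) (at t)" .
  then have "(p +++ q has_vector_derivative 2 *\<^sub>R vector_derivative p (at (2 * t))) (at t)"
  proof (rule has_vector_derivative_transform_within_open[of _ _ _ "{..<1/2}"])
    show "(p \<circ> (\<lambda>t. 2 * t)) x = (p +++ q) x" if "x \<in> {..<1/2}" for x
      using that by (simp add: joinpaths_def)
  qed (use t in auto)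
  then have "vector_derivative (p +++ q) (at t within {0..1}) = 2 *\<^sub>R vector_derivative p (at (2 * t))"
    using t by (intro vector_derivative_at_within_ivl) auto
  moreover have "vector_derivative p (at (2 * t) within {0..1}) = vector_derivative p (at (2 * t))"
    using t p by (intro vector_derivative_at_within_ivl) auto
  ultimately show ?thesis by (simp add: scaleR_conv_of_real)
qed

lemma vector_derivative_spiral:
  assumes t: "1/2 < t" "t < 1"
  shows "vector_derivative (spiral_curve \<delta> \<zeta>0 \<zeta>) (at t within {0..1}) =
           2 * (exp (linepath \<zeta>0 \<zeta> (2 * t - 1)) * (\<zeta> - \<zeta>0))"
proof -
  have d: "((\<lambda>t. 1 + exp (\<zeta>0 + (2 * of_real t - 1) * (\<zeta> - \<zeta>0))) has_vector_derivative
          exp (\<zeta>0 + (2 * of_real t - 1) * (\<zeta> - \<zeta>0)) * (2 * (\<zeta> - \<zeta>0))) (at t)"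
    by (rule has_vector_derivative_real_field) (auto intro!: derivative_eq_intros)
  have lp: "linepath \<zeta>0 \<zeta> (2 * x - 1) = \<zeta>0 + (2 * of_real x - 1) * (\<zeta> - \<zeta>0)" for x
    by (simp add: linepath_def scaleR_conv_of_real algebra_simps)
  have "((\<lambda>t. 1 + exp (linepath \<zeta>0 \<zeta> (2 * t - 1))) has_vector_derivative
          2 * (exp (linepath \<zeta>0 \<zeta> (2 * t - 1)) * (\<zeta> - \<zeta>0))) (at t)"
    unfolding lp mult.left_commute[of 2] by (rule d)
  then have "(spiral_curve \<delta> \<zeta>0 \<zeta> has_vector_derivative 2 *
      (exp (linepath \<zeta>0 \<zeta> (2 * t - 1)) * (\<zeta> - \<zeta>0))) (at t)"
    by (rule has_vector_derivative_transform_within_open[of _ _ _ "{1/2<..}"])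
       (use t in \<open>auto simp: spiral_curve_def joinpaths_def\<close>)
  then show ?thesis using t by (intro vector_derivative_at_within_ivl) auto
qed

lemma curve_class_subpath_spiral_curve_left:
  assumes L: "log_coordinate S \<omega> \<delta> \<zeta>0" and \<zeta>: "Re \<zeta> \<le> Re \<zeta>0" and t: "0 < t" "t \<le> 1/2"
  shows "curve_class S (Some \<circ> subpath 0 t (spiral_curve \<delta> \<zeta>0 \<zeta>))
      = curve_class S (Some \<circ> subpath 0 (2 * t) \<delta>)"
proof (rule curve_class_cong)
  show "regular_path S (subpath 0 t (spiral_curve \<delta> \<zeta>0 \<zeta>))"
    using t by (intro regular_path_subpath regular_path_spiral_curve[OF L \<zeta>]) auto
  show "regular_path S (subpath 0 (2 * t) \<delta>)"
    using t by (intro regular_path_subpath log_coordinate_regular_path[OF L]) auto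
  fix s :: real assume "s \<in> {0..1}"
  then have "t * s \<le> t" using t by (auto intro: mult_left_le)
  then have "2 * (t * s) \<le> 1" using t by linarith
  then show "subpath 0 t (spiral_curve \<delta> \<zeta>0 \<zeta>) s = subpath 0 (2 * t) \<delta> s"
    using t by (simp add: subpath_def spiral_curve_def joinpaths_def mult_ac)
qed

text \<open>
  The value of \<open>L\<^sub>\<beta> F\<close> near the singularity: \<open>D\<close> is the part along \<open>\<delta>\<close>, the contour integral the part
  along the spiral, and \<open>m0 + Ln (1 + exp \<zeta>)\<close> the value of the branch of \<open>ln (w - s)\<close> at the start \<open>s = 0\<close>.
\<close>
lemma has_L_spiral_curve:
  assumes S: "discrete_punctures S" and F: "analytic_on_Omega S F" and S1: "Some 1 \<in> S"
    and L: "log_coordinate S \<omega> \<delta> \<zeta>0" and \<beta>: "Re \<beta> > 0"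
  shows "\<exists>\<kappa> m0 D \<rho>. exp \<kappa> = -1 \<and> D analytic_on {1} \<and>
    (\<forall>\<zeta>. Re \<zeta> < \<rho> \<longrightarrow> has_L \<beta> S F (spiral_curve \<delta> \<zeta>0 \<zeta>)
        (exp (- \<beta> * (m0 + Ln (1 + exp \<zeta>))) * (D (1 + exp \<zeta>) +
          contour_integral (linepath \<zeta>0 \<zeta>) (spiral_kernel \<beta> \<kappa> (\<lambda>x. F (log_point S \<delta> \<zeta>0 x)) \<zeta>))))"
proof -
  let ?f = "\<lambda>x. F (log_point S \<delta> \<zeta>0 x)"
  let ?\<Phi> = "\<lambda>t. F (curve_class S (Some \<circ> subpath 0 t \<delta>))"
  note \<delta> = log_coordinate_regular_path(1)[OF L]
  note fc = log_point_continuous_holomorphic(1)[OF F L]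
  note fh = log_point_continuous_holomorphic(2)[OF F L]
  have \<delta>c: "continuous_on {0..1} \<delta>" and \<delta>0: "\<delta> 0 = 0" using \<delta> by (auto simp: regular_path_def)
  have \<delta>1: "\<delta> 1 = 1 + exp \<zeta>0" by (rule log_coordinate_regular_path[OF L])
  have vp: "valid_path \<delta>" using L by (simp add: log_coordinate_def)
  have ne1: "\<delta> t \<noteq> 1" if "t \<in> {0..1}" for t
  proof (cases "t = 0")
    case False
    then have "\<delta> t \<in> regular_points S" using \<delta> that by (simp add: regular_path_def)
    then show ?thesis using S1 by (auto simp: regular_points_def)
  qed (simp add: \<delta>0)
  obtain m where m: "continuous_on {0..1} m" "\<And>t. t \<in> {0..1} \<Longrightarrow> exp (m t) = 1 - \<delta> t"
  proof (rule continuous_logarithm_on_contractible[of "{0..1::real}" "\<lambda>t. 1 - \<delta> t"])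
    show "continuous_on {0..1} (\<lambda>t. 1 - \<delta> t)" by (intro continuous_intros \<delta>c)
    show "contractible {0..1::real}" by (simp add: convex_imp_contractible)
    show "1 - \<delta> t \<noteq> 0" if "t \<in> {0..1}" for t using ne1[OF that] by simp
  qed (use that in metis)
  obtain d where d: "d > 0" "\<And>t. t \<in> {0..1} \<Longrightarrow> d \<le> norm (1 - \<delta> t)"
  proof -
    have "continuous_on {0..1} (\<lambda>t. norm (1 - \<delta> t))" by (intro continuous_intros \<delta>c)
    then obtain t0 where "t0 \<in> {0..1::real}" "\<forall>t\<in>{0..1}. norm (1 - \<delta> t0) \<le> norm (1 - \<delta> t)"
      using continuous_attains_inf[of "{0..1::real}" "\<lambda>t. norm (1 - \<delta> t)"] by auto
    then show ?thesis using ne1[of t0] by (intro that[of "norm (1 - \<delta> t0)"]) auto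
  qed
  \<comment> \<open>With this choice the branches on \<open>\<delta>\<close> and on the spiral agree at the join.\<close>
  define \<kappa> where "\<kappa> = m 1 - \<zeta>0"
  have \<kappa>: "exp \<kappa> = -1"
    using m(2)[of 1] by (simp add: \<kappa>_def exp_diff \<delta>1)
  define k where "k w s = exp (\<beta> * Ln (1 + (w - 1) / (1 - s)))" for w s :: complex
  define W where "W = ball (1::complex) (d / 2)"
  define V where "V = - cball (1::complex) (d / 2)"
  have quot: "1 + (w - 1) / (1 - s) \<notin> \<real>\<^sub>\<le>\<^sub>0" "1 - s \<noteq> 0" "1 + (w - 1) / (1 - s) \<noteq> 0"
      if "w \<in> W" "s \<in> V" for w s
  proof -
    have "norm (w - 1) < d / 2" "d / 2 < norm (1 - s)"
      using that by (auto simp: W_def V_def dist_norm norm_minus_commute)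
    then have "norm ((w - 1) / (1 - s)) < 1" using d(1) by (simp add: norm_divide divide_less_eq)
    then have "\<bar>Re ((w - 1) / (1 - s))\<bar> < 1" using abs_Re_le_cmod le_less_trans by blast
    then have pos: "Re (1 + (w - 1) / (1 - s)) > 0" by simp
    then show "1 + (w - 1) / (1 - s) \<notin> \<real>\<^sub>\<le>\<^sub>0"
      unfolding complex_nonpos_Reals_iff by linarith
    show "1 + (w - 1) / (1 - s) \<noteq> 0"
      using pos by (metis less_irrefl zero_complex.simps(1))
    show "1 - s \<noteq> 0" using \<open>d / 2 < norm (1 - s)\<close> d(1) by auto
  qed
  have \<delta>V: "\<delta> t \<in> V" if "t \<in> {0..1}" for t
    using d(2)[OF that] d(1) by (simp add: V_def dist_norm)
  have "\<exists>D. D holomorphic_on W \<and>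
    (\<forall>w\<in>W. ((\<lambda>t. (?\<Phi> t * exp (\<beta> * m t)) * k w (\<delta> t) * vector_derivative \<delta> (at t within {0..1}))
        has_integral D w) {0..1})"
  proof (rule holomorphic_path_integral_parameter[OF vp])
    show "open W" "open V" by (auto simp: W_def V_def)
    show "path_image \<delta> \<subseteq> V" using \<delta>V by (auto simp: path_image_def)
    show "continuous_on (W \<times> V) (\<lambda>(w, s). k w s)"
      unfolding k_def case_prod_unfold
    proof (intro continuous_on_exp continuous_on_mult continuous_on_const)
      have "continuous_on (W \<times> V) (\<lambda>x. 1 + (fst x - 1) / (1 - snd x))"
        by (intro continuous_on_add continuous_on_divide continuous_on_diff continuous_on_const
              continuous_on_fst continuous_on_snd continuous_on_id) (use quot(2) in \<open>auto simp: W_def\<close>)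
      then show "continuous_on (W \<times> V) (\<lambda>x. Ln (1 + (fst x - 1) / (1 - snd x)))"
        by (rule continuous_on_Ln') (use quot(1) in auto)
    qed
    show "k w holomorphic_on V" if "w \<in> W" for w
      unfolding k_def by (intro holomorphic_intros) (use quot that in auto)
    show "(\<lambda>w. k w s) holomorphic_on W" if "s \<in> V" for s
      unfolding k_def by (intro holomorphic_intros) (use quot that in auto)
    show "\<exists>f r e. r > 0 \<and> e > 0 \<and> f holomorphic_on ball (\<delta> t0) r \<and>
        (\<forall>t\<in>{0<..1}. \<bar>t - t0\<bar> < e \<longrightarrow> \<delta> t \<in> ball (\<delta> t0) r \<and> ?\<Phi> t * exp (\<beta> * m t) = f (\<delta> t))"
      if "t0 \<in> {0..1}" for t0
      by (rule local_branch_with_power[OF S F \<delta> that m])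
  qed
  then obtain D where D: "D holomorphic_on W"
    "\<And>w. w \<in> W \<Longrightarrow> ((\<lambda>t. (?\<Phi> t * exp (\<beta> * m t)) * k w (\<delta> t) * vector_derivative \<delta> (at t within {0..1}))
        has_integral D w) {0..1}"
    by blast
  have Da: "D analytic_on {1}"
    using D(1) d(1) analytic_on_open[of W] analytic_on_subset[of D W "{1}"] by (auto simp: W_def)
  define \<rho> where "\<rho> = min (Re \<zeta>0) (ln (d / 2))"
  have "has_L \<beta> S F (spiral_curve \<delta> \<zeta>0 \<zeta>) (exp (- \<beta> * (m 0 + Ln (1 + exp \<zeta>))) * (D (1 + exp \<zeta>) +
          contour_integral (linepath \<zeta>0 \<zeta>) (spiral_kernel \<beta> \<kappa> ?f \<zeta>)))" if \<zeta>: "Re \<zeta> < \<rho>" for \<zeta>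
  proof -
    let ?g = "spiral_curve \<delta> \<zeta>0 \<zeta>"
    let ?w = "1 + exp \<zeta>"
    let ?x = "\<lambda>t. linepath \<zeta>0 \<zeta> (2 * t - 1)"
    have Rz: "Re \<zeta> < Re \<zeta>0" using \<zeta> by (simp add: \<rho>_def)
    have w: "?w \<in> W"
    proof -
      have "exp (Re \<zeta>) < exp (ln (d / 2))" using \<zeta> by (simp add: \<rho>_def)
      then show ?thesis using d(1) by (simp add: W_def dist_norm)
    qed
    have Rx: "Re \<zeta> < Re (?x t)" if "t < 1" for t
    proof -
      have "Re (?x t) - Re \<zeta> = 2 * (1 - t) * (Re \<zeta>0 - Re \<zeta>)"
        by (simp add: linepath_def algebra_simps)
      moreover have "2 * (1 - t) * (Re \<zeta>0 - Re \<zeta>) > 0" using that Rz by simp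
      ultimately show ?thesis by linarith
    qed
    \<comment> \<open>The branch of \<open>ln (w - s)\<close> along the curve. On \<open>\<delta>\<close> it is \<open>ln (1 - s)\<close> plus a small correction,
      which makes its value at the join a function of \<open>w\<close>.\<close>
    define l where "l t = (if t \<le> 1/2 then m (2 * t) + Ln (1 + exp \<zeta> / (1 - \<delta> (2 * t)))
        else ?x t + \<kappa> + Ln (1 - exp (\<zeta> - ?x t)))" for t
    have kl: "exp (\<beta> * l t) = exp (\<beta> * m (2 * t)) * k ?w (\<delta> (2 * t))" if "t \<le> 1/2" for t
      using that by (simp add: l_def k_def distrib_left exp_add)
    have lc: "continuous_on {0..<1} l"
      unfolding l_def
    proof (rule continuous_on_cases_le)
      have sub: "{t \<in> {0..<1}. t \<le> 1/2} = {0..1/2::real}" "{t \<in> {0..<1}. 1/2 \<le> t} = {1/2..<1::real}" by auto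
      have \<delta>2: "continuous_on {0..1/2} (\<lambda>t. \<delta> (2 * t))" "continuous_on {0..1/2} (\<lambda>t. m (2 * t))"
        by (auto intro!: continuous_on_compose2[OF \<delta>c] continuous_on_compose2[OF m(1)] continuous_intros)
      have "continuous_on {0..1/2} (\<lambda>t. 1 + exp \<zeta> / (1 - \<delta> (2 * t)))"
        by (intro continuous_on_add continuous_on_divide continuous_on_diff continuous_on_const \<delta>2)
            (use ne1 in force)
      then have "continuous_on {0..1/2} (\<lambda>t. Ln (1 + exp \<zeta> / (1 - \<delta> (2 * t))))"
      proof (rule continuous_on_Ln')
        show "1 + exp \<zeta> / (1 - \<delta> (2 * t)) \<notin> \<real>\<^sub>\<le>\<^sub>0" if "t \<in> {0..1/2}" for t
          using quot(1)[OF w \<delta>V[of "2 * t"]] that by simp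
      qed
      then show "continuous_on {t \<in> {0..<1}. t \<le> 1/2} (\<lambda>t. m (2 * t) + Ln (1 + exp \<zeta> / (1 - \<delta> (2 * t))))"
        unfolding sub by (intro continuous_on_add \<delta>2)
      have xc: "continuous_on {1/2..<1} ?x"
        unfolding linepath_def by (intro continuous_intros)
      have "continuous_on {1/2..<1} (\<lambda>t. Ln (1 - exp (\<zeta> - ?x t)))"
      proof (rule continuous_on_Ln')
        show "continuous_on {1/2..<1} (\<lambda>t. 1 - exp (\<zeta> - ?x t))" by (intro continuous_intros xc)
        show "1 - exp (\<zeta> - ?x t) \<notin> \<real>\<^sub>\<le>\<^sub>0" if "t \<in> {1/2..<1}" for t
          using Re_one_minus_exp_pos[OF Rx[of t]] that unfolding complex_nonpos_Reals_iff by auto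
      qed
      then show "continuous_on {t \<in> {0..<1}. 1/2 \<le> t} (\<lambda>t. ?x t + \<kappa> + Ln (1 - exp (\<zeta> - ?x t)))"
        unfolding sub by (intro continuous_on_add xc continuous_on_const)
      show "m (2 * t) + Ln (1 + exp \<zeta> / (1 - \<delta> (2 * t))) = ?x t + \<kappa> + Ln (1 - exp (\<zeta> - ?x t))"
        if "t \<in> {0..<1}" "t = 1/2" for t :: real
      proof -
        have t2: "2 * t = 1" using that by simp
        have xt: "?x t = \<zeta>0" unfolding t2 by (simp add: linepath_def)
        have q: "1 + exp \<zeta> / (1 - \<delta> (2 * t)) = 1 - exp (\<zeta> - \<zeta>0)"
          unfolding t2 by (simp add: \<delta>1 exp_diff)
        show ?thesis unfolding xt q unfolding t2 \<kappa>_def by simp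
      qed
    qed (intro continuous_intros)
    have gl: "exp (l t) = ?g 1 - ?g t" if t: "t \<in> {0..<1}" for t
    proof (cases "t \<le> 1/2")
      case True
      have d2: "\<delta> (2 * t) \<noteq> 1" "2 * t \<in> {0..1}" using ne1[of "2 * t"] t True by auto
      have "exp (l t) = (1 - \<delta> (2 * t)) * (1 + exp \<zeta> / (1 - \<delta> (2 * t)))"
        using True m(2)[OF d2(2)] quot(3)[OF w \<delta>V[OF d2(2)]] by (simp add: l_def exp_add)
      also have "\<dots> = 1 + exp \<zeta> - \<delta> (2 * t)" using d2(1) by (simp add: field_simps)
      also have "\<dots> = ?g 1 - ?g t" using True by (simp add: spiral_curve_1)
          (simp add: spiral_curve_def joinpaths_def)
      finally show ?thesis .
    next
      case False
      have "1 - exp (\<zeta> - ?x t) \<noteq> 0" using Re_one_minus_exp_pos[OF Rx[of t]] t by force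
      then have "exp (l t) = - (exp (?x t) * (1 - exp (\<zeta> - ?x t)))"
        using False \<kappa> by (simp add: l_def exp_add)
      also have "\<dots> = exp \<zeta> - exp (?x t)" by (simp add: algebra_simps exp_diff)
      also have "\<dots> = ?g 1 - ?g t" using False by (simp add: spiral_curve_1)
          (simp add: spiral_curve_def joinpaths_def)
      finally show ?thesis .
    qed
    let ?G = "\<lambda>t. F (curve_class S (Some \<circ> subpath 0 t ?g)) * exp (\<beta> * l t) * vector_derivative ?g
        (at t within {0..1})"
    let ?S = "contour_integral (linepath \<zeta>0 \<zeta>) (spiral_kernel \<beta> \<kappa> ?f \<zeta>)"
    have left: "(?G has_integral D ?w) {0..1/2}"
    proof -
      let ?J = "\<lambda>t. (?\<Phi> t * exp (\<beta> * m t)) * k ?w (\<delta> t) * vector_derivative \<delta> (at t within {0..1})"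
      obtain K where K: "finite K" "\<And>t. t \<in> {0..1} - K \<Longrightarrow> \<delta> differentiable at t"
        using vp by (auto simp: valid_path_def piecewise_C1_differentiable_on_def C1_differentiable_on_eq)
      have "((\<lambda>t. ?J (2 * t)) has_integral (D ?w / 2)) {0..1/2}"
        using has_integral_affinity01[OF D(2)[OF w], where m = 2 and c = 0] by (simp add: scaleR_conv_of_real)
      then have "((\<lambda>t. 2 * ?J (2 * t)) has_integral (2 * (D ?w / 2))) {0..1/2}"
          by (rule has_integral_mult_right)
      then have "((\<lambda>t. 2 * ?J (2 * t)) has_integral D ?w) {0..1/2}" by simp
      then show ?thesis
      proof (rule has_integral_spike_finite[of "{0, 1/2} \<union> (\<lambda>t. t / 2) ` K", rotated 2])
        show "finite ({0, 1/2} \<union> (\<lambda>t. t / 2) ` K)" using K(1) by simp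
        fix t assume "t \<in> {0..1/2} - ({0, 1/2} \<union> (\<lambda>t. t / 2) ` K)"
        then have t: "0 < t" "t < 1/2" "2 * t \<notin> K" by (auto simp: image_iff mult.commute)
        have 1: "curve_class S (Some \<circ> subpath 0 t ?g) = curve_class S (Some \<circ> subpath 0 (2 * t) \<delta>)"
          using t Rz by (intro curve_class_subpath_spiral_curve_left[OF L]) auto
        have 2: "vector_derivative ?g (at t within {0..1})
            = 2 * vector_derivative \<delta> (at (2 * t) within {0..1})"
          unfolding spiral_curve_def by (rule vector_derivative_join_left[OF K t])
        have 3: "exp (\<beta> * l t) = exp (\<beta> * m (2 * t)) * k ?w (\<delta> (2 * t))"
          using t by (intro kl) simp
        show "?G t = 2 * ?J (2 * t)"
          unfolding 1 2 3 by (simp only: mult_ac)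
      qed
    qed
    have right: "(?G has_integral ?S) {1/2..1}"
    proof -
      have "spiral_kernel \<beta> \<kappa> ?f \<zeta> contour_integrable_on linepath \<zeta>0 \<zeta>"
        using Rz by (intro contour_integrable_spiral_kernel[OF \<beta> fc fh]) (auto simp: half_strip_def)
      then have "(spiral_kernel \<beta> \<kappa> ?f \<zeta> has_contour_integral ?S) (linepath \<zeta>0 \<zeta>)"
        by (rule has_contour_integral_integral)
      then have "((\<lambda>t. spiral_kernel \<beta> \<kappa> ?f \<zeta> (linepath \<zeta>0 \<zeta> t) * (\<zeta> - \<zeta>0)) has_integral ?S) {0..1}"
        by (simp add: has_contour_integral_linepath)
      from has_integral_affinity01[OF this, where m = 2 and c = "-1"]
      have "((\<lambda>t. spiral_kernel \<beta> \<kappa> ?f \<zeta> (?x t) * (\<zeta> - \<zeta>0)) has_integral (?S / 2)) {1/2..1}"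
        by (simp add: image_affinity_atLeastAtMost_div scaleR_conv_of_real)
      then have "((\<lambda>t. 2 * (spiral_kernel \<beta> \<kappa> ?f \<zeta> (?x t) * (\<zeta> - \<zeta>0))) has_integral (2 * (?S / 2))) {1/2..1}"
        by (rule has_integral_mult_right)
      then have "((\<lambda>t. 2 * (spiral_kernel \<beta> \<kappa> ?f \<zeta> (?x t) * (\<zeta> - \<zeta>0))) has_integral ?S) {1/2..1}" by simp
      then show ?thesis
      proof (rule has_integral_spike_finite[of "{1/2, 1}", rotated 2])
        fix t :: real assume "t \<in> {1/2..1} - {1/2, 1}"
        then have t: "1/2 < t" "t < 1" by auto
        have 1: "curve_class S (Some \<circ> subpath 0 t ?g) = log_point S \<delta> \<zeta>0 (?x t)"
          using t Rz by (intro curve_class_subpath_spiral_curve_right[OF L]) auto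
        have 2: "vector_derivative ?g (at t within {0..1}) = 2 * (exp (?x t) * (\<zeta> - \<zeta>0))"
          by (rule vector_derivative_spiral[OF t])
        have "1 - exp (\<zeta> - ?x t) \<noteq> 0" using Re_one_minus_exp_pos[OF Rx[OF t(2)]] by force
        then have 3: "exp (\<beta> * l t) = exp (\<beta> * (?x t + \<kappa>)) * (1 - exp (\<zeta> - ?x t)) powr \<beta>"
          using t by (simp add: l_def powr_def distrib_left exp_add)
        show "?G t = 2 * (spiral_kernel \<beta> \<kappa> ?f \<zeta> (?x t) * (\<zeta> - \<zeta>0))"
          unfolding 1 2 3 spiral_kernel_def by (simp only: mult_ac)
      qed simp
    qed
    have "(?G has_integral (D ?w + ?S)) {0..1}"
      by (rule has_integral_combine[OF _ _ left right]) auto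
    moreover have "l 0 = m 0 + Ln (1 + exp \<zeta>)" by (simp add: l_def \<delta>0)
    ultimately show ?thesis
      unfolding has_L_def using lc gl by (intro exI[of _ l] exI[of _ "D ?w + ?S"]) simp
  qed
  then show ?thesis using \<kappa> Da by (intro exI[of _ \<kappa>] exI[of _ "m 0"] exI[of _ D] exI[of _ \<rho>]) auto
qed

text \<open>
  From \<open>1 - (2 * z - z\<^sup>2) = (z - 1)\<^sup>2\<close>: the difference \<open>\<zeta> u - 2 * u\<close> is continuous with values in a
  discrete set.
\<close>
lemma double_cover_lift:
  assumes c: "continuous_on {u. Re u < \<rho>} \<zeta>"
    and e: "\<And>u. Re u < \<rho> \<Longrightarrow> 1 + exp (\<zeta> u) = 2 * (1 + exp u) - (1 + exp u)\<^sup>2"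
  shows "\<exists>v. \<forall>u. Re u < \<rho> \<longrightarrow> \<zeta> u = 2 * u + v"
proof -
  let ?U = "{u. Re u < \<rho>}"
  have exp: "exp (\<zeta> u - 2 * u) = -1" if "Re u < \<rho>" for u
  proof -
    have "exp (\<zeta> u) = - (exp u)\<^sup>2" using e[OF that] by (simp add: power2_eq_square algebra_simps add_eq_0_iff)
    also have "(exp u)\<^sup>2 = exp (2 * u)" by (simp add: exp_double)
    finally show ?thesis by (simp add: exp_diff)
  qed
  have "(\<lambda>u. \<zeta> u - 2 * u) constant_on ?U"
  proof (rule continuous_discrete_range_constant)
    show "connected ?U" by (simp add: convex_connected convex_halfspace_Re_lt)
    show "continuous_on ?U (\<lambda>u. \<zeta> u - 2 * u)" by (intro continuous_intros c)
    fix x assume x: "x \<in> ?U"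
    have "2 * pi \<le> norm (\<zeta> y - 2 * y - (\<zeta> x - 2 * x))"
      if y: "y \<in> ?U" "\<zeta> y - 2 * y \<noteq> \<zeta> x - 2 * x" for y
    proof -
      have "exp (\<zeta> y - 2 * y) = exp (\<zeta> x - 2 * x)" using exp x y by simp
      then obtain n :: int where n: "\<zeta> y - 2 * y = \<zeta> x - 2 * x + of_int (2 * n) * pi * \<i>"
        unfolding exp_eq by blast
      then have "n \<noteq> 0" using y by auto
      then have "1 \<le> \<bar>real_of_int n\<bar>" by linarith
      moreover have "norm (\<zeta> y - 2 * y - (\<zeta> x - 2 * x)) = 2 * pi * \<bar>real_of_int n\<bar>"
        unfolding n by (simp add: norm_mult)
      ultimately show ?thesis by (simp add: mult_le_cancel_left1)
    qed
    then show "\<exists>e>0. \<forall>y. y \<in> ?U \<and> \<zeta> y - 2 * y \<noteq> \<zeta> x - 2 * x \<longrightarrow> e \<le> norm (\<zeta> y - 2 * y - (\<zeta> x - 2 * x))"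
      by (intro exI[of _ "2 * pi"]) auto
  qed
  then obtain v where v: "\<And>u. u \<in> ?U \<Longrightarrow> \<zeta> u - 2 * u = v" unfolding constant_on_def by blast
  then have "\<zeta> u = 2 * u + v" if "Re u < \<rho>" for u
    using v[of u] that by (simp add: algebra_simps)
  then show ?thesis by blast
qed

text \<open>
  All curves in a class have the same end point.
\<close>
lemma puncture_of_boundary_point:
  assumes "\<omega> \<in> Omega_boundary S" "\<omega> \<in> fibre S (Some 1)"
  shows "Some 1 \<in> S"
proof -
  obtain p \<gamma> where p: "p \<in> S" "\<omega> = curve_class S \<gamma>" "\<gamma> \<in> curves S" "\<gamma> 1 = p"
    using assms(1) unfolding Omega_boundary_def fibre_def by blast
  obtain \<eta> where \<eta>: "\<omega> = curve_class S \<eta>" "\<eta> \<in> curves S" "\<eta> 1 = Some 1"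
    using assms(2) unfolding fibre_def by blast
  have "(\<gamma>, \<gamma>) \<in> homotopic_curves S"
    using p(3) by (auto simp: homotopic_curves_def homotopic_with_refl curves_def pathin_def)
  then have "\<gamma> \<in> curve_class S \<eta>" using p(2) \<eta>(1) by (auto simp: curve_class_def)
  then have "homotopic_with (\<lambda>\<kappa>. \<kappa> \<in> curves S \<and> \<kappa> 1 = \<eta> 1) (top_of_set {0..1}) riemann_sphere \<eta> \<gamma>"
    by (simp add: curve_class_def homotopic_curves_def)
  from homotopic_with_imp_property[OF this] have "\<gamma> 1 = Some 1" using \<eta>(3) by simp
  then show ?thesis using p by simp
qed

lemma L_comp_analytic_at_1_phi0:
  assumes S: "discrete_punctures S" and F: "analytic_on_Omega S F" and S1: "Some 1 \<in> S"
    and \<beta>: "Re \<beta> > 0" and c: "c * exp (2 * of_real pi * \<i> * \<beta>) = -1" and N: "N \<le> Re \<beta>"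
    and mono: "\<And>\<delta> \<zeta>0. log_coordinate S \<omega> \<delta> \<zeta>0 \<Longrightarrow> \<exists>B \<rho>. B analytic_on {1} \<and> (\<forall>x. Re x < \<rho> \<longrightarrow>
          F (log_point S \<delta> \<zeta>0 (x + 2 * of_real pi * \<i>)) = c * F (log_point S \<delta> \<zeta>0 x) + B (1 + exp x))"
    and growth: "\<And>\<delta> \<zeta>0 M. log_coordinate S \<omega> \<delta> \<zeta>0 \<Longrightarrow> \<exists>C \<rho>. \<forall>x. Re x < \<rho> \<and> \<bar>Im x\<bar> \<le> M \<longrightarrow>
          norm (F (log_point S \<delta> \<zeta>0 x)) \<le> C * exp (- N * Re x)"
  shows "L_comp_analytic_at_1 \<beta> S F \<omega> (\<lambda>z. 2 * z - z\<^sup>2)"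
  unfolding L_comp_analytic_at_1_def
proof (intro allI impI, elim conjE)
  let ?\<phi> = "\<lambda>z::complex. 2 * z - z\<^sup>2"
  fix \<delta> \<zeta>0 \<zeta> \<rho>
  assume L: "log_coordinate S \<omega> \<delta> \<zeta>0" and \<zeta>: "continuous_on {u. Re u < \<rho>} \<zeta>"
    "\<forall>u. Re u < \<rho> \<longrightarrow> 1 + exp (\<zeta> u) = ?\<phi> (1 + exp u)"
  let ?f = "\<lambda>x. F (log_point S \<delta> \<zeta>0 x)"
  obtain v where v: "\<And>u. Re u < \<rho> \<Longrightarrow> \<zeta> u = 2 * u + v"
    using double_cover_lift[OF \<zeta>(1)] \<zeta>(2) by blast
  obtain \<kappa> m0 D \<rho>1 where D: "exp \<kappa> = -1" "D analytic_on {1}" "\<And>\<zeta>. Re \<zeta> < \<rho>1 \<Longrightarrow>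
      has_L \<beta> S F (spiral_curve \<delta> \<zeta>0 \<zeta>)
        (exp (- \<beta> * (m0 + Ln (1 + exp \<zeta>))) * (D (1 + exp \<zeta>) +
          contour_integral (linepath \<zeta>0 \<zeta>) (spiral_kernel \<beta> \<kappa> ?f \<zeta>)))"
    using has_L_spiral_curve[OF S F S1 L \<beta>] by blast
  obtain B \<rho>2 where B: "B analytic_on {1}"
    "\<And>x. Re x < \<rho>2 \<Longrightarrow> ?f (x + 2 * of_real pi * \<i>) = c * ?f x + B (1 + exp x)"
    using mono[OF L] by blast
  obtain H \<rho>3 where H: "H analytic_on {1}" "\<And>u. Re u < \<rho>3 \<Longrightarrow>
      contour_integral (linepath \<zeta>0 (2 * u + v)) (spiral_kernel \<beta> \<kappa> ?f (2 * u + v)) = H (1 + exp u)"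
    using spiral_integral_double_cover_analytic[OF \<beta> D(1) log_point_continuous_holomorphic[OF F L] B c N
        growth[OF L], where v = v]
    by blast
  define G where "G z = exp (- \<beta> * (m0 + Ln (?\<phi> z))) * (D (?\<phi> z) + H z)" for z
  have \<phi>: "?\<phi> analytic_on {1}" by (intro analytic_intros)
  have "D analytic_on ?\<phi> ` {1}" using D(2) by simp
  then have D\<phi>: "(\<lambda>z. D (?\<phi> z)) analytic_on {1}"
    using analytic_on_compose[OF \<phi>, of D] by (simp add: o_def)
  have "(\<lambda>z. Ln (?\<phi> z)) analytic_on {1}"
    by (rule analytic_on_ln[OF \<phi>]) auto
  then have "G analytic_on {1}"
    unfolding G_def by (intro analytic_intros D\<phi> H(1)) auto
  moreover have "has_L \<beta> S F (spiral_curve \<delta> \<zeta>0 (\<zeta> u)) (G (1 + exp u))"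
    if u: "Re u < min \<rho> (min ((\<rho>1 - Re v) / 2) \<rho>3)" for u
  proof -
    have z: "\<zeta> u = 2 * u + v" using u by (intro v) simp
    have "Re (\<zeta> u) < \<rho>1" unfolding z using u by simp
    note hL = D(3)[OF this]
    \<comment> \<open>The point \<open>w = 1 + exp (\<zeta> u)\<close> is \<open>\<phi> z\<close> for \<open>z = 1 + exp u\<close>.\<close>
    have e: "1 + exp (\<zeta> u) = ?\<phi> (1 + exp u)" using \<zeta>(2) u by simp
    have "contour_integral (linepath \<zeta>0 (\<zeta> u)) (spiral_kernel \<beta> \<kappa> ?f (\<zeta> u)) = H (1 + exp u)"
      unfolding z using u by (intro H(2)) simp
    then show ?thesis using hL unfolding e G_def by simp
  qed
  ultimately show "\<exists>G \<rho>'. G analytic_on {1} \<and>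
      (\<forall>u. Re u < \<rho>' \<longrightarrow> has_L \<beta> S F (spiral_curve \<delta> \<zeta>0 (\<zeta> u)) (G (1 + exp u)))"
    by blast
qed

theorem theorem33:
  fixes S :: "complex option set"
    and F :: "surface_point \<Rightarrow> complex"
    and \<omega> :: surface_point
  assumes "discrete_punctures S"
    and "analytic_on_Omega S F"
    and "\<omega> \<in> Omega_boundary S"
    and "\<omega> \<in> fibre S (Some 1)"
    and "elementary_singularity S F \<omega>"
  shows "\<exists>\<beta> \<phi>. Re \<beta> > -1 \<and> rational_map \<phi> \<and>
           L_comp_analytic_at_0 \<beta> S F \<phi> \<and> L_comp_analytic_at_1 \<beta> S F \<omega> \<phi>"
proof -
  obtain \<beta> c N where \<beta>: "Re \<beta> > 0" and c: "c * exp (2 * of_real pi * \<i> * \<beta>) = -1" and N: "N \<le> Re \<beta>"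
    and mono: "\<And>\<delta> \<zeta>0. log_coordinate S \<omega> \<delta> \<zeta>0 \<Longrightarrow> \<exists>B \<rho>. B analytic_on {1} \<and> (\<forall>x. Re x < \<rho> \<longrightarrow>
          F (log_point S \<delta> \<zeta>0 (x + 2 * of_real pi * \<i>)) = c * F (log_point S \<delta> \<zeta>0 x) + B (1 + exp x))"
    and growth: "\<And>\<delta> \<zeta>0 M. log_coordinate S \<omega> \<delta> \<zeta>0 \<Longrightarrow> \<exists>C \<rho>. \<forall>x. Re x < \<rho> \<and> \<bar>Im x\<bar> \<le> M \<longrightarrow>
          norm (F (log_point S \<delta> \<zeta>0 x)) \<le> C * exp (- N * Re x)"
    using elementary_singularity_monodromy[OF assms(5)] by blast
  have "Some 1 \<in> S" using puncture_of_boundary_point[OF assms(3,4)] .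
  then have "L_comp_analytic_at_1 \<beta> S F \<omega> (\<lambda>z. 2 * z - z\<^sup>2)"
    using L_comp_analytic_at_1_phi0[OF assms(1,2) _ \<beta> c N mono growth] by blast
  moreover have "L_comp_analytic_at_0 \<beta> S F (\<lambda>z. 2 * z - z\<^sup>2)"
    using L_comp_analytic_at_0_phi0[OF assms(2) \<beta>] .
  moreover have "Re \<beta> > -1" using \<beta> by simp
  ultimately show ?thesis using rational_map_phi0 by blast
qed

end
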